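(* Let $m\ge 3$ and let $W$ be the Coxeter group of type $I_2(m)$ (the dihedral group of order $2m$), with associated Artin group $B$. For every field $\mathbf{k}$ of characteristic $0$ there exists a morphism of Hopf algebras $\widetilde{\Phi}:\mathbf{k}B\to\mathfrak{B}(\mathbf{k})$ satisfying the fundamental condition, that is: there exist $\lambda,\mu\in\mathbf{k}\setminus\{0\}$ and grouplike elements $g,h\in\mathcal{A}(\mathbf{k})$ such that $$\widetilde{\Phi}(\sigma)=g\,\bigl(s\exp(\lambda\mathsf{t}_0)\bigr)\,g^{-1},\qquad \widetilde{\Phi}(\tau)=h\,\bigl(\omega s\exp(\mu\mathsf{t}_1)\bigr)\,h^{-1}.$$
   Context: $W=\langle s,\omega\mid s^2=\omega^m=1,\ s\omega=\omega^{-1}s\rangle$; it is a Coxeter group with simple reflections $s$ and $s'=\omega s$, acting on $\mathbb{R}^2$ with $s=\mathrm{diag}(1,-1)$ and $\omega$ the rotation of angle $2\pi/m$. The Artin group is $B=\langle\sigma,\tau\mid \sigma\tau\sigma\cdots=\tau\sigma\tau\cdots\ (m\text{ factors on each side})\rangle$, with projection $\pi:B\to W$, $\sigma\mapsto s$, $\tau\mapsto s'=\omega s$. $\mathfrak{g}$ is the Lie algebra over $\mathbf{k}$ with generators $\mathsf{t}_0,\dots,\mathsf{t}_{m-1}$ (indices taken modulo $m$) and the relations saying that $T=\mathsf{t}_0+\dots+\mathsf{t}_{m-1}$ is central. (The generator $\mathsf{t}_r$ corresponds to the line spanned by $(\cos(r\pi/m),\sin(r\pi/m))$, which is the fixed line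 of the reflection $\omega^r s$; so $\mathsf{t}_0$ corresponds to $s$ and $\mathsf{t}_1$ to $\omega s$.) $\mathfrak{g}$ is graded by $\deg\mathsf{t}_r=1$, and $\mathcal{A}(\mathbf{k})$ is the completion of the enveloping algebra $\mathsf{U}\mathfrak{g}$ with respect to this grading, a complete Hopf algebra in which the $\mathsf{t}_r$ are primitive. $W$ acts on $\mathcal{A}(\mathbf{k})$ by $s\cdot\mathsf{t}_r=\mathsf{t}_{-r}$, $\omega\cdot\mathsf{t}_r=\mathsf{t}_{r+2}$, and $\mathfrak{B}(\mathbf{k})=\mathbf{k}W\ltimes\mathcal{A}(\mathbf{k})$ is the semidirect product complete Hopf algebra, in which the elements of $W$ are grouplike. A morphism of Hopf algebras $\mathbf{k}B\to\mathfrak{B}(\mathbf{k})$ is a $\mathbf{k}$-algebra morphism sending the elements of $B$ to grouplike elements of $\mathfrak{B}(\mathbf{k})$. The general form of the fundamental condition is: for each Artin generator $\sigma_i$ with image the simple reflection $s_i$, and $\mathsf{t}_i$ the generator associated to the hyperplane $\ker(s_i-1)$, there is $\lambda\in\mathbf{k}\setminus\{0\}$ such that $\widetilde\Phi(\sigma_i)$ is conjugate to $s_i\exp(\lambda\mathsf{t}_i)$ by a grouplike element of the completed enveloping algebra. *)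

theory Defs
  imports "HOL-Algebra.Module"
begin

section \<open>Groups given by generators and relations\<close>

text \<open>A letter is a generator paired with \<^term>\<open>True\<close>, or with \<^term>\<open>False\<close> for its formal inverse.\<close>

type_synonym 'x gword = "('x \<times> bool) list"

inductive gword_eq :: "('x gword \<times> 'x gword) set \<Rightarrow> 'x gword \<Rightarrow> 'x gword \<Rightarrow> bool"
  for R where
  refl: "gword_eq R u u"
| sym: "gword_eq R u v \<Longrightarrow> gword_eq R v u"
| trans: "gword_eq R u v \<Longrightarrow> gword_eq R v w \<Longrightarrow> gword_eq R u w"
| cancel: "gword_eq R (u @ [(x, b), (x, \<not> b)] @ v) (u @ v)"
| rel: "(l, r) \<in> R \<Longrightarrow> gword_eq R (u @ l @ v) (u @ r @ v)"

definition gword_class :: "('x gword \<times> 'x gword) set \<Rightarrow> 'x gword \<Rightarrow> 'x gword set" where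
  "gword_class R u = {v. gword_eq R u v}"

definition presented_group :: "('x gword \<times> 'x gword) set \<Rightarrow> 'x gword set monoid" where
  "presented_group R =
    \<lparr>carrier = range (gword_class R),
     mult = (\<lambda>C D. \<Union>u\<in>C. \<Union>v\<in>D. gword_class R (u @ v)),
     one = gword_class R []\<rparr>"


section \<open>Algebras over a field\<close>

text \<open>Scalars range over a type \<open>'k\<close> of class \<^class>\<open>field\<close>; a \<open>'k\<close>-algebra (associative, unital, not
  necessarily commutative) is carried by the record type of \<^theory>\<open>HOL-Algebra.Module\<close>.\<close>

definition alg_hom :: "('k, 'a) module \<Rightarrow> ('k, 'b) module \<Rightarrow> ('a \<Rightarrow> 'b) set" where
  "alg_hom A B =
    {f \<in> ring_hom A B. \<forall>c. \<forall>x\<in>carrier A. f (c \<odot>\<^bsub>A\<^esub> x) = c \<odot>\<^bsub>B\<^esub> f x}"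

definition ground_algebra :: "('k::field, 'k) module" where
  "ground_algebra =
    \<lparr>carrier = UNIV, mult = (*), one = 1, zero = 0, add = (+), smult = (*)\<rparr>"

subsection \<open>Group algebras\<close>

definition group_algebra :: "'g monoid \<Rightarrow> ('k::field, 'g \<Rightarrow> 'k) module" where
  "group_algebra G =
    \<lparr>carrier = {f. finite {x. f x \<noteq> 0} \<and> {x. f x \<noteq> 0} \<subseteq> carrier G},
     mult = (\<lambda>f f' x. \<Sum>(u, v) | f u \<noteq> 0 \<and> f' v \<noteq> 0 \<and> u \<otimes>\<^bsub>G\<^esub> v = x. f u * f' v),
     one = (\<lambda>x. if x = \<one>\<^bsub>G\<^esub> then 1 else 0),
     zero = (\<lambda>x. 0),
     add = (\<lambda>f f' x. f x + f' x),
     smult = (\<lambda>c f x. c * f x)\<rparr>"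

definition group_elem :: "'g \<Rightarrow> 'g \<Rightarrow> 'k::field" where
  "group_elem u = (\<lambda>x. if x = u then 1 else 0)"

subsection \<open>Algebras given by generators and relations\<close>

datatype ('k, alg_gens: 'x) alg_term =
    AGen 'x
  | AZero
  | AOne
  | AAdd "('k, 'x) alg_term" "('k, 'x) alg_term"
  | ASmult 'k "('k, 'x) alg_term"
  | AMult "('k, 'x) alg_term" "('k, 'x) alg_term"

inductive alg_eq ::
  "(('k::field, 'x) alg_term \<times> ('k, 'x) alg_term) set \<Rightarrow>
   ('k, 'x) alg_term \<Rightarrow> ('k, 'x) alg_term \<Rightarrow> bool"
  for R where
  refl: "alg_eq R a a"
| sym: "alg_eq R a b \<Longrightarrow> alg_eq R b a"
| trans: "alg_eq R a b \<Longrightarrow> alg_eq R b c \<Longrightarrow> alg_eq R a c"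
| rel: "(a, b) \<in> R \<Longrightarrow> alg_eq R a b"
| cong_add: "alg_eq R a a' \<Longrightarrow> alg_eq R b b' \<Longrightarrow> alg_eq R (AAdd a b) (AAdd a' b')"
| cong_smult: "alg_eq R a a' \<Longrightarrow> alg_eq R (ASmult c a) (ASmult c a')"
| cong_mult: "alg_eq R a a' \<Longrightarrow> alg_eq R b b' \<Longrightarrow> alg_eq R (AMult a b) (AMult a' b')"
| add_assoc: "alg_eq R (AAdd (AAdd a b) c) (AAdd a (AAdd b c))"
| add_comm: "alg_eq R (AAdd a b) (AAdd b a)"
| add_zero: "alg_eq R (AAdd AZero a) a"
| add_neg: "alg_eq R (AAdd a (ASmult (- 1) a)) AZero"
| smult_one: "alg_eq R (ASmult 1 a) a"
| smult_smult: "alg_eq R (ASmult c (ASmult d a)) (ASmult (c * d) a)"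
| smult_add_left: "alg_eq R (ASmult (c + d) a) (AAdd (ASmult c a) (ASmult d a))"
| smult_add_right: "alg_eq R (ASmult c (AAdd a b)) (AAdd (ASmult c a) (ASmult c b))"
| mult_assoc: "alg_eq R (AMult (AMult a b) c) (AMult a (AMult b c))"
| mult_one_left: "alg_eq R (AMult AOne a) a"
| mult_one_right: "alg_eq R (AMult a AOne) a"
| mult_add_left: "alg_eq R (AMult (AAdd a b) c) (AAdd (AMult a c) (AMult b c))"
| mult_add_right: "alg_eq R (AMult a (AAdd b c)) (AAdd (AMult a b) (AMult a c))"
| mult_smult_left: "alg_eq R (AMult (ASmult c a) b) (ASmult c (AMult a b))"
| mult_smult_right: "alg_eq R (AMult a (ASmult c b)) (ASmult c (AMult a b))"

definition alg_class ::
  "'x set \<Rightarrow> (('k::field, 'x) alg_term \<times> ('k, 'x) alg_term) set \<Rightarrow>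
   ('k, 'x) alg_term \<Rightarrow> ('k, 'x) alg_term set" where
  "alg_class X R a = {b. alg_gens b \<subseteq> X \<and> alg_eq R a b}"

definition presented_algebra ::
  "'x set \<Rightarrow> (('k::field, 'x) alg_term \<times> ('k, 'x) alg_term) set \<Rightarrow>
   ('k, ('k, 'x) alg_term set) module" where
  "presented_algebra X R =
    \<lparr>carrier = alg_class X R ` {a. alg_gens a \<subseteq> X},
     mult = (\<lambda>C D. \<Union>a\<in>C. \<Union>b\<in>D. alg_class X R (AMult a b)),
     one = alg_class X R AOne,
     zero = alg_class X R AZero,
     add = (\<lambda>C D. \<Union>a\<in>C. \<Union>b\<in>D. alg_class X R (AAdd a b)),
     smult = (\<lambda>c C. \<Union>a\<in>C. alg_class X R (ASmult c a))\<rparr>"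

text \<open>If \<open>D n\<close> is the set of generators of degree \<open>n\<close>, the homogeneous part of degree \<open>n\<close> consists
  of the classes of the terms that are visibly homogeneous of degree \<open>n\<close>.\<close>

inductive alg_homogeneous :: "(nat \<Rightarrow> 'x set) \<Rightarrow> nat \<Rightarrow> ('k, 'x) alg_term \<Rightarrow> bool"
  for D where
  "x \<in> D n \<Longrightarrow> alg_homogeneous D n (AGen x)"
| "alg_homogeneous D n AZero"
| "alg_homogeneous D 0 AOne"
| "alg_homogeneous D n a \<Longrightarrow> alg_homogeneous D n b \<Longrightarrow> alg_homogeneous D n (AAdd a b)"
| "alg_homogeneous D n a \<Longrightarrow> alg_homogeneous D n (ASmult c a)"
| "alg_homogeneous D i a \<Longrightarrow> alg_homogeneous D j b \<Longrightarrow> alg_homogeneous D (i + j) (AMult a b)"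

definition alg_part ::
  "'x set \<Rightarrow> (('k::field, 'x) alg_term \<times> ('k, 'x) alg_term) set \<Rightarrow>
   (nat \<Rightarrow> 'x set) \<Rightarrow> nat \<Rightarrow> ('k, 'x) alg_term set set" where
  "alg_part X R D n = alg_class X R ` {a. alg_gens a \<subseteq> X \<and> alg_homogeneous D n a}"

text \<open>\<open>alg_lift A \<phi>\<close> is the algebra morphism from a presented algebra to \<open>A\<close> that extends
  the map \<open>\<phi>\<close> on the generators (meaningful when \<open>\<phi>\<close> respects the relations).\<close>

primrec alg_eval :: "('k, 'a) module \<Rightarrow> ('x \<Rightarrow> 'a) \<Rightarrow> ('k, 'x) alg_term \<Rightarrow> 'a" where
  "alg_eval A \<phi> (AGen x) = \<phi> x"
| "alg_eval A \<phi> AZero = \<zero>\<^bsub>A\<^esub>"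
| "alg_eval A \<phi> AOne = \<one>\<^bsub>A\<^esub>"
| "alg_eval A \<phi> (AAdd a b) = alg_eval A \<phi> a \<oplus>\<^bsub>A\<^esub> alg_eval A \<phi> b"
| "alg_eval A \<phi> (ASmult c a) = c \<odot>\<^bsub>A\<^esub> alg_eval A \<phi> a"
| "alg_eval A \<phi> (AMult a b) = alg_eval A \<phi> a \<otimes>\<^bsub>A\<^esub> alg_eval A \<phi> b"

definition alg_lift :: "('k, 'a) module \<Rightarrow> ('x \<Rightarrow> 'a) \<Rightarrow> ('k, 'x) alg_term set \<Rightarrow> 'a" where
  "alg_lift A \<phi> C = the_elem (alg_eval A \<phi> ` C)"

subsection \<open>Tensor products of algebras\<close>

text \<open>The algebra \<open>A \<otimes> B\<close> is generated by the symbols \<open>a \<otimes> b\<close>, which are bilinear and are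
  multiplied by \<open>(a \<otimes> b) (a' \<otimes> b') = a a' \<otimes> b b'\<close>, with unit \<open>1 \<otimes> 1\<close>.\<close>

definition tensor_gens :: "('k, 'a) module \<Rightarrow> ('k, 'b) module \<Rightarrow> ('a \<times> 'b) set" where
  "tensor_gens A B = carrier A \<times> carrier B"

definition tensor_rels ::
  "('k::field, 'a) module \<Rightarrow> ('k, 'b) module \<Rightarrow>
   (('k, 'a \<times> 'b) alg_term \<times> ('k, 'a \<times> 'b) alg_term) set" where
  "tensor_rels A B =
     {(AGen (a \<oplus>\<^bsub>A\<^esub> a', b), AAdd (AGen (a, b)) (AGen (a', b))) | a a' b.
        a \<in> carrier A \<and> a' \<in> carrier A \<and> b \<in> carrier B}
   \<union> {(AGen (a, b \<oplus>\<^bsub>B\<^esub> b'), AAdd (AGen (a, b)) (AGen (a, b'))) | a b b'.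
        a \<in> carrier A \<and> b \<in> carrier B \<and> b' \<in> carrier B}
   \<union> {(AGen (c \<odot>\<^bsub>A\<^esub> a, b), ASmult c (AGen (a, b))) | c a b.
        a \<in> carrier A \<and> b \<in> carrier B}
   \<union> {(AGen (a, c \<odot>\<^bsub>B\<^esub> b), ASmult c (AGen (a, b))) | c a b.
        a \<in> carrier A \<and> b \<in> carrier B}
   \<union> {(AMult (AGen (a, b)) (AGen (a', b')), AGen (a \<otimes>\<^bsub>A\<^esub> a', b \<otimes>\<^bsub>B\<^esub> b')) | a a' b b'.
        a \<in> carrier A \<and> a' \<in> carrier A \<and> b \<in> carrier B \<and> b' \<in> carrier B}
   \<union> {(AGen (\<one>\<^bsub>A\<^esub>, \<one>\<^bsub>B\<^esub>), AOne)}"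

definition tensor_algebra ::
  "('k::field, 'a) module \<Rightarrow> ('k, 'b) module \<Rightarrow> ('k, ('k, 'a \<times> 'b) alg_term set) module" where
  "tensor_algebra A B = presented_algebra (tensor_gens A B) (tensor_rels A B)"

definition pure_tensor ::
  "('k::field, 'a) module \<Rightarrow> ('k, 'b) module \<Rightarrow> 'a \<Rightarrow> 'b \<Rightarrow> ('k, 'a \<times> 'b) alg_term set" where
  "pure_tensor A B a b = alg_class (tensor_gens A B) (tensor_rels A B) (AGen (a, b))"

text \<open>The total grading, for gradings \<open>P\<close> of \<open>A\<close> and \<open>Q\<close> of \<open>B\<close>.\<close>

definition tensor_part ::
  "('k::field, 'a) module \<Rightarrow> (nat \<Rightarrow> 'a set) \<Rightarrow> ('k, 'b) module \<Rightarrow> (nat \<Rightarrow> 'b set) \<Rightarrow>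
   nat \<Rightarrow> ('k, 'a \<times> 'b) alg_term set set" where
  "tensor_part A P B Q =
     alg_part (tensor_gens A B) (tensor_rels A B) (\<lambda>n. \<Union>i\<le>n. P i \<times> Q (n - i))"

subsection \<open>Completion with respect to a grading\<close>

text \<open>For an algebra \<open>A\<close> graded by the subspaces \<open>P n\<close>, an element of the completion is the sequence
  of its homogeneous components, so the completion is the product of all the \<open>P n\<close>.\<close>

definition completion :: "('k, 'a) module \<Rightarrow> (nat \<Rightarrow> 'a set) \<Rightarrow> ('k, nat \<Rightarrow> 'a) module" where
  "completion A P =
    \<lparr>carrier = {x. \<forall>n. x n \<in> P n},
     mult = (\<lambda>x y n. \<Oplus>\<^bsub>A\<^esub>i\<in>{..n}. x i \<otimes>\<^bsub>A\<^esub> y (n - i)),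
     one = (\<lambda>n. if n = 0 then \<one>\<^bsub>A\<^esub> else \<zero>\<^bsub>A\<^esub>),
     zero = (\<lambda>n. \<zero>\<^bsub>A\<^esub>),
     add = (\<lambda>x y n. x n \<oplus>\<^bsub>A\<^esub> y n),
     smult = (\<lambda>c x n. c \<odot>\<^bsub>A\<^esub> x n)\<rparr>"

definition in_degree :: "('k, 'a) module \<Rightarrow> nat \<Rightarrow> 'a \<Rightarrow> nat \<Rightarrow> 'a" where
  "in_degree A d a = (\<lambda>n. if n = d then a else \<zero>\<^bsub>A\<^esub>)"

text \<open>The exponential of \<open>x\<close> with \<open>x 0 = 0\<close>: the power \<open>x ^ k\<close> starts in degree \<open>k\<close>, so that only
  \<open>k \<le> n\<close> contributes in degree \<open>n\<close>.\<close>

definition completed_exp ::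
  "('k::field_char_0, 'a) module \<Rightarrow> (nat \<Rightarrow> 'a set) \<Rightarrow> (nat \<Rightarrow> 'a) \<Rightarrow> nat \<Rightarrow> 'a" where
  "completed_exp A P x =
     (\<lambda>n. \<Oplus>\<^bsub>A\<^esub>k\<in>{..n}. (1 / fact k) \<odot>\<^bsub>A\<^esub> (x [^]\<^bsub>completion A P\<^esub> k) n)"

subsection \<open>Semidirect products\<close>

text \<open>For a finite group \<open>G\<close> acting on \<open>A\<close> by algebra automorphisms, the function \<open>f\<close> stands for
  the element \<open>\<Sum>w\<in>G. f w \<cdot> w\<close>, and \<open>w \<cdot> a = act w a \<cdot> w\<close>.\<close>

definition semidirect_algebra ::
  "'g monoid \<Rightarrow> ('k, 'a) module \<Rightarrow> ('g \<Rightarrow> 'a \<Rightarrow> 'a) \<Rightarrow> ('k, 'g \<Rightarrow> 'a) module" where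
  "semidirect_algebra G A act =
    \<lparr>carrier = carrier G \<rightarrow>\<^sub>E carrier A,
     mult = (\<lambda>f f'. \<lambda>w\<in>carrier G.
               \<Oplus>\<^bsub>A\<^esub>u\<in>carrier G. f u \<otimes>\<^bsub>A\<^esub> act u (f' (inv\<^bsub>G\<^esub> u \<otimes>\<^bsub>G\<^esub> w))),
     one = (\<lambda>w\<in>carrier G. if w = \<one>\<^bsub>G\<^esub> then \<one>\<^bsub>A\<^esub> else \<zero>\<^bsub>A\<^esub>),
     zero = (\<lambda>w\<in>carrier G. \<zero>\<^bsub>A\<^esub>),
     add = (\<lambda>f f'. \<lambda>w\<in>carrier G. f w \<oplus>\<^bsub>A\<^esub> f' w),
     smult = (\<lambda>c f. \<lambda>w\<in>carrier G. c \<odot>\<^bsub>A\<^esub> f w)\<rparr>"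

definition semidirect_group_elem :: "'g monoid \<Rightarrow> ('k, 'a) module \<Rightarrow> 'g \<Rightarrow> 'g \<Rightarrow> 'a" where
  "semidirect_group_elem G A u = (\<lambda>w\<in>carrier G. if w = u then \<one>\<^bsub>A\<^esub> else \<zero>\<^bsub>A\<^esub>)"

definition semidirect_alg_elem :: "'g monoid \<Rightarrow> ('k, 'a) module \<Rightarrow> 'a \<Rightarrow> 'g \<Rightarrow> 'a" where
  "semidirect_alg_elem G A a = (\<lambda>w\<in>carrier G. if w = \<one>\<^bsub>G\<^esub> then a else \<zero>\<^bsub>A\<^esub>)"


section \<open>Lie algebras\<close>

record ('k, 'a) lie_algebra =
  lie_carrier :: "'a set"
  lie_zero :: 'a
  lie_add :: "'a \<Rightarrow> 'a \<Rightarrow> 'a"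
  lie_smult :: "'k \<Rightarrow> 'a \<Rightarrow> 'a"
  lie_bracket :: "'a \<Rightarrow> 'a \<Rightarrow> 'a"

subsection \<open>Lie algebras given by generators and relations\<close>

datatype ('k, lie_gens: 'x) lie_term =
    LGen 'x
  | LZero
  | LAdd "('k, 'x) lie_term" "('k, 'x) lie_term"
  | LSmult 'k "('k, 'x) lie_term"
  | LBr "('k, 'x) lie_term" "('k, 'x) lie_term"

inductive lie_eq ::
  "(('k::field, 'x) lie_term \<times> ('k, 'x) lie_term) set \<Rightarrow>
   ('k, 'x) lie_term \<Rightarrow> ('k, 'x) lie_term \<Rightarrow> bool"
  for R where
  refl: "lie_eq R a a"
| sym: "lie_eq R a b \<Longrightarrow> lie_eq R b a"
| trans: "lie_eq R a b \<Longrightarrow> lie_eq R b c \<Longrightarrow> lie_eq R a c"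
| rel: "(a, b) \<in> R \<Longrightarrow> lie_eq R a b"
| cong_add: "lie_eq R a a' \<Longrightarrow> lie_eq R b b' \<Longrightarrow> lie_eq R (LAdd a b) (LAdd a' b')"
| cong_smult: "lie_eq R a a' \<Longrightarrow> lie_eq R (LSmult c a) (LSmult c a')"
| cong_br: "lie_eq R a a' \<Longrightarrow> lie_eq R b b' \<Longrightarrow> lie_eq R (LBr a b) (LBr a' b')"
| add_assoc: "lie_eq R (LAdd (LAdd a b) c) (LAdd a (LAdd b c))"
| add_comm: "lie_eq R (LAdd a b) (LAdd b a)"
| add_zero: "lie_eq R (LAdd LZero a) a"
| add_neg: "lie_eq R (LAdd a (LSmult (- 1) a)) LZero"
| smult_one: "lie_eq R (LSmult 1 a) a"
| smult_smult: "lie_eq R (LSmult c (LSmult d a)) (LSmult (c * d) a)"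
| smult_add_left: "lie_eq R (LSmult (c + d) a) (LAdd (LSmult c a) (LSmult d a))"
| smult_add_right: "lie_eq R (LSmult c (LAdd a b)) (LAdd (LSmult c a) (LSmult c b))"
| br_add_left: "lie_eq R (LBr (LAdd a b) c) (LAdd (LBr a c) (LBr b c))"
| br_add_right: "lie_eq R (LBr a (LAdd b c)) (LAdd (LBr a b) (LBr a c))"
| br_smult_left: "lie_eq R (LBr (LSmult c a) b) (LSmult c (LBr a b))"
| br_smult_right: "lie_eq R (LBr a (LSmult c b)) (LSmult c (LBr a b))"
| br_self: "lie_eq R (LBr a a) LZero"
| jacobi: "lie_eq R (LAdd (LBr a (LBr b c)) (LAdd (LBr b (LBr c a)) (LBr c (LBr a b)))) LZero"

definition lie_class ::
  "'x set \<Rightarrow> (('k::field, 'x) lie_term \<times> ('k, 'x) lie_term) set \<Rightarrow>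
   ('k, 'x) lie_term \<Rightarrow> ('k, 'x) lie_term set" where
  "lie_class X R a = {b. lie_gens b \<subseteq> X \<and> lie_eq R a b}"

definition presented_lie_algebra ::
  "'x set \<Rightarrow> (('k::field, 'x) lie_term \<times> ('k, 'x) lie_term) set \<Rightarrow>
   ('k, ('k, 'x) lie_term set) lie_algebra" where
  "presented_lie_algebra X R =
    \<lparr>lie_carrier = lie_class X R ` {a. lie_gens a \<subseteq> X},
     lie_zero = lie_class X R LZero,
     lie_add = (\<lambda>C D. \<Union>a\<in>C. \<Union>b\<in>D. lie_class X R (LAdd a b)),
     lie_smult = (\<lambda>c C. \<Union>a\<in>C. lie_class X R (LSmult c a)),
     lie_bracket = (\<lambda>C D. \<Union>a\<in>C. \<Union>b\<in>D. lie_class X R (LBr a b))\<rparr>"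

inductive lie_homogeneous :: "nat \<Rightarrow> ('k, 'x) lie_term \<Rightarrow> bool" where
  "lie_homogeneous 1 (LGen x)"
| "lie_homogeneous n LZero"
| "lie_homogeneous n a \<Longrightarrow> lie_homogeneous n b \<Longrightarrow> lie_homogeneous n (LAdd a b)"
| "lie_homogeneous n a \<Longrightarrow> lie_homogeneous n (LSmult c a)"
| "lie_homogeneous i a \<Longrightarrow> lie_homogeneous j b \<Longrightarrow> lie_homogeneous (i + j) (LBr a b)"

definition lie_part ::
  "'x set \<Rightarrow> (('k::field, 'x) lie_term \<times> ('k, 'x) lie_term) set \<Rightarrow>
   nat \<Rightarrow> ('k, 'x) lie_term set set" where
  "lie_part X R n = lie_class X R ` {a. lie_gens a \<subseteq> X \<and> lie_homogeneous n a}"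

primrec lie_eval :: "('k, 'a) lie_algebra \<Rightarrow> ('x \<Rightarrow> 'a) \<Rightarrow> ('k, 'x) lie_term \<Rightarrow> 'a" where
  "lie_eval L \<phi> (LGen x) = \<phi> x"
| "lie_eval L \<phi> LZero = lie_zero L"
| "lie_eval L \<phi> (LAdd a b) = lie_add L (lie_eval L \<phi> a) (lie_eval L \<phi> b)"
| "lie_eval L \<phi> (LSmult c a) = lie_smult L c (lie_eval L \<phi> a)"
| "lie_eval L \<phi> (LBr a b) = lie_bracket L (lie_eval L \<phi> a) (lie_eval L \<phi> b)"

definition lie_lift :: "('k, 'a) lie_algebra \<Rightarrow> ('x \<Rightarrow> 'a) \<Rightarrow> ('k, 'x) lie_term set \<Rightarrow> 'a" where
  "lie_lift L \<phi> C = the_elem (lie_eval L \<phi> ` C)"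

subsection \<open>Enveloping algebras\<close>

definition enveloping_rels ::
  "('k::field, 'a) lie_algebra \<Rightarrow> (('k, 'a) alg_term \<times> ('k, 'a) alg_term) set" where
  "enveloping_rels L =
     {(AGen (lie_add L x y), AAdd (AGen x) (AGen y)) | x y.
        x \<in> lie_carrier L \<and> y \<in> lie_carrier L}
   \<union> {(AGen (lie_smult L c x), ASmult c (AGen x)) | c x. x \<in> lie_carrier L}
   \<union> {(AGen (lie_bracket L x y),
        AAdd (AMult (AGen x) (AGen y)) (ASmult (- 1) (AMult (AGen y) (AGen x)))) | x y.
        x \<in> lie_carrier L \<and> y \<in> lie_carrier L}"

definition enveloping_algebra ::
  "('k::field, 'a) lie_algebra \<Rightarrow> ('k, ('k, 'a) alg_term set) module" where
  "enveloping_algebra L = presented_algebra (lie_carrier L) (enveloping_rels L)"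

definition enveloping_incl :: "('k::field, 'a) lie_algebra \<Rightarrow> 'a \<Rightarrow> ('k, 'a) alg_term set" where
  "enveloping_incl L x = alg_class (lie_carrier L) (enveloping_rels L) (AGen x)"

text \<open>The grading of the enveloping algebra induced by a grading \<open>D\<close> of \<open>L\<close>.\<close>

definition enveloping_part ::
  "('k::field, 'a) lie_algebra \<Rightarrow> (nat \<Rightarrow> 'a set) \<Rightarrow> nat \<Rightarrow> ('k, 'a) alg_term set set" where
  "enveloping_part L D = alg_part (lie_carrier L) (enveloping_rels L) D"

text \<open>The coproduct and the counit for which the elements of \<open>L\<close> are primitive.\<close>

definition enveloping_coproduct ::
  "('k::field, 'a) lie_algebra \<Rightarrow> ('k, 'a) alg_term set \<Rightarrow>
   ('k, ('k, 'a) alg_term set \<times> ('k, 'a) alg_term set) alg_term set" where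
  "enveloping_coproduct L =
     (let U = enveloping_algebra L; UU = tensor_algebra U U in
      alg_lift UU (\<lambda>x. pure_tensor U U (enveloping_incl L x) \<one>\<^bsub>U\<^esub>
                        \<oplus>\<^bsub>UU\<^esub> pure_tensor U U \<one>\<^bsub>U\<^esub> (enveloping_incl L x)))"

definition enveloping_counit :: "('k::field, 'a) lie_algebra \<Rightarrow> ('k, 'a) alg_term set \<Rightarrow> 'k" where
  "enveloping_counit L = alg_lift ground_algebra (\<lambda>x. 0)"


section \<open>The dihedral group and its Artin group\<close>

datatype dihedral_gen = Gen_s | Gen_omega

datatype artin_gen = Gen_sigma | Gen_tau

primrec alternating :: "nat \<Rightarrow> 'a \<Rightarrow> 'a \<Rightarrow> 'a list" where
  "alternating 0 a b = []"
| "alternating (Suc n) a b = a # alternating n b a"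

definition dihedral_rels :: "nat \<Rightarrow> (dihedral_gen gword \<times> dihedral_gen gword) set" where
  "dihedral_rels m =
    {([(Gen_s, True), (Gen_s, True)], []),
     (replicate m (Gen_omega, True), []),
     ([(Gen_s, True), (Gen_omega, True)], [(Gen_omega, False), (Gen_s, True)])}"

definition dihedral :: "nat \<Rightarrow> dihedral_gen gword set monoid" where
  "dihedral m = presented_group (dihedral_rels m)"

definition dih_s :: "nat \<Rightarrow> dihedral_gen gword set" where
  "dih_s m = gword_class (dihedral_rels m) [(Gen_s, True)]"

definition dih_omega :: "nat \<Rightarrow> dihedral_gen gword set" where
  "dih_omega m = gword_class (dihedral_rels m) [(Gen_omega, True)]"

definition artin_rels :: "nat \<Rightarrow> (artin_gen gword \<times> artin_gen gword) set" where
  "artin_rels m =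
    {(alternating m (Gen_sigma, True) (Gen_tau, True),
      alternating m (Gen_tau, True) (Gen_sigma, True))}"

definition artin :: "nat \<Rightarrow> artin_gen gword set monoid" where
  "artin m = presented_group (artin_rels m)"

definition art_sigma :: "nat \<Rightarrow> artin_gen gword set" where
  "art_sigma m = gword_class (artin_rels m) [(Gen_sigma, True)]"

definition art_tau :: "nat \<Rightarrow> artin_gen gword set" where
  "art_tau m = gword_class (artin_rels m) [(Gen_tau, True)]"


section \<open>The holonomy Lie algebra and the complete Hopf algebras\<close>

text \<open>The generators of the Lie algebra are indexed by \<open>0, \<dots>, m - 1\<close>, as integers; indices are
  reduced modulo \<open>m\<close> by \<open>hol_t\<close>.\<close>

type_synonym 'k hol = "('k, int) lie_term set"
type_synonym 'k Uhol = "('k, 'k hol) alg_term set"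
type_synonym 'k UUhol = "('k, 'k Uhol \<times> 'k Uhol) alg_term set"
type_synonym 'k Ahol = "nat \<Rightarrow> 'k Uhol"
type_synonym 'k Bhol = "dihedral_gen gword set \<Rightarrow> 'k Ahol"

definition hol_gens :: "nat \<Rightarrow> int set" where
  "hol_gens m = {0..<int m}"

definition hol_T :: "nat \<Rightarrow> ('k::field, int) lie_term" where
  "hol_T m = foldr (\<lambda>r a. LAdd (LGen r) a) [0..int m - 1] LZero"

definition hol_rels :: "nat \<Rightarrow> (('k::field, int) lie_term \<times> ('k, int) lie_term) set" where
  "hol_rels m = {(LBr (hol_T m) (LGen r), LZero) | r. r \<in> hol_gens m}"

definition hol_lie :: "nat \<Rightarrow> ('k::field, 'k hol) lie_algebra" where
  "hol_lie m = presented_lie_algebra (hol_gens m) (hol_rels m)"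

definition hol_t :: "nat \<Rightarrow> int \<Rightarrow> 'k::field hol" where
  "hol_t m r = lie_class (hol_gens m) (hol_rels m) (LGen (r mod int m))"

definition Ug :: "nat \<Rightarrow> ('k::field, 'k Uhol) module" where
  "Ug m = enveloping_algebra (hol_lie m)"

definition Ug_part :: "nat \<Rightarrow> nat \<Rightarrow> 'k::field Uhol set" where
  "Ug_part m = enveloping_part (hol_lie m) (lie_part (hol_gens m) (hol_rels m))"

definition UUg :: "nat \<Rightarrow> ('k::field, 'k UUhol) module" where
  "UUg m = tensor_algebra (Ug m) (Ug m)"

subsection \<open>The complete Hopf algebra \<open>\<A>\<close>\<close>

definition Acal :: "nat \<Rightarrow> ('k::field, 'k Ahol) module" where
  "Acal m = completion (Ug m) (Ug_part m)"

definition Acal_t :: "nat \<Rightarrow> int \<Rightarrow> 'k::field Ahol" where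
  "Acal_t m r = in_degree (Ug m) 1 (enveloping_incl (hol_lie m) (hol_t m r))"

definition Acal_exp :: "nat \<Rightarrow> 'k::field_char_0 Ahol \<Rightarrow> 'k Ahol" where
  "Acal_exp m = completed_exp (Ug m) (Ug_part m)"

text \<open>The completed tensor square \<open>\<A> \<otimes> \<A>\<close> is the completion of \<^term>\<open>UUg m\<close> for its total
  grading, so its elements, too, are sequences of homogeneous components.\<close>

definition Acal_tensor :: "nat \<Rightarrow> 'k::field Ahol \<Rightarrow> 'k Ahol \<Rightarrow> nat \<Rightarrow> 'k UUhol" where
  "Acal_tensor m x y =
     (\<lambda>n. \<Oplus>\<^bsub>UUg m\<^esub>i\<in>{..n}. pure_tensor (Ug m) (Ug m) (x i) (y (n - i)))"

definition Acal_coproduct :: "nat \<Rightarrow> 'k::field Ahol \<Rightarrow> nat \<Rightarrow> 'k UUhol" where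
  "Acal_coproduct m x = (\<lambda>n. enveloping_coproduct (hol_lie m) (x n))"

definition Acal_counit :: "nat \<Rightarrow> 'k::field Ahol \<Rightarrow> 'k" where
  "Acal_counit m x = enveloping_counit (hol_lie m) (x 0)"

definition Acal_grouplike :: "nat \<Rightarrow> 'k::field Ahol set" where
  "Acal_grouplike m =
     {x \<in> carrier (Acal m). Acal_counit m x = 1 \<and> Acal_coproduct m x = Acal_tensor m x x}"

subsection \<open>The action of the dihedral group\<close>

fun dih_letter_index :: "nat \<Rightarrow> dihedral_gen \<times> bool \<Rightarrow> int \<Rightarrow> int" where
  "dih_letter_index m (Gen_s, b) r = (- r) mod int m"
| "dih_letter_index m (Gen_omega, True) r = (r + 2) mod int m"
| "dih_letter_index m (Gen_omega, False) r = (r - 2) mod int m"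

definition dih_index :: "nat \<Rightarrow> dihedral_gen gword set \<Rightarrow> int \<Rightarrow> int" where
  "dih_index m w r = the_elem ((\<lambda>u. foldr (dih_letter_index m) u (r mod int m)) ` w)"

definition dih_act_hol :: "nat \<Rightarrow> dihedral_gen gword set \<Rightarrow> 'k::field hol \<Rightarrow> 'k hol" where
  "dih_act_hol m w = lie_lift (hol_lie m) (\<lambda>r. hol_t m (dih_index m w r))"

definition dih_act_Ug :: "nat \<Rightarrow> dihedral_gen gword set \<Rightarrow> 'k::field Uhol \<Rightarrow> 'k Uhol" where
  "dih_act_Ug m w = alg_lift (Ug m) (\<lambda>x. enveloping_incl (hol_lie m) (dih_act_hol m w x))"

definition dih_act :: "nat \<Rightarrow> dihedral_gen gword set \<Rightarrow> 'k::field Ahol \<Rightarrow> 'k Ahol" where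
  "dih_act m w x = (\<lambda>n. dih_act_Ug m w (x n))"

subsection \<open>The complete Hopf algebra \<open>\<B>\<close>\<close>

definition Bcal :: "nat \<Rightarrow> ('k::field, 'k Bhol) module" where
  "Bcal m = semidirect_algebra (dihedral m) (Acal m) (dih_act m)"

definition Bcal_W :: "nat \<Rightarrow> dihedral_gen gword set \<Rightarrow> 'k::field Bhol" where
  "Bcal_W m = semidirect_group_elem (dihedral m) (Acal m)"

definition Bcal_A :: "nat \<Rightarrow> 'k::field Ahol \<Rightarrow> 'k Bhol" where
  "Bcal_A m = semidirect_alg_elem (dihedral m) (Acal m)"

text \<open>As \<open>W\<close> is finite, the completed tensor square of \<open>\<B>\<close> consists of the functions on \<open>W \<times> W\<close>
  with values in the completed tensor square of \<open>\<A>\<close>. On the basis elements, the coproduct is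
  \<open>\<Delta> (a w) = \<Delta> a (w \<otimes> w)\<close>.\<close>

definition Bcal_tensor ::
  "nat \<Rightarrow> 'k::field Bhol \<Rightarrow> 'k Bhol \<Rightarrow>
   dihedral_gen gword set \<times> dihedral_gen gword set \<Rightarrow> nat \<Rightarrow> 'k UUhol" where
  "Bcal_tensor m f f' =
     (\<lambda>(w, w') \<in> carrier (dihedral m) \<times> carrier (dihedral m). Acal_tensor m (f w) (f' w'))"

definition Bcal_coproduct ::
  "nat \<Rightarrow> 'k::field Bhol \<Rightarrow>
   dihedral_gen gword set \<times> dihedral_gen gword set \<Rightarrow> nat \<Rightarrow> 'k UUhol" where
  "Bcal_coproduct m f =
     (\<lambda>(w, w') \<in> carrier (dihedral m) \<times> carrier (dihedral m).
        if w = w' then Acal_coproduct m (f w) else (\<lambda>n. \<zero>\<^bsub>UUg m\<^esub>))"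

definition Bcal_counit :: "nat \<Rightarrow> 'k::field Bhol \<Rightarrow> 'k" where
  "Bcal_counit m f = (\<Sum>w\<in>carrier (dihedral m). Acal_counit m (f w))"

definition Bcal_grouplike :: "nat \<Rightarrow> 'k::field Bhol set" where
  "Bcal_grouplike m =
     {f \<in> carrier (Bcal m). Bcal_counit m f = 1 \<and> Bcal_coproduct m f = Bcal_tensor m f f}"

subsection \<open>Morphisms of Hopf algebras and the fundamental condition\<close>

definition hopf_morphisms ::
  "nat \<Rightarrow> ((artin_gen gword set \<Rightarrow> 'k::field) \<Rightarrow> 'k Bhol) set" where
  "hopf_morphisms m =
     {\<Phi> \<in> alg_hom (group_algebra (artin m)) (Bcal m).
        \<forall>b\<in>carrier (artin m). \<Phi> (group_elem b) \<in> Bcal_grouplike m}"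

definition fundamental_condition ::
  "nat \<Rightarrow> ((artin_gen gword set \<Rightarrow> 'k::field_char_0) \<Rightarrow> 'k Bhol) \<Rightarrow> bool" where
  "fundamental_condition m \<Phi> \<longleftrightarrow>
     (\<exists>\<kappa> \<mu> :: 'k. \<exists>g \<in> Acal_grouplike m. \<exists>h \<in> Acal_grouplike m.
        \<kappa> \<noteq> 0 \<and> \<mu> \<noteq> 0 \<and>
        \<Phi> (group_elem (art_sigma m)) =
          Bcal_A m g
          \<otimes>\<^bsub>Bcal m\<^esub> (Bcal_W m (dih_s m)
             \<otimes>\<^bsub>Bcal m\<^esub> Bcal_A m (Acal_exp m (\<kappa> \<odot>\<^bsub>Acal m\<^esub> Acal_t m 0)))
          \<otimes>\<^bsub>Bcal m\<^esub> inv\<^bsub>Bcal m\<^esub> (Bcal_A m g) \<and>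
        \<Phi> (group_elem (art_tau m)) =
          Bcal_A m h
          \<otimes>\<^bsub>Bcal m\<^esub> (Bcal_W m (dih_omega m \<otimes>\<^bsub>dihedral m\<^esub> dih_s m)
             \<otimes>\<^bsub>Bcal m\<^esub> Bcal_A m (Acal_exp m (\<mu> \<odot>\<^bsub>Acal m\<^esub> Acal_t m 1)))
          \<otimes>\<^bsub>Bcal m\<^esub> inv\<^bsub>Bcal m\<^esub> (Bcal_A m h))"

end

theory Submission
  imports Defs
begin

text \<open>Write \<open>\<Phi>(\<sigma>)\<close> and \<open>\<Phi>(\<tau>)\<close> as conjugates of \<open>s exp(t\<^sub>0)\<close> and \<open>\<omega>s exp(t\<^sub>1)\<close> by unknown group-like elements.
  For \<open>m = 2p\<close> the braid relation says that \<open>(\<sigma>\<tau>)\<^sup>p\<close> commutes with \<open>\<sigma>\<close>; this follows from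
  \<open>\<sigma>\<tau> = \<omega>\<inverse> exp(T/p)\<close>, because \<open>T\<close> is central and \<open>\<omega>\<^sup>p\<close> acts trivially. For \<open>m = 2p + 1\<close> it says
  that \<open>(\<sigma>\<tau>)\<^sup>p\<sigma>\<close> has square \<open>(\<sigma>\<tau>)\<^sup>m\<close>; this follows from \<open>\<sigma>\<tau> = \<omega>\<inverse> exp(2T/m)\<close> if
  \<open>(\<sigma>\<tau>)\<^sup>p\<sigma>\<close> is a conjugate of \<open>w exp(T)\<close> for the reflection \<open>w = \<omega>\<^sup>-\<^sup>ps\<close>.

  Both cases amount to one equation \<open>s(g) e\<^sup>x g\<inverse> v(h) e\<^sup>y h\<inverse> = e\<^sup>z\<close> for two reflections \<open>s\<close>, \<open>v\<close> generating
  \<open>W\<close>, which is solved already in the completed free algebra on \<open>t\<^sub>0, \<dots>, t\<^sub>m\<^sub>-\<^sub>1\<close>, degree by degree.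
  Modifying \<open>g\<close> and \<open>h\<close> in degree \<open>n\<close> by Lie elements \<open>a\<close>, \<open>b\<close> changes the error in degree \<open>n\<close> by
  \<open>(s - 1)a + (v - 1)b\<close>, and modifying them in degree \<open>n - 1\<close> by \<open>a'\<close>, \<open>b'\<close> with \<open>s(a') = a'\<close>,
  \<open>v(b') = b'\<close> changes it by \<open>[a', x] + [b', y]\<close>. These changes reach every error in degrees \<open>n \<ge> 2\<close>:
  the free Lie algebra satisfies \<open>L\<^sub>n = \<Sum>r. [t\<^sub>r, L\<^sub>n\<^sub>-\<^sub>1]\<close>, and each \<open>t\<^sub>r\<close> is conjugate under \<open>W\<close> to \<open>t\<^sub>0\<close> or \<open>t\<^sub>1\<close>.\<close>

section \<open>The completed free associative algebra, as functions on words\<close>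

section \<open>Noncommutative power series\<close>

text \<open>The multiple of T on the right-hand side is forced in degree 1, where the equation asks
  that x + y - z vanish in the W-coinvariants of the span of the letters. For m = 2p the letters
  form two orbits of p letters each, so T/p has the class of t_0 + t_1. For odd m they form a single
  orbit, so T/m has the class of t_0; this leaves no room for an exponential on the second
  reflection, and y = 0. Accordingly h then does not describe \<tau>: its image is defined as the
  inverse of that of \<sigma> times the prescribed value of \<sigma>\<tau>, and the braid relation
  makes it the conjugate of the image of \<sigma> by that of (\<sigma>\<tau>)^p \<sigma>, which
  yields the conjugating series. A correction in degree n - 1 must not disturb what is already
  solved, which is why a' and b' have to be fixed by their reflections; averaging over the
  reflection supplies such elements without changing the class of a bracket in the coinvariants. On
  the free algebra T is only W-invariant; its centrality is used after evaluation.\<close>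

typedef ('x, 'k) ncs = "UNIV :: ('x list \<Rightarrow> 'k) set"
  morphisms coeff Ncs ..

setup_lifting type_definition_ncs

lemma ncs_eqI: "(\<And>w. coeff f w = coeff g w) \<Longrightarrow> f = g"
  by (simp add: coeff_inject[symmetric] ext)

text \<open>The Cauchy product over all factorizations \<open>w = u @ v\<close>: either the left
  factor is empty, or it takes the first letter, which is then absorbed into \<open>f\<close>. A
  word has finitely many factorizations, so the alphabet may be infinite.\<close>

primrec conv :: "'x list \<Rightarrow> ('x list \<Rightarrow> 'k) \<Rightarrow> ('x list \<Rightarrow> 'k) \<Rightarrow> 'k::semiring_0" where
  "conv [] f g = f [] * g []"
| "conv (r # w) f g = f [] * g (r # w) + conv w (\<lambda>u. f (r # u)) g"

lemma conv_add_left: "conv w (\<lambda>u. f u + f' u) g = conv w f g + conv w f' g"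
  by (induction w arbitrary: f f') (auto simp: algebra_simps)

lemma conv_add_right: "conv w f (\<lambda>u. g u + g' u) = conv w f g + conv w f g'"
  by (induction w arbitrary: f) (auto simp: algebra_simps)

lemma conv_mult_left: "conv w (\<lambda>u. c * f u) g = c * conv w f g"
  by (induction w arbitrary: f) (auto simp: algebra_simps)

lemma conv_mult_right: "conv w f (\<lambda>u. c * g u) = (c::'k::comm_semiring_0) * conv w f g"
  by (induction w arbitrary: f) (auto simp: algebra_simps)

lemma conv_zero_left: "conv w (\<lambda>u. 0) g = 0"
  by (induction w) auto

lemma conv_assoc: "conv w (\<lambda>u. conv u f g) h = conv w f (\<lambda>u. conv u g h)"
  by (induction w arbitrary: f)
    (simp_all add: mult.assoc conv_add_left conv_mult_left distrib_left add.assoc)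

lemma conv_one_left: "conv w (\<lambda>u. if u = [] then 1 else 0) g = (g w :: 'k::semiring_1)"
  by (cases w) (simp_all add: conv_zero_left)

lemma conv_one_right: "conv w f (\<lambda>u. if u = [] then 1 else 0) = (f w :: 'k::semiring_1)"
  by (induction w arbitrary: f) simp_all

lemma conv_map: "conv w (\<lambda>u. f (map \<sigma> u)) (\<lambda>u. g (map \<sigma> u)) = conv (map \<sigma> w) f g"
proof (induction w arbitrary: f)
  case (Cons r w)
  show ?case using Cons[of "\<lambda>u. f (\<sigma> r # u)"] by simp
qed simp

lemma conv_order:
  assumes "\<And>u. length u < n \<Longrightarrow> f u = 0" "\<And>u. length u < k \<Longrightarrow> g u = 0" "length w < n + k"
  shows "conv w f g = 0"
  using assms
proof (induction w arbitrary: f n)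
  case Nil
  then show ?case by (cases n) auto
next
  case (Cons r w)
  have "f [] * g (r # w) = 0" using Cons.prems by (cases n) auto
  moreover have "conv w (\<lambda>u. f (r # u)) g = 0"
    by (rule Cons.IH[of "n - 1"]) (use Cons.prems in \<open>auto\<close>)
  ultimately show ?case by simp
qed

text \<open>Length is additive along a factorization. This is the Leibniz rule for
  \<open>degder\<close>, the derivation that multiplies degree n by n.\<close>

lemma conv_length:
  "conv w (\<lambda>u. of_nat (length u) * f u) g + conv w f (\<lambda>u. of_nat (length u) * g u)
    = (of_nat (length w) :: 'k::comm_semiring_1) * conv w f g"
proof (induction w arbitrary: f)
  case (Cons r w)
  show ?case using Cons[of "\<lambda>u. f (r # u)"]
    by (simp add: algebra_simps conv_add_left) 
qed simp

instantiation ncs :: (type, comm_ring_1) ring_1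
begin

lift_definition zero_ncs :: "('a, 'b) ncs" is "\<lambda>w. 0" .
lift_definition one_ncs :: "('a, 'b) ncs" is "\<lambda>w. if w = [] then 1 else 0" .
lift_definition plus_ncs :: "('a, 'b) ncs \<Rightarrow> ('a, 'b) ncs \<Rightarrow> ('a, 'b) ncs"
  is "\<lambda>f g w. f w + g w" .
lift_definition minus_ncs :: "('a, 'b) ncs \<Rightarrow> ('a, 'b) ncs \<Rightarrow> ('a, 'b) ncs"
  is "\<lambda>f g w. f w - g w" .
lift_definition uminus_ncs :: "('a, 'b) ncs \<Rightarrow> ('a, 'b) ncs" is "\<lambda>f w. - f w" .
lift_definition times_ncs :: "('a, 'b) ncs \<Rightarrow> ('a, 'b) ncs \<Rightarrow> ('a, 'b) ncs"
  is "\<lambda>f g w. conv w f g" .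

instance
proof
  show "(0::('a, 'b) ncs) \<noteq> 1" by transfer (metis zero_neq_one)
qed (transfer; auto simp: algebra_simps conv_add_left conv_add_right conv_assoc
      conv_one_left conv_one_right)+

end

text \<open>\<open>ren \<sigma>\<close> substitutes \<open>\<sigma>\<close> in the argument of the coefficient function, so for a bijection \<open>\<sigma>\<close> it
  sends the letter \<open>r\<close> to \<open>\<sigma>\<inverse> r\<close>.\<close>

lift_definition scl :: "'k \<Rightarrow> ('x, 'k::comm_ring_1) ncs \<Rightarrow> ('x, 'k) ncs" is "\<lambda>c f w. c * f w" .
lift_definition var :: "'x \<Rightarrow> ('x, 'k::comm_ring_1) ncs" is "\<lambda>r w. if w = [r] then 1 else 0" .
lift_definition degder :: "('x, 'k::comm_ring_1) ncs \<Rightarrow> ('x, 'k) ncs"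
  is "\<lambda>f w. of_nat (length w) * f w" .
lift_definition hpart :: "nat \<Rightarrow> ('x, 'k::comm_ring_1) ncs \<Rightarrow> ('x, 'k) ncs"
  is "\<lambda>n f w. if length w = n then f w else 0" .
lift_definition lder :: "'x \<Rightarrow> ('x, 'k::comm_ring_1) ncs \<Rightarrow> ('x, 'k) ncs"
  is "\<lambda>r f w. f (r # w)" .
lift_definition ren :: "('x \<Rightarrow> 'x) \<Rightarrow> ('x, 'k::comm_ring_1) ncs \<Rightarrow> ('x, 'k) ncs"
  is "\<lambda>\<sigma> f w. f (map \<sigma> w)" .

lemma coeff_simps [simp]:
  "coeff 0 w = 0" "coeff 1 w = (if w = [] then 1 else 0)" "coeff (f + g) w = coeff f w + coeff g w"
  "coeff (f - g) w = coeff f w - coeff g w" "coeff (- f) w = - coeff f w"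
  "coeff (scl c f) w = c * coeff f w" "coeff (var r) w = (if w = [r] then 1 else 0)"
  "coeff (degder f) w = of_nat (length w) * coeff f w"
  "coeff (hpart n f) w = (if length w = n then coeff f w else 0)"
  "coeff (lder r f) w = coeff f (r # w)" "coeff (ren \<sigma> f) w = coeff f (map \<sigma> w)"
  for w :: "'x list" and f g :: "('x, 'k::comm_ring_1) ncs"
  by (transfer; simp)+

lemma coeff_mult: "coeff (f * g) w = conv w (coeff f) (coeff g)"
  by transfer simp

lemma coeff_mult_Nil [simp]: "coeff (f * g) [] = coeff f [] * coeff g []"
  by (simp add: coeff_mult)

lemma coeff_sum [simp]: "coeff (sum F A) w = (\<Sum>i\<in>A. coeff (F i) w)"
  by (induction A rule: infinite_finite_induct) simp_all

lemma coeff_power_Nil [simp]: "coeff (f ^ n) [] = coeff f [] ^ n"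
  by (induction n) simp_all

lemma scl_simps:
  "scl c (f + g) = scl c f + scl c g" "scl c (f - g) = scl c f - scl c g" "scl c (- f) = - scl c f"
  "scl (c + d) f = scl c f + scl d f" "scl c (scl d f) = scl (c * d) f" "scl 1 f = f" "scl 0 f = 0"
  "scl c 0 = 0"
  for f g :: "('x, 'k::comm_ring_1) ncs"
  by (rule ncs_eqI; simp add: algebra_simps)+

lemma mult_scl_left: "scl c f * g = scl c (f * g)"
  by (rule ncs_eqI) (simp add: coeff_mult conv_mult_left scl.rep_eq)

lemma mult_scl_right: "f * scl c g = scl c (f * g)"
  by (rule ncs_eqI) (simp add: coeff_mult conv_mult_right scl.rep_eq)

lemma scl_sum: "scl c (sum F A) = (\<Sum>i\<in>A. scl c (F i))"
  by (rule ncs_eqI) (simp add: sum_distrib_left)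

lemma of_nat_mult_ncs: "of_nat n * f = scl (of_nat n) f"
  by (induction n) (simp_all add: scl_simps algebra_simps)

lemma degder_simps:
  "degder (f + g) = degder f + degder g" "degder (f - g) = degder f - degder g" "degder 0 = 0"
  "degder 1 = 0" "degder (scl c f) = scl c (degder f)" "degder (f * g) = degder f * g + f * degder g"
  "degder (- f) = - degder f"
  by (rule ncs_eqI; auto simp: algebra_simps coeff_mult degder.rep_eq conv_length[symmetric])+

lemma ren_simps:
  "ren \<sigma> (f + g) = ren \<sigma> f + ren \<sigma> g" "ren \<sigma> (f - g) = ren \<sigma> f - ren \<sigma> g" "ren \<sigma> 0 = 0"
  "ren \<sigma> 1 = 1" "ren \<sigma> (- f) = - ren \<sigma> f" "ren \<sigma> (scl c f) = scl c (ren \<sigma> f)"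
  "ren \<sigma> (f * g) = ren \<sigma> f * ren \<sigma> g" "ren \<sigma> (degder f) = degder (ren \<sigma> f)"
  "ren \<sigma> (ren \<tau> f) = ren (\<tau> \<circ> \<sigma>) f" "ren id f = f"
  by (rule ncs_eqI; simp add: coeff_mult ren.rep_eq conv_map comp_def)+

lemma ren_sum: "ren \<sigma> (sum F A) = (\<Sum>i\<in>A. ren \<sigma> (F i))"
  by (induction A rule: infinite_finite_induct) (simp_all add: ren_simps)

lemma ren_power: "ren \<sigma> (f ^ n) = ren \<sigma> f ^ n"
  by (induction n) (simp_all add: ren_simps)

lemma ren_var:
  assumes "\<And>x. \<sigma> x = r \<longleftrightarrow> x = r'"
  shows "ren \<sigma> (var r) = var r'"
  by (rule ncs_eqI) (use assms in \<open>auto simp: map_eq_Cons_conv\<close>)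

lemma lder_simps:
  "lder r (f + g) = lder r f + lder r g" "lder r 0 = 0" "lder r 1 = 0"
  "lder r (scl c f) = scl c (lder r f)" "lder r (var r') = (if r = r' then 1 else 0)"
  "lder r (f * g) = scl (coeff f []) (lder r g) + lder r f * g"
  by (rule ncs_eqI; auto simp: coeff_mult lder.rep_eq)+

lemma hpart_simps:
  "hpart n (f + g) = hpart n f + hpart n g" "hpart n (f - g) = hpart n f - hpart n g" "hpart n 0 = 0"
  "hpart n (scl c f) = scl c (hpart n f)" "hpart n (- f) = - hpart n f"
  "hpart n (ren \<sigma> f) = ren \<sigma> (hpart n f)"
  by (rule ncs_eqI; simp)+

lemma hpart_sum: "hpart n (sum F A) = (\<Sum>i\<in>A. hpart n (F i))"
  by (induction A rule: infinite_finite_induct) (simp_all add: hpart_simps)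

subsection \<open>The order filtration\<close>

definition order_ge :: "nat \<Rightarrow> ('x, 'k::comm_ring_1) ncs set" where
  "order_ge n = {f. \<forall>w. length w < n \<longrightarrow> coeff f w = 0}"

lemma order_ge_0 [simp]: "f \<in> order_ge 0"
  by (simp add: order_ge_def)

lemma order_ge_zero [simp]: "0 \<in> order_ge n"
  by (simp add: order_ge_def)

lemma order_ge_add: "f \<in> order_ge n \<Longrightarrow> g \<in> order_ge n \<Longrightarrow> f + g \<in> order_ge n"
  by (simp add: order_ge_def)

lemma order_ge_diff: "f \<in> order_ge n \<Longrightarrow> g \<in> order_ge n \<Longrightarrow> f - g \<in> order_ge n"
  by (simp add: order_ge_def)

lemma order_ge_uminus: "f \<in> order_ge n \<Longrightarrow> - f \<in> order_ge n"
  by (simp add: order_ge_def)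

lemma order_ge_mult: "f \<in> order_ge n \<Longrightarrow> g \<in> order_ge k \<Longrightarrow> f * g \<in> order_ge (n + k)"
  unfolding order_ge_def by (auto simp: coeff_mult intro: conv_order)

lemma order_ge_mult_left: "g \<in> order_ge n \<Longrightarrow> f * g \<in> order_ge n"
  using order_ge_mult[of f 0 g n] by simp

lemma order_ge_mult_right: "f \<in> order_ge n \<Longrightarrow> f * g \<in> order_ge n"
  using order_ge_mult[of f n g 0] by simp

lemma order_ge_mono: "f \<in> order_ge n \<Longrightarrow> k \<le> n \<Longrightarrow> f \<in> order_ge k"
  by (simp add: order_ge_def)

lemma order_ge_power: "f \<in> order_ge n \<Longrightarrow> f ^ k \<in> order_ge (n * k)"
  by (induction k) (auto dest: order_ge_mult)

lemma order_ge_Suc_0_iff: "f \<in> order_ge (Suc 0) \<longleftrightarrow> coeff f [] = 0"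
  by (auto simp: order_ge_def less_Suc_eq_0_disj)

lemma order_ge_degder: "f \<in> order_ge n \<Longrightarrow> degder f \<in> order_ge n"
  by (simp add: order_ge_def)

lemma order_ge_ren: "f \<in> order_ge n \<Longrightarrow> ren \<sigma> f \<in> order_ge n"
  by (simp add: order_ge_def)

lemma hpart_order_ge: "hpart n f \<in> order_ge n"
  by (simp add: order_ge_def)

lemma hpart_eq_0: "f \<in> order_ge k \<Longrightarrow> n < k \<Longrightarrow> hpart n f = 0"
  by (intro ncs_eqI) (simp add: order_ge_def)

lemma hpart_cong_order: "f - g \<in> order_ge k \<Longrightarrow> n < k \<Longrightarrow> hpart n f = hpart n g"
  using hpart_eq_0[of "f - g" k n] by (simp add: hpart_simps)

lemma order_ge_trans: "f - g \<in> order_ge n \<Longrightarrow> g - h \<in> order_ge n \<Longrightarrow> f - h \<in> order_ge n"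
  using order_ge_add[of "f - g" n "g - h"] by simp

lemma order_ge_sym: "f - g \<in> order_ge n \<Longrightarrow> g - f \<in> order_ge n"
  using order_ge_uminus[of "f - g" n] by simp

lemma order_ge_mult_cong:
  "f - f' \<in> order_ge n \<Longrightarrow> g - g' \<in> order_ge n \<Longrightarrow> f * g - f' * g' \<in> order_ge n"
  using order_ge_add[OF order_ge_mult_right[of "f - f'" n g] order_ge_mult_left[of "g - g'" n f']]
  by (simp add: algebra_simps)

text \<open>The order filtration is separated; identities between limits are checked modulo every
  \<open>order_ge n\<close>.\<close>

lemma eq_if_order_ge: "(\<And>n. f - g \<in> order_ge n) \<Longrightarrow> f = g"
proof (rule ncs_eqI)
  fix w
  assume "\<And>n. f - g \<in> order_ge n"
  from this[of "Suc (length w)"] have "coeff (f - g) w = 0"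
    unfolding order_ge_def by blast
  then show "coeff f w = coeff g w"
    by simp
qed

lemma order_ge_SucI: "f \<in> order_ge n \<Longrightarrow> hpart n f = 0 \<Longrightarrow> f \<in> order_ge (Suc n)"
  unfolding order_ge_def
  by (auto simp: less_Suc_eq) (metis coeff_simps(1,9))

subsection \<open>Inverses and exponentials\<close>

text \<open>The geometric series of 1 - f. When f has constant term 1, the k-th power has order at
  least k, so stopping at the word length cuts off only zero terms.\<close>

definition ginv :: "('x, 'k::comm_ring_1) ncs \<Rightarrow> ('x, 'k) ncs" where
  "ginv f = Ncs (\<lambda>w. \<Sum>k\<le>length w. coeff ((1 - f) ^ k) w)"

lemma coeff_ginv: "coeff (ginv f) w = (\<Sum>k\<le>length w. coeff ((1 - f) ^ k) w)"
  by (simp add: ginv_def Ncs_inverse)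

lemma sum_atMost_eq_order:
  assumes "(n::nat) \<le> N" "\<And>k. k > n \<Longrightarrow> (c k :: 'a::comm_monoid_add) = 0"
  shows "sum c {..N} = sum c {..n}"
  using assms by (intro sum.mono_neutral_right) (simp_all add: subset_iff)

lemma ginv_approx:
  assumes "coeff f [] = 1"
  shows "ginv f - (\<Sum>k\<le>n. (1 - f) ^ k) \<in> order_ge (Suc n)"
proof -
  have "coeff ((1 - f) ^ k) w = 0" if "k > length w" for k w
    using order_ge_power[of "1 - f" "Suc 0" k] that assms by (simp add: order_ge_Suc_0_iff) (simp add: order_ge_def)
  then have "(\<Sum>k\<le>n. coeff ((1 - f) ^ k) w) = (\<Sum>k\<le>length w. coeff ((1 - f) ^ k) w)"
    if "length w \<le> n" for w
    using that by (intro sum_atMost_eq_order) auto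
  then show ?thesis
    by (simp add: order_ge_def coeff_ginv)
qed

lemma
  assumes "coeff f [] = 1"
  shows ginv_right: "f * ginv f = 1" and ginv_left: "ginv f * f = 1"
proof -
  let ?S = "\<lambda>n. \<Sum>k\<le>n. (1 - f) ^ k"
  have tele: "f * ?S n = 1 - (1 - f) ^ Suc n" "?S n * f = 1 - (1 - f) ^ Suc n" for n
  proof (induction n)
    case (Suc n)
    define q where "q = (1 - f) ^ Suc n"
    have S: "?S (Suc n) = ?S n + q"
      by (simp only: q_def sum.atMost_Suc)
    have q: "(1 - f) ^ Suc (Suc n) = (1 - f) * q" "(1 - f) ^ Suc (Suc n) = q * (1 - f)"
      unfolding q_def by (simp_all only: power_Suc power_commutes mult.assoc)
    show "f * ?S (Suc n) = 1 - (1 - f) ^ Suc (Suc n)"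
      unfolding S q(1) distrib_left Suc(1) q_def[symmetric] by (simp add: left_diff_distrib)
    show "?S (Suc n) * f = 1 - (1 - f) ^ Suc (Suc n)"
      unfolding S q(2) distrib_right Suc(2) q_def[symmetric] by (simp add: right_diff_distrib)
  qed simp_all
  have small: "(1 - f) ^ Suc n \<in> order_ge (Suc n)" for n
    using order_ge_power[of "1 - f" "Suc 0" "Suc n"] assms by (simp add: order_ge_Suc_0_iff del: power_Suc)
  show "f * ginv f = 1"
  proof (rule eq_if_order_ge)
    fix n
    have "f * (ginv f - ?S n) - (1 - f) ^ Suc n \<in> order_ge (Suc n)"
      by (intro order_ge_diff order_ge_mult_left ginv_approx assms small)
    also have "f * (ginv f - ?S n) - (1 - f) ^ Suc n = f * ginv f - 1"
      by (simp only: right_diff_distrib tele) simp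
    finally show "f * ginv f - 1 \<in> order_ge n"
      by (rule order_ge_mono) simp
  qed
  show "ginv f * f = 1"
  proof (rule eq_if_order_ge)
    fix n
    have "(ginv f - ?S n) * f - (1 - f) ^ Suc n \<in> order_ge (Suc n)"
      by (intro order_ge_diff order_ge_mult_right ginv_approx assms small)
    also have "(ginv f - ?S n) * f - (1 - f) ^ Suc n = ginv f * f - 1"
      by (simp only: left_diff_distrib tele) simp
    finally show "ginv f * f - 1 \<in> order_ge n"
      by (rule order_ge_mono) simp
  qed
qed

lemma coeff_ginv_Nil [simp]: "coeff (ginv f) [] = 1"
  by (simp add: coeff_ginv)

lemma ginv_unique: "coeff f [] = 1 \<Longrightarrow> f * g = 1 \<Longrightarrow> g = ginv f"
  by (metis ginv_left mult.assoc mult.left_neutral mult.right_neutral)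

lemma ginv_mult: "coeff f [] = 1 \<Longrightarrow> coeff g [] = 1 \<Longrightarrow> ginv (f * g) = ginv g * ginv f"
  by (rule ginv_unique[symmetric]) (simp_all, metis ginv_right mult.assoc mult.right_neutral)

lemma ginv_ginv [simp]: "coeff f [] = 1 \<Longrightarrow> ginv (ginv f) = f"
  by (metis coeff_ginv_Nil ginv_left ginv_unique)

lemma ginv_one [simp]: "ginv 1 = 1"
  by (rule ginv_unique[symmetric]) simp_all

lemma ren_ginv: "coeff f [] = 1 \<Longrightarrow> ren \<sigma> (ginv f) = ginv (ren \<sigma> f)"
  by (rule ginv_unique) (simp_all add: ren_simps(7)[symmetric] ginv_right ren_simps(4))

lemma order_ge_ginv:
  assumes "coeff f [] = 1" "coeff g [] = 1" "f - g \<in> order_ge n"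
  shows "ginv f - ginv g \<in> order_ge n"
proof -
  have "ginv f - ginv g = ginv f * (g - f) * ginv g"
    by (simp add: algebra_simps ginv_left[OF assms(1)])
      (simp add: mult.assoc ginv_right[OF assms(2)])
  then show ?thesis
    using order_ge_mult_right[OF order_ge_mult_left[OF order_ge_sym[OF assms(3)]]] by metis
qed

lemma degder_ginv: "coeff f [] = 1 \<Longrightarrow> degder (ginv f) = - (ginv f * degder f * ginv f)"
proof -
  assume f: "coeff f [] = 1"
  have "degder (f * ginv f) = 0"
    by (simp add: ginv_right[OF f] degder_simps)
  then have "f * degder (ginv f) = - (degder f * ginv f)"
    by (simp add: degder_simps eq_neg_iff_add_eq_0 add.commute)
  then have "ginv f * (f * degder (ginv f)) = - (ginv f * degder f * ginv f)"
    by (simp add: mult.assoc)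
  then show ?thesis
    by (simp add: mult.assoc[symmetric] ginv_left[OF f])
qed

definition ncexp :: "('x, 'k::field_char_0) ncs \<Rightarrow> ('x, 'k) ncs" where
  "ncexp f = Ncs (\<lambda>w. \<Sum>k\<le>length w. coeff (scl (1 / fact k) (f ^ k)) w)"

lemma coeff_ncexp: "coeff (ncexp f) w = (\<Sum>k\<le>length w. coeff (scl (1 / fact k) (f ^ k)) w)"
  by (simp add: ncexp_def Ncs_inverse)

lemma coeff_ncexp_Nil [simp]: "coeff (ncexp f) [] = 1"
  by (simp add: coeff_ncexp)

text \<open>The k-th power of f has order d k, hence the remainder has order d (n + 1). With n = 1
  this is the quadratic error behind all linearizations below.\<close>

lemma ncexp_approx:
  assumes "f \<in> order_ge d" "d > 0"
  shows "ncexp f - (\<Sum>k\<le>n. scl (1 / fact k) (f ^ k)) \<in> order_ge (d * Suc n)"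
proof -
  have *: "coeff (f ^ k) w = 0" if "d * k > length w" for k w
    using order_ge_power[OF assms(1), of k] that by (simp add: order_ge_def)
  then have "(\<Sum>k\<le>n. coeff (scl (1 / fact k) (f ^ k)) w) = coeff (ncexp f) w"
    if w: "length w < d * Suc n" for w
  proof -
    have zero: "coeff (scl (1 / fact k) (f ^ k)) w = 0" if "k > min n (length w)" for k
    proof -
      have "length w < d * k"
      proof (cases "k > n")
        case True
        then have "d * Suc n \<le> d * k" by (intro mult_le_mono) auto
        then show ?thesis using w by simp
      next
        case False
        then have "length w < k" using that by simp
        also have "k \<le> d * k" using assms(2) by simp
        finally show ?thesis .
      qed
      then show ?thesis using * by simp
    qed
    have "(\<Sum>k\<le>N. coeff (scl (1 / fact k) (f ^ k)) w)
        = (\<Sum>k\<le>min n (length w). coeff (scl (1 / fact k) (f ^ k)) w)"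
      if "min n (length w) \<le> N" for N
      using that zero by (intro sum_atMost_eq_order) auto
    from this[of n] this[of "length w"] show ?thesis by (simp add: coeff_ncexp)
  qed
  then show ?thesis by (simp add: order_ge_def)
qed

lemma ren_ncexp: "ren \<sigma> (ncexp f) = ncexp (ren \<sigma> f)"
  by (rule ncs_eqI) (simp only: coeff_ncexp ren_power[symmetric] ren_simps(6)[symmetric] coeff_simps(11) length_map)

lemma ncexp_zero [simp]: "ncexp 0 = 1"
proof (rule ncs_eqI)
  fix w :: "'a list"
  have "coeff (scl (1 / fact k) ((0::('a, 'b) ncs) ^ k)) w = (if k = 0 then coeff (1::('a, 'b) ncs) w else 0)"
    for k by (cases k) simp_all
  then show "coeff (ncexp (0::('a, 'b) ncs)) w = coeff 1 w"
    unfolding coeff_ncexp by (simp only: sum.delta) simp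
qed

text \<open>The derivation only rescales a homogeneous a, so a commutes with its derivative and the
  chain rule of the commutative exponential holds. Both logarithmic derivatives of
  \<open>ncexp a\<close> are then d a.\<close>

lemma degder_ncexp:
  fixes a :: "('x, 'k::field_char_0) ncs"
  assumes "degder a = scl (of_nat d) a" "a \<in> order_ge d" "d > 0"
  shows "degder (ncexp a) = scl (of_nat d) a * ncexp a" 
    and "degder (ncexp a) = ncexp a * scl (of_nat d) a"
proof -
  let ?S = "\<lambda>n. \<Sum>k\<le>n. scl (1 / fact k) (a ^ k)"
  have pow: "degder (a ^ k) = scl (of_nat (d * k)) (a ^ k)" for k
  proof (induction k)
    case (Suc k)
    have "degder (a ^ Suc k) = scl (of_nat d) a * a ^ k + a * scl (of_nat (d * k)) (a ^ k)"
      by (simp add: degder_simps(6) assms(1) Suc)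
    also have "\<dots> = scl (of_nat d) (a ^ Suc k) + scl (of_nat (d * k)) (a ^ Suc k)"
      by (simp add: mult_scl_left mult_scl_right)
    also have "\<dots> = scl (of_nat (d * Suc k)) (a ^ Suc k)"
      by (simp only: scl_simps(4)[symmetric] mult_Suc_right of_nat_add)
    finally show ?case .
  qed (simp add: degder_simps(4) scl_simps(7))
  have S: "degder (?S (Suc n)) = scl (of_nat d) a * ?S n" for n
  proof (induction n)
    case 0
    have "scl 1 f = f" for f :: "('x,'k) ncs" by (simp add: scl_simps)
    then show ?case by (simp add: degder_simps assms(1))
  next
    case (Suc n)
    have "degder (scl (1 / fact (Suc (Suc n))) (a ^ Suc (Suc n)))
        = scl (of_nat d) a * scl (1 / fact (Suc n)) (a ^ Suc n)"
    proof -
      have "(1 / fact (Suc (Suc n))) * of_nat (d * Suc (Suc n)) = of_nat d * (1 / fact (Suc n) :: 'k)"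
        unfolding fact_Suc[of "Suc n"] of_nat_mult
        by (simp add: divide_simps del: of_nat_Suc fact_Suc)
      then show ?thesis
        unfolding degder_simps pow mult_scl_left mult_scl_right scl_simps by simp
    qed
    then show ?case
      using Suc by (simp only: sum.atMost_Suc[of _ "Suc n"] sum.atMost_Suc[of _ n] degder_simps distrib_left)
  qed
  have comm: "a * ncexp a = ncexp a * a"
  proof (rule eq_if_order_ge)
    fix n
    have "a * (ncexp a - ?S n) - (ncexp a - ?S n) * a \<in> order_ge (d * Suc n)"
      by (intro order_ge_diff order_ge_mult_left order_ge_mult_right ncexp_approx assms)
    moreover have "a * ?S n = ?S n * a"
      by (simp add: sum_distrib_left sum_distrib_right mult_scl_left mult_scl_right power_commutes)
    ultimately have "a * ncexp a - ncexp a * a \<in> order_ge (d * Suc n)"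
      by (simp add: algebra_simps)
    then show "a * ncexp a - ncexp a * a \<in> order_ge n"
      by (rule order_ge_mono) (use assms(3) in \<open>simp add: trans_le_add2\<close>)
  qed
  show 1: "degder (ncexp a) = scl (of_nat d) a * ncexp a"
  proof (rule eq_if_order_ge)
    fix n
    have "degder (ncexp a - ?S (Suc n)) \<in> order_ge (d * Suc n)"
      by (intro order_ge_degder order_ge_mono[OF ncexp_approx[OF assms(2,3)]]) auto
    moreover have "scl (of_nat d) a * (ncexp a - ?S n) \<in> order_ge (d * Suc n)"
      by (intro order_ge_mult_left ncexp_approx assms)
    ultimately have "degder (ncexp a - ?S (Suc n)) - scl (of_nat d) a * (ncexp a - ?S n) \<in> order_ge (d * Suc n)"
      by (rule order_ge_diff)
    moreover have "degder (ncexp a - ?S (Suc n)) - scl (of_nat d) a * (ncexp a - ?S n)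
        = degder (ncexp a) - scl (of_nat d) a * ncexp a"
      unfolding degder_simps(2)[of "ncexp a"] S right_diff_distrib by simp
    ultimately have "degder (ncexp a) - scl (of_nat d) a * ncexp a \<in> order_ge (d * Suc n)"
      by metis
    then show "degder (ncexp a) - scl (of_nat d) a * ncexp a \<in> order_ge n"
      by (rule order_ge_mono) (use assms(3) in \<open>simp add: trans_le_add2\<close>)
  qed
  then show "degder (ncexp a) = ncexp a * scl (of_nat d) a"
    by (simp add: mult_scl_left mult_scl_right comm)
qed

subsection \<open>Products of homogeneous components\<close>

lemma conv_homogeneous:
  assumes "\<And>u. length u \<noteq> i \<Longrightarrow> f u = 0" "\<And>u. length u \<noteq> j \<Longrightarrow> g u = 0" "length w \<noteq> i + j"
  shows "conv w f g = 0"
  using assms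
proof (induction w arbitrary: f i)
  case (Cons r w)
  have "f [] * g (r # w) = 0" using Cons.prems by (cases i) auto
  moreover have "conv w (\<lambda>u. f (r # u)) g = 0"
  proof (cases i)
    case 0
    then show ?thesis using Cons.prems(1) by (simp add: conv_zero_left)
  next
    case (Suc i')
    then show ?thesis using Cons.prems by (intro Cons.IH[of i']) auto
  qed
  ultimately show ?case by simp
qed auto

lemma conv_split:
  "conv w f g = (\<Sum>i\<le>length w. conv w (\<lambda>u. if length u = i then f u else 0)
    (\<lambda>u. if length u = length w - i then g u else 0))"
proof (induction w arbitrary: f)
  case (Cons r w)
  show ?case
    unfolding list.size sum.atMost_Suc_shift add_0_right add_Suc_right
    using Cons[of "\<lambda>u. f (r # u)"] by (simp add: conv_zero_left)
qed simp

lemma hpart_mult: "hpart n (f * g) = (\<Sum>i\<le>n. hpart i f * hpart (n - i) g)"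
proof (rule ncs_eqI)
  fix w
  show "coeff (hpart n (f * g)) w = coeff (\<Sum>i\<le>n. hpart i f * hpart (n - i) g) w"
  proof (cases "length w = n")
    case True
    then show ?thesis
      using conv_split[of w "coeff f" "coeff g"] by (simp add: coeff_mult hpart.rep_eq)
  next
    case False
    have "conv w (coeff (hpart i f)) (coeff (hpart (n - i) g)) = 0" if "i \<le> n" for i
      by (rule conv_homogeneous[of i _ "n - i"]) (use that False in auto)
    then show ?thesis
      using False by (simp add: coeff_mult)
  qed
qed

lemma hpart_degder: "hpart n (degder f) = scl (of_nat n) (hpart n f)"
  by (rule ncs_eqI) simp

lemma hpart_approx: "f - (\<Sum>d\<le>n. hpart d f) \<in> order_ge (Suc n)"
  by (simp add: order_ge_def sum.delta)

section \<open>Lie series and group-like series through logarithmic derivatives\<close>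

section \<open>Lie elements and grouplike series\<close>

text \<open>The homogeneous parts of the free Lie algebra inside the free associative algebra. Only
  brackets with a letter on the left are generated, so that L_(n+1) is the sum of the [t_r, L_n] is
  built into the induction rule; closure under all brackets is proved afterwards.\<close>

inductive lie :: "'x set \<Rightarrow> nat \<Rightarrow> ('x, 'k::field) ncs \<Rightarrow> bool" for X where
  var: "r \<in> X \<Longrightarrow> lie X (Suc 0) (var r)"
| zero: "lie X n 0"
| add: "lie X n a \<Longrightarrow> lie X n b \<Longrightarrow> lie X n (a + b)"
| scl: "lie X n a \<Longrightarrow> lie X n (scl c a)"
| br: "r \<in> X \<Longrightarrow> lie X n a \<Longrightarrow> lie X (Suc n) (var r * a - a * var r)"

lemma lie_uminus: "lie X n a \<Longrightarrow> lie X n (- a)"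
  using lie.scl[of X n a "- 1"] scl_simps(3)[of 1 a] scl_simps(6)[of a]
  by (metis add.inverse_inverse add_cancel_left_right add_eq_0_iff scl_simps(4,7))

lemma lie_diff: "lie X n a \<Longrightarrow> lie X n b \<Longrightarrow> lie X n (a - b)"
  using lie.add[OF _ lie_uminus] by fastforce

lemma lie_sum: "(\<And>i. i \<in> A \<Longrightarrow> lie X n (F i)) \<Longrightarrow> lie X n (sum F A)"
  by (induction A rule: infinite_finite_induct) (auto intro: lie.zero lie.add)

lemma lie_homogeneous: "lie X n a \<Longrightarrow> length w \<noteq> n \<Longrightarrow> coeff a w = 0"
proof (induction arbitrary: w rule: lie.induct)
  case (br r n a)
  have "coeff (var r * a) w = 0" "coeff (a * var r) w = 0"
    unfolding coeff_mult using br
    by (intro conv_homogeneous[of "Suc 0" _ n] conv_homogeneous[of n _ "Suc 0"]; auto)+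
  then show ?case by simp
qed auto

lemma lie_hpart: "lie X n a \<Longrightarrow> hpart n a = a"
  by (rule ncs_eqI) (auto simp: lie_homogeneous)

lemma lie_hpart_neq: "lie X n a \<Longrightarrow> k \<noteq> n \<Longrightarrow> hpart k a = 0"
  by (rule ncs_eqI) (auto simp: lie_homogeneous)

lemma lie_degder: "lie X n a \<Longrightarrow> degder a = scl (of_nat n) a"
proof (rule ncs_eqI)
  fix w
  assume "lie X n a"
  then show "coeff (degder a) w = coeff (scl (of_nat n) a) w"
    by (cases "length w = n") (auto simp: lie_homogeneous)
qed

lemma lie_order_ge: "lie X n a \<Longrightarrow> a \<in> order_ge n"
  by (auto simp: order_ge_def lie_homogeneous)

lemma lie_0: "lie X 0 a \<Longrightarrow> a = 0"
proof -
  have "lie X n a \<Longrightarrow> n = 0 \<Longrightarrow> a = 0" for n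
    by (induction rule: lie.induct) (auto simp: scl_simps)
  then show "lie X 0 a \<Longrightarrow> a = 0" by simp
qed

text \<open>Induction on the first argument, for all b at once: the Jacobi identity writes [[r, a],
  b] as [r, [a, b]] - [a, [r, b]], where only brackets with the shorter a remain.\<close>

lemma lie_bracket:
  assumes "lie X i a" "lie X j b"
  shows "lie X (i + j) (a * b - b * a)"
  using assms
proof (induction arbitrary: j b rule: lie.induct)
  case (var r)
  then show ?case using lie.br[of r X j b] by simp
next
  case (add n a a')
  have "(a + a') * b - b * (a + a') = (a * b - b * a) + (a' * b - b * a')"
    by (simp add: algebra_simps)
  then show ?case using add by (metis lie.add)
next
  case (scl n a c)
  have "scl c a * b - b * scl c a = scl c (a * b - b * a)"
    by (simp add: mult_scl_left mult_scl_right scl_simps)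
  then show ?case using scl by (metis lie.scl)
next
  case (br r n a)
  let ?B = "\<lambda>f g. f * g - g * f"
  have "?B (?B (var r) a) b = ?B (var r) (?B a b) - ?B a (?B (var r) b)"
    by (simp add: algebra_simps)
  moreover have "lie X (Suc (n + j)) (?B (var r) (?B a b))"
    by (intro lie.br br.IH br)
  moreover have "lie X (n + Suc j) (?B a (?B (var r) b))"
    by (intro br.IH lie.br br)
  ultimately show ?case by (simp add: lie_diff)
qed (auto intro: lie.zero)

text \<open>The inverse is carried along because \<open>ren \<sigma>\<close> moves the letters by
  \<tau>.\<close>

definition letter_sym :: "'x set \<Rightarrow> ('x \<Rightarrow> 'x) \<Rightarrow> ('x \<Rightarrow> 'x) \<Rightarrow> bool" where
  "letter_sym X \<sigma> \<tau> \<longleftrightarrow> \<sigma> \<circ> \<tau> = id \<and> \<tau> \<circ> \<sigma> = id \<and> \<sigma> ` X \<subseteq> X \<and> \<tau> ` X \<subseteq> X"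

lemma letter_sym_ren_var: "letter_sym X \<sigma> \<tau> \<Longrightarrow> ren \<sigma> (var r) = var (\<tau> r)"
  by (rule ren_var) (metis comp_apply id_apply letter_sym_def)

lemma letter_sym_ren_inverse: "letter_sym X \<sigma> \<tau> \<Longrightarrow> ren \<sigma> (ren \<tau> a) = a"
  by (simp add: ren_simps letter_sym_def)

lemma letter_sym_flip: "letter_sym X \<sigma> \<tau> \<Longrightarrow> letter_sym X \<tau> \<sigma>"
  by (auto simp: letter_sym_def)

lemma letter_sym_comp:
  "letter_sym X \<sigma> \<tau> \<Longrightarrow> letter_sym X \<sigma>' \<tau>' \<Longrightarrow> letter_sym X (\<sigma> \<circ> \<sigma>') (\<tau>' \<circ> \<tau>)"
  unfolding letter_sym_def by (simp add: fun_eq_iff image_subset_iff)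

lemma lie_ren:
  assumes "letter_sym X \<sigma> \<tau>" "lie X n a"
  shows "lie X n (ren \<sigma> a)"
  using assms(2)
proof (induction rule: lie.induct)
  case (br r n a)
  then show ?case
    using lie.br[of "\<tau> r" X n "ren \<sigma> a"] assms(1)
    by (auto simp: ren_simps letter_sym_ren_var[OF assms(1)] letter_sym_def)
qed (use assms(1) in \<open>auto simp: ren_simps letter_sym_ren_var[OF assms(1)] letter_sym_def intro: lie.intros\<close>)

text \<open>These series form the degree completion of the free Lie algebra on X.\<close>

definition liehat :: "'x set \<Rightarrow> ('x, 'k::field) ncs \<Rightarrow> bool" where
  "liehat X f \<longleftrightarrow> (\<forall>n. lie X n (hpart n f))"

lemma liehat_add: "liehat X f \<Longrightarrow> liehat X g \<Longrightarrow> liehat X (f + g)"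
  by (simp add: liehat_def hpart_simps lie.add)

lemma liehat_uminus: "liehat X f \<Longrightarrow> liehat X (- f)"
  by (simp add: liehat_def hpart_simps lie_uminus)

lemma liehat_zero: "liehat X 0"
  by (simp add: liehat_def hpart_simps lie.zero)

lemma lie_imp_liehat: "lie X n a \<Longrightarrow> liehat X a"
  unfolding liehat_def by (metis lie.zero lie_hpart lie_hpart_neq)

lemma liehat_ren: "letter_sym X \<sigma> \<tau> \<Longrightarrow> liehat X f \<Longrightarrow> liehat X (ren \<sigma> f)"
  unfolding liehat_def hpart_simps by (metis lie_ren)

text \<open>Being group-like is expressed without a coproduct: both logarithmic derivatives, for the
  derivation multiplying degree \<open>n\<close> by \<open>n\<close>, are Lie series. The leading term of such a series is then
  visibly a Lie element, so neither the Campbell-Hausdorff formula nor Friedrichs' criterion is needed.\<close>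

definition grp :: "'x set \<Rightarrow> ('x, 'k::field) ncs set" where
  "grp X = {g. coeff g [] = 1 \<and> liehat X (degder g * ginv g) \<and> liehat X (ginv g * degder g)}"

lemma grp_Nil: "g \<in> grp X \<Longrightarrow> coeff g [] = 1"
  by (simp add: grp_def)

lemma grpI:
  assumes "coeff g [] = 1" "degder g = l * g" "degder g = g * l'" "liehat X l" "liehat X l'"
  shows "g \<in> grp X"
proof -
  have "degder g * ginv g = l"
    by (simp add: assms(2) mult.assoc ginv_right assms(1))
  moreover have "ginv g * degder g = l'"
    by (simp add: assms(3) mult.assoc[symmetric] ginv_left assms(1))
  ultimately show ?thesis using assms by (simp add: grp_def)
qed

lemma grpE:
  assumes "g \<in> grp X"
  obtains l l' where "coeff g [] = 1" "degder g = l * g" "degder g = g * l'" "liehat X l" "liehat X l'"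
proof
  show "coeff g [] = 1" "liehat X (degder g * ginv g)" "liehat X (ginv g * degder g)"
    using assms by (auto simp: grp_def)
  then show "degder g = degder g * ginv g * g" "degder g = g * (ginv g * degder g)"
    by (simp_all add: mult.assoc ginv_left) (simp add: mult.assoc[symmetric] ginv_right)
qed

text \<open>The components of \<open>w = g z g\<inverse>\<close> satisfy \<open>(n - d) w\<^sub>n = \<Sum>i. [l\<^sub>i, w\<^sub>n\<^sub>-\<^sub>i]\<close>.\<close>

lemma conjugate_lie:
  fixes g :: "('x, 'k::field_char_0) ncs"
  assumes g: "coeff g [] = 1" "degder g = l * g" "liehat X l" and z: "lie X d z"
  shows "liehat X (g * z * ginv g)"
proof -
  define w where "w = g * z * ginv g"
  have gi: "degder (ginv g) = - (ginv g * l)"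
    by (simp add: degder_ginv g mult.assoc ginv_right)
  have "degder w = l * w - w * l + scl (of_nat d) w"
    unfolding w_def degder_simps gi g(2) lie_degder[OF z]
    by (simp add: algebra_simps mult_scl_left mult_scl_right)
  then have Dw: "degder w - scl (of_nat d) w = l * w - w * l" by simp
  \<comment> \<open>Without a degree 0 part in l, the recursion for degree n involves only lower
    components of w.\<close>
  have l0: "hpart 0 l = 0"
    using g(3) lie_0 unfolding liehat_def by metis
  \<comment> \<open>In degree d the factor n - d vanishes and the recursion says nothing; there w
    agrees with z.\<close>
  have lead: "w - z \<in> order_ge (Suc d)"
  proof -
    have g1: "g - 1 \<in> order_ge (Suc 0)"
      by (simp add: order_ge_Suc_0_iff g)
    have zd: "z \<in> order_ge d" using z by (rule lie_order_ge)
    have "((g - 1) * z - z * (g - 1)) * ginv g \<in> order_ge (Suc d)"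
      using order_ge_mult[OF g1 zd] order_ge_mult[OF zd g1]
      using order_ge_mult_right order_ge_diff by fastforce
    also have "((g - 1) * z - z * (g - 1)) * ginv g = w - z"
      by (simp add: w_def algebra_simps ginv_right[OF g(1)])
    finally show ?thesis .
  qed
  have "lie X n (hpart n w)" for n
  proof (induction n rule: less_induct)
    case (less n)
    show ?case
    proof (cases "n = d")
      case True
      then show ?thesis
        using hpart_cong_order[OF lead, of d] z by (simp add: lie_hpart)
    next
      case False
      have "scl (of_nat n - of_nat d) (hpart n w) = hpart n (degder w - scl (of_nat d) w)"
        by (rule ncs_eqI) (simp add: algebra_simps)
      also have "\<dots> = hpart n (l * w) - hpart n (w * l)"
        by (simp only: Dw hpart_simps)
      also have "hpart n (w * l) = (\<Sum>i\<le>n. hpart (n - i) w * hpart i l)"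
        unfolding hpart_mult by (rule sum.reindex_bij_witness[of _ "\<lambda>i. n - i" "\<lambda>i. n - i"]) auto
      also have "hpart n (l * w) - \<dots>
          = (\<Sum>i\<le>n. hpart i l * hpart (n - i) w - hpart (n - i) w * hpart i l)"
        by (simp add: hpart_mult sum_subtractf)
      finally have eq: "scl (of_nat n - of_nat d) (hpart n w)
          = (\<Sum>i\<le>n. hpart i l * hpart (n - i) w - hpart (n - i) w * hpart i l)" .
      have "lie X n (\<Sum>i\<le>n. hpart i l * hpart (n - i) w - hpart (n - i) w * hpart i l)"
      proof (rule lie_sum)
        fix i assume i: "i \<in> {..n}"
        show "lie X n (hpart i l * hpart (n - i) w - hpart (n - i) w * hpart i l)"
        proof (cases "i = 0")
          case True
          then show ?thesis by (simp add: l0 lie.zero)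
        next
          case False
          then have "lie X (n - i) (hpart (n - i) w)" using i less by simp
          moreover have "lie X i (hpart i l)" using g(3) by (simp add: liehat_def)
          ultimately show ?thesis using lie_bracket[of X i _ "n - i"] i by force
        qed
      qed
      then have "lie X n (scl (1 / (of_nat n - of_nat d)) (scl (of_nat n - of_nat d) (hpart n w)))"
        unfolding eq by (rule lie.scl)
      moreover have "(of_nat n - of_nat d :: 'k) \<noteq> 0" using False by simp
      ultimately show ?thesis by (simp add: scl_simps)
    qed
  qed
  then show ?thesis by (simp add: liehat_def w_def)
qed

lemma conjugate_liehat:
  fixes g :: "('x, 'k::field_char_0) ncs"
  assumes g: "coeff g [] = 1" "degder g = l * g" "liehat X l" and z: "liehat X z"
  shows "liehat X (g * z * ginv g)"
  unfolding liehat_def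
proof
  fix n
  \<comment> \<open>Degree n of the conjugate sees only the components of z up to degree n, which
    reduces the claim to homogeneous z.\<close>
  have "g * (z - (\<Sum>d\<le>n. hpart d z)) * ginv g \<in> order_ge (Suc n)"
    by (intro order_ge_mult_left order_ge_mult_right hpart_approx)
  then have "g * z * ginv g - g * (\<Sum>d\<le>n. hpart d z) * ginv g \<in> order_ge (Suc n)"
    by (simp add: algebra_simps)
  then have "hpart n (g * z * ginv g) = (\<Sum>d\<le>n. hpart n (g * hpart d z * ginv g))"
    by (subst hpart_cong_order, assumption) (simp_all add: hpart_sum sum_distrib_left sum_distrib_right)
  moreover have "lie X n (hpart n (g * hpart d z * ginv g))" for d
    using conjugate_lie[OF g, of d "hpart d z"] z by (simp add: liehat_def)
  ultimately show "lie X n (hpart n (g * z * ginv g))"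
    by (simp add: lie_sum)
qed

lemma grp_one [simp]: "1 \<in> grp X"
  by (rule grpI[of _ 0 0]) (simp_all add: degder_simps liehat_zero)

text \<open>Inversion exchanges the two logarithmic derivatives up to sign; this is why
  \<open>grp\<close> asks for both of them to be Lie series.\<close>

lemma grp_ginv:
  assumes "g \<in> grp X"
  shows "ginv g \<in> grp X"
proof -
  obtain l l' where *: "coeff g [] = 1" "degder g = l * g" "degder g = g * l'" "liehat X l" "liehat X l'"
    using assms by (rule grpE)
  show ?thesis
  proof (rule grpI[of _ "- l'" "- l"])
    show "degder (ginv g) = - l' * ginv g"
      unfolding degder_ginv[OF *(1)] *(3) by (simp add: mult.assoc[symmetric] ginv_left *(1))
    show "degder (ginv g) = ginv g * - l"
      by (simp add: degder_ginv * mult.assoc ginv_right)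
  qed (use * in \<open>auto simp: liehat_uminus\<close>)
qed

text \<open>The left logarithmic derivative of g h is l + g k g^-1, the right one is h^-1 l' h + k'.
  Closure therefore rests on conjugation preserving Lie series, once by g and once by h^-1.\<close>

lemma grp_mult:
  fixes g h :: "('x, 'k::field_char_0) ncs"
  assumes "g \<in> grp X" "h \<in> grp X"
  shows "g * h \<in> grp X"
proof -
  obtain l l' where g: "coeff g [] = 1" "degder g = l * g" "degder g = g * l'" "liehat X l" "liehat X l'"
    using assms(1) by (rule grpE)
  obtain k k' where h: "coeff h [] = 1" "degder h = k * h" "degder h = h * k'" "liehat X k" "liehat X k'"
    using assms(2) by (rule grpE)
  obtain j where hi: "degder (ginv h) = j * ginv h" "liehat X j"
    using grp_ginv[OF assms(2)] by (rule grpE)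
  have ih: "ginv (ginv h) = h" using h(1) by simp
  show ?thesis
  proof (rule grpI[of _ "l + g * k * ginv g" "ginv h * l' * h + k'"])
    have 1: "degder (g * h) = degder g * h + g * degder h" by (simp add: degder_simps)
    show "degder (g * h) = (l + g * k * ginv g) * (g * h)"
    proof -
      have "g * k * ginv g * (g * h) = g * (k * h)"
        by (metis ginv_left[OF g(1)] mult.assoc mult.left_neutral)
      then show ?thesis unfolding 1 g(2) h(2) by (simp add: distrib_right mult.assoc)
    qed
    show "degder (g * h) = (g * h) * (ginv h * l' * h + k')"
    proof -
      have "g * h * (ginv h * l' * h) = g * l' * h"
        by (metis ginv_right[OF h(1)] mult.assoc mult.left_neutral)
      then show ?thesis unfolding 1 g(3) h(3) by (simp add: distrib_left mult.assoc)
    qed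
    show "liehat X (l + g * k * ginv g)"
      by (intro liehat_add conjugate_liehat[of g l] g h)
    have "liehat X (ginv h * l' * ginv (ginv h))"
      by (rule conjugate_liehat[OF _ hi g(5)]) simp
    then show "liehat X (ginv h * l' * h + k')"
      using h by (simp add: ih liehat_add)
  qed (use g h in simp)
qed

lemma grp_power:
  fixes g :: "('x, 'k::field_char_0) ncs"
  shows "g \<in> grp X \<Longrightarrow> g ^ n \<in> grp X"
  by (induction n) (simp_all add: grp_mult)

lemma grp_ren:
  assumes "letter_sym X \<sigma> \<tau>" "g \<in> grp X"
  shows "ren \<sigma> g \<in> grp X"
proof -
  obtain l l' where g: "coeff g [] = 1" "degder g = l * g" "degder g = g * l'" "liehat X l" "liehat X l'"
    using assms(2) by (rule grpE)
  show ?thesis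
  proof (rule grpI[of _ "ren \<sigma> l" "ren \<sigma> l'"])
    show "degder (ren \<sigma> g) = ren \<sigma> l * ren \<sigma> g"
      by (simp only: ren_simps(8)[symmetric] g(2) ren_simps(7))
    show "degder (ren \<sigma> g) = ren \<sigma> g * ren \<sigma> l'"
      by (simp only: ren_simps(8)[symmetric] g(3) ren_simps(7))
  qed (use g assms(1) in \<open>auto intro: liehat_ren\<close>)
qed

lemma grp_ncexp:
  fixes a :: "('x, 'k::field_char_0) ncs"
  assumes "lie X n a"
  shows "ncexp a \<in> grp X"
proof (cases "n = 0")
  case True
  then show ?thesis using assms lie_0 by fastforce
next
  case False
  show ?thesis
    by (rule grpI[of _ "scl (of_nat n) a" "scl (of_nat n) a"])
      (use degder_ncexp[OF lie_degder[OF assms] lie_order_ge[OF assms]] False assms in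
        \<open>auto intro: lie_imp_liehat lie.scl\<close>)
qed

text \<open>Each component of a logarithmic derivative depends on finitely many components of g, so
  being group-like passes to limits for the order filtration.\<close>

lemma grp_limit:
  assumes "\<And>n. \<exists>g' \<in> grp X. g - g' \<in> order_ge n"
  shows "g \<in> grp X"
proof -
  have g1: "coeff g [] = 1"
    using assms[of "Suc 0"] by (auto simp: order_ge_Suc_0_iff grp_Nil)
  have "lie X n (hpart n (degder g * ginv g)) \<and> lie X n (hpart n (ginv g * degder g))" for n
  proof -
    obtain g' where g': "g' \<in> grp X" "g - g' \<in> order_ge (Suc n)"
      using assms by blast
    have "degder g - degder g' \<in> order_ge (Suc n)"
      using order_ge_degder[OF g'(2)] by (simp add: degder_simps)
    then have "degder g * ginv g - degder g' * ginv g' \<in> order_ge (Suc n)"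
      "ginv g * degder g - ginv g' * degder g' \<in> order_ge (Suc n)"
      using g1 g' by (auto intro!: order_ge_mult_cong order_ge_ginv grp_Nil)
    then have "hpart n (degder g * ginv g) = hpart n (degder g' * ginv g')"
      "hpart n (ginv g * degder g) = hpart n (ginv g' * degder g')"
      by (auto intro: hpart_cong_order)
    then show ?thesis
      using g' by (simp add: grp_def liehat_def)
  qed
  then show ?thesis
    using g1 by (simp add: grp_def liehat_def)
qed

lemma order_ge_unit_left:
  assumes "coeff u [] = 1" "c \<in> order_ge n"
  shows "u * c - c \<in> order_ge (Suc n)"
  using order_ge_mult[of "u - 1" "Suc 0" c n] assms by (simp add: order_ge_Suc_0_iff algebra_simps)

lemma order_ge_unit_right:
  assumes "coeff u [] = 1" "c \<in> order_ge n"
  shows "c * u - c \<in> order_ge (Suc n)"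
  using order_ge_mult[of c n "u - 1" "Suc 0"] assms by (simp add: order_ge_Suc_0_iff algebra_simps)

text \<open>If g - 1 starts in degree n, so does \<open>degder g\<close>, and dividing by g does not
  change its leading part, n times that of g. Applied to the error of an approximate solution, this
  shows that only Lie elements have to be removed.\<close>

lemma grp_leading_term:
  fixes g :: "('x, 'k::field_char_0) ncs"
  assumes "g \<in> grp X" "g - 1 \<in> order_ge n" "n > 0"
  shows "lie X n (hpart n g)"
proof -
  have D: "degder g \<in> order_ge n"
    using order_ge_degder[OF assms(2)] by (simp add: degder_simps)
  have "hpart n (degder g * ginv g) = hpart n (degder g)"
    by (rule hpart_cong_order[OF order_ge_unit_right[OF _ D]]) simp_all
  then have "lie X n (scl (of_nat n) (hpart n g))"
    using assms(1) unfolding grp_def liehat_def hpart_degder by (metis (mono_tags, lifting) mem_Collect_eq)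
  from lie.scl[OF this, of "1 / of_nat n"] show ?thesis
    using assms(3) by (simp add: scl_simps)
qed

section \<open>Successive approximation for the twisted product equation\<close>

section \<open>Solving the product equation degree by degree\<close>

lemma ncexp_minus_linear:
  assumes "lie X n a" "n > 0"
  shows "ncexp a - 1 - a \<in> order_ge (2 * n)"
  using ncexp_approx[OF lie_order_ge[OF assms(1)] assms(2), of 1]
  by (simp add: scl_simps diff_diff_eq mult.commute[of 2] mult_2_right)

lemma ncexp_minus_one:
  assumes "lie X n a" "n > 0"
  shows "ncexp a - 1 \<in> order_ge n"
proof -
  have "ncexp a - 1 - a + a \<in> order_ge n"
    using assms by (intro order_ge_add lie_order_ge order_ge_mono[OF ncexp_minus_linear]) auto
  then show ?thesis by simp
qed

text \<open>The commutator of the two exponentials begins with [a, x] in degree n + 1, and all other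
  mixed terms have degree at least n + 2. This is how a factor of degree n acts on the error one
  degree higher.\<close>

lemma order_ge_commute_exp:
  fixes a x :: "('x, 'k::field_char_0) ncs"
  assumes a: "lie X n a" and x: "lie X (Suc 0) x" and n: "n > 0"
  shows "ncexp a * ncexp x - ncexp x * ncexp a - (a * x - x * a) \<in> order_ge (Suc (Suc n))"
proof -
  define p where "p = ncexp a - 1 - a"
  define e where "e = ncexp x - 1 - x"
  have p: "p \<in> order_ge (Suc n)"
    unfolding p_def by (rule order_ge_mono[OF ncexp_minus_linear[OF a n]]) (use n in simp)
  have e: "e \<in> order_ge 2"
    unfolding e_def using ncexp_minus_linear[OF x] by simp
  have a': "a \<in> order_ge n" and x': "x \<in> order_ge (Suc 0)"
    using a x by (auto intro: lie_order_ge)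
  have *: "ncexp a = 1 + a + p" "ncexp x = 1 + x + e"
    by (simp_all add: p_def e_def)
  have "ncexp a * ncexp x - ncexp x * ncexp a - (a * x - x * a)
      = (a * e - e * a) + (p * x - x * p) + (p * e - e * p)"
    unfolding * by (simp add: algebra_simps)
  also have "\<dots> \<in> order_ge (Suc (Suc n))"
    using order_ge_mult[OF a' e] order_ge_mult[OF e a'] order_ge_mult[OF p x'] order_ge_mult[OF x' p]
      order_ge_mult_right[OF order_ge_mult[OF p x'], of 1]
      order_ge_mono[OF order_ge_mult[OF p e], of "Suc (Suc n)"]
      order_ge_mono[OF order_ge_mult[OF e p], of "Suc (Suc n)"]
    by (intro order_ge_add order_ge_diff) simp_all
  finally show ?thesis .
qed

text \<open>The factor p is the correction from one degree lower: it is fixed by \<sigma>, and c is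
  the leading part of its commutator with E. With q = \<open>p * ncexp a\<close>, the estimate is
  made for \<open>ren \<sigma> q * E - E * q\<close>; dividing by q on the right does not change a
  leading part.\<close>

lemma side_correction:
  fixes a :: "('x, 'k::field_char_0) ncs"
  assumes ls: "letter_sym X \<sigma> \<tau>" and a: "lie X n a" "n > 0"
    and p: "coeff p [] = 1" "ren \<sigma> p = p"
    and E: "coeff E [] = 1"
    and c: "c \<in> order_ge n" and pE: "p * E - E * p - c \<in> order_ge (Suc n)"
  shows "ren \<sigma> (p * ncexp a) * E * ginv (p * ncexp a) - E - (ren \<sigma> a - a + c) \<in> order_ge (Suc n)"
proof -
  have lin: "u * (ncexp b - 1) * v - b \<in> order_ge (Suc n)"
    if "lie X n b" "coeff u [] = 1" "coeff v [] = 1" for u v b :: "('x, 'k) ncs"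
  proof -
    have 1: "ncexp b - 1 \<in> order_ge n"
      using that a by (intro ncexp_minus_one) auto
    have "u * (ncexp b - 1) * v - u * (ncexp b - 1) \<in> order_ge (Suc n)"
      by (intro order_ge_unit_right that order_ge_mult_left 1)
    moreover have "u * (ncexp b - 1) - (ncexp b - 1) \<in> order_ge (Suc n)"
      by (intro order_ge_unit_left that 1)
    moreover have "ncexp b - 1 - b \<in> order_ge (Suc n)"
      by (rule order_ge_mono[OF ncexp_minus_linear[OF that(1) a(2)]]) (use a in simp)
    ultimately show ?thesis by (blast intro: order_ge_trans)
  qed
  let ?q = "p * ncexp a" and ?\<delta> = "ren \<sigma> a - a + c"
  have q1: "coeff ?q [] = 1" using p by simp
  have rq: "ren \<sigma> ?q = p * ncexp (ren \<sigma> a)"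
    by (simp add: ren_simps p ren_ncexp)
  have sa: "lie X n (ren \<sigma> a)" using ls a by (simp add: lie_ren)
  let ?D = "ren \<sigma> ?q * E - E * ?q"
  have "?D - ?\<delta> = (p * E - E * p - c) + (p * (ncexp (ren \<sigma> a) - 1) * E - ren \<sigma> a)
      - (E * p * (ncexp a - 1) * 1 - a)"
    by (simp add: rq algebra_simps)
  also have "\<dots> \<in> order_ge (Suc n)"
    by (intro order_ge_add order_ge_diff pE lin sa a) (simp_all add: p E)
  finally have D: "?D - ?\<delta> \<in> order_ge (Suc n)" .
  have "?\<delta> \<in> order_ge n"
    by (intro order_ge_add order_ge_diff c lie_order_ge[OF sa] lie_order_ge[OF a(1)])
  from order_ge_add[OF order_ge_mono[OF D, of n] this] have "?D - ?\<delta> + ?\<delta> \<in> order_ge n"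
    by simp
  then have "?D \<in> order_ge n" by simp
  then have "?D * ginv ?q - ?D \<in> order_ge (Suc n)"
    by (intro order_ge_unit_right) simp_all
  from order_ge_trans[OF this D] show ?thesis
    by (simp add: left_diff_distrib mult.assoc[of E] ginv_right[OF q1])
qed

text \<open>The assumptions separate the linear algebra from the approximation: \<sigma> and
  \<upsilon> are mere letter permutations here, and \<open>degree_Suc\<close> is the linearized
  equation in degree n + 1. Degree 1 stands apart because there are no nonzero Lie elements of
  degree 0 to bracket with x and y.\<close>

locale product_equation =
  fixes X :: "'x set" and \<sigma> \<upsilon> \<sigma>' \<upsilon>' :: "'x \<Rightarrow> 'x" and x y z :: "('x, 'k::field_char_0) ncs"
  assumes sym_\<sigma>: "letter_sym X \<sigma> \<sigma>'" and sym_\<upsilon>: "letter_sym X \<upsilon> \<upsilon>'"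
    and lie_x: "lie X (Suc 0) x" and lie_y: "lie X (Suc 0) y" and lie_z: "lie X (Suc 0) z"
    and degree_one: "\<exists>a b. lie X (Suc 0) a \<and> lie X (Suc 0) b \<and>
      x + y - z + (ren \<sigma> a - a) + (ren \<upsilon> b - b) = 0"
    and degree_Suc: "\<And>n e. n > 0 \<Longrightarrow> lie X (Suc n) e \<Longrightarrow> \<exists>a b a' b'.
      lie X (Suc n) a \<and> lie X (Suc n) b \<and> lie X n a' \<and> lie X n b' \<and> ren \<sigma> a' = a' \<and> ren \<upsilon> b' = b' \<and>
      e + (ren \<sigma> a - a + (a' * x - x * a')) + (ren \<upsilon> b - b + (b' * y - y * b')) = 0"
begin

text \<open>Dividing by \<open>ncexp z\<close> instead of subtracting it keeps the error group-like,
  so its leading term is a Lie element.\<close>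

definition defect :: "('x, 'k) ncs \<Rightarrow> ('x, 'k) ncs \<Rightarrow> ('x, 'k) ncs" where
  "defect g h = ren \<sigma> g * ncexp x * ginv g * ren \<upsilon> h * ncexp y * ginv h * ginv (ncexp z)"

lemma defect_grp: "g \<in> grp X \<Longrightarrow> h \<in> grp X \<Longrightarrow> defect g h \<in> grp X"
  unfolding defect_def
  by (intro grp_mult grp_ren[OF sym_\<sigma>] grp_ren[OF sym_\<upsilon>] grp_ginv
      grp_ncexp[OF lie_x] grp_ncexp[OF lie_y] grp_ncexp[OF lie_z])

lemma defect_cong:
  assumes "g \<in> grp X" "h \<in> grp X" "g' \<in> grp X" "h' \<in> grp X" "g - g' \<in> order_ge n" "h - h' \<in> order_ge n"
  shows "defect g h - defect g' h' \<in> order_ge n"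
proof -
  have "ren \<sigma> g - ren \<sigma> g' \<in> order_ge n" "ren \<upsilon> h - ren \<upsilon> h' \<in> order_ge n"
    using order_ge_ren[OF assms(5), of \<sigma>] order_ge_ren[OF assms(6), of \<upsilon>] by (simp_all add: ren_simps)
  then show ?thesis
    unfolding defect_def using assms
    by (intro order_ge_mult_cong order_ge_ginv) (simp_all add: grp_Nil)
qed

text \<open>Replacing g by g q replaces \<open>ncexp x\<close> by
  \<open>ren \<sigma> q * ncexp x * ginv q\<close> between unchanged outer factors. These have
  constant term 1 and do not affect leading terms, and the mixed term of \<delta> and \<epsilon> has
  order 2 n, which is at least n + 1 as n > 0.\<close>

lemma defect_correction:
  assumes gh: "g \<in> grp X" "h \<in> grp X" and n: "n > 0"
    and P: "ren \<sigma> (q::('x, 'k) ncs) * ncexp x * ginv q - ncexp x - \<delta> \<in> order_ge (Suc n)" "\<delta> \<in> order_ge n" "coeff q [] = 1"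
    and R: "ren \<upsilon> (r::('x, 'k) ncs) * ncexp y * ginv r - ncexp y - \<epsilon> \<in> order_ge (Suc n)" "\<epsilon> \<in> order_ge n" "coeff r [] = 1"
  shows "defect (g * q) (h * r) - defect g h - (\<delta> + \<epsilon>) \<in> order_ge (Suc n)"
proof -
  define A where "A = ren \<sigma> q * ncexp x * ginv q"
  define B where "B = ren \<upsilon> r * ncexp y * ginv r"
  define u where "u = ren \<sigma> g"
  define v where "v = ginv g * ren \<upsilon> h"
  define w where "w = ginv h * ginv (ncexp z)"
  note g1 = grp_Nil[OF gh(1)] and h1 = grp_Nil[OF gh(2)]
  have uvw: "coeff u [] = 1" "coeff v [] = 1" "coeff w [] = 1"
    by (simp_all add: u_def v_def w_def g1 h1)
  have 1: "defect (g * q) (h * r) = u * A * v * B * w"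
    by (simp add: defect_def A_def B_def u_def v_def w_def ren_simps ginv_mult g1 h1 P R mult.assoc)
  have 2: "defect g h = u * ncexp x * v * ncexp y * w"
    by (simp add: defect_def u_def v_def w_def mult.assoc)
  have A: "A - (ncexp x + \<delta>) \<in> order_ge (Suc n)"
    using P(1) by (simp add: A_def algebra_simps)
  have B: "B - (ncexp y + \<epsilon>) \<in> order_ge (Suc n)"
    using R(1) by (simp add: B_def algebra_simps)
  have S1: "u * A * v * B * w - u * (ncexp x + \<delta>) * v * (ncexp y + \<epsilon>) * w \<in> order_ge (Suc n)"
    by (intro order_ge_mult_cong A B) simp_all
  have lin: "a * d * b - d \<in> order_ge (Suc n)"
    if "d \<in> order_ge n" "coeff a [] = 1" "coeff b [] = 1" for a b d :: "('x, 'k) ncs"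
    by (rule order_ge_trans[OF order_ge_unit_right order_ge_unit_left])
      (use that in \<open>simp_all add: order_ge_mult_left\<close>)
  have "\<delta> * v * \<epsilon> \<in> order_ge (n + n)"
    using P R by (intro order_ge_mult order_ge_mult_right)
  then have "u * (\<delta> * v * \<epsilon>) * w \<in> order_ge (n + n)"
    using order_ge_mult_right order_ge_mult_left by blast
  then have small: "u * (\<delta> * v * \<epsilon>) * w \<in> order_ge (Suc n)"
    by (rule order_ge_mono) (use n in simp)
  have "u * (ncexp x + \<delta>) * v * (ncexp y + \<epsilon>) * w - u * ncexp x * v * ncexp y * w - (\<delta> + \<epsilon>)
      = (u * \<delta> * (v * ncexp y * w) - \<delta>) + ((u * ncexp x * v) * \<epsilon> * w - \<epsilon>) + u * (\<delta> * v * \<epsilon>) * w"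
    by (simp add: algebra_simps)
  also have "\<dots> \<in> order_ge (Suc n)"
    using P R by (intro order_ge_add lin small) (simp_all add: uvw)
  finally have "u * A * v * B * w - u * (ncexp x + \<delta>) * v * (ncexp y + \<epsilon>) * w +
      (u * (ncexp x + \<delta>) * v * (ncexp y + \<epsilon>) * w - u * ncexp x * v * ncexp y * w - (\<delta> + \<epsilon>)) \<in> order_ge (Suc n)"
    by (rule order_ge_add[OF S1])
  then show ?thesis unfolding 1 2 by (simp add: algebra_simps)
qed

text \<open>The error starts in degree n + 2, but g and h change from degree n + 1 on, on account of
  a' and b'. As these are invariant, their effect on the defect starts only in degree n + 2, through
  the brackets with x and y.\<close>

lemma correction_step:
  assumes gh: "g \<in> grp X" "h \<in> grp X" and small: "defect g h - 1 \<in> order_ge (Suc (Suc n))"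
  shows "\<exists>g' \<in> grp X. \<exists>h' \<in> grp X. defect g' h' - 1 \<in> order_ge (Suc (Suc (Suc n)))
    \<and> g' - g \<in> order_ge (Suc n) \<and> h' - h \<in> order_ge (Suc n)"
proof -
  let ?N = "Suc (Suc n)"
  define e where "e = hpart ?N (defect g h)"
  have "lie X ?N e"
    unfolding e_def by (rule grp_leading_term[OF defect_grp[OF gh] small]) simp
  then obtain a b a' b' where ab: "lie X ?N a" "lie X ?N b" "lie X (Suc n) a'" "lie X (Suc n) b'"
    "ren \<sigma> a' = a'" "ren \<upsilon> b' = b'"
    and zero: "e + (ren \<sigma> a - a + (a' * x - x * a')) + (ren \<upsilon> b - b + (b' * y - y * b')) = 0"
    using degree_Suc[of "Suc n" e] by auto
  let ?\<delta> = "ren \<sigma> a - a + (a' * x - x * a')" and ?\<epsilon> = "ren \<upsilon> b - b + (b' * y - y * b')"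
  let ?q = "ncexp a' * ncexp a" and ?r = "ncexp b' * ncexp b"
  have brackets: "a' * x - x * a' \<in> order_ge ?N" "b' * y - y * b' \<in> order_ge ?N"
    using lie_order_ge[OF lie_bracket[OF ab(3) lie_x]] lie_order_ge[OF lie_bracket[OF ab(4) lie_y]]
    by simp_all
  have q: "?q \<in> grp X" and r: "?r \<in> grp X"
    using ab by (auto intro!: grp_mult grp_ncexp)
  have P: "ren \<sigma> ?q * ncexp x * ginv ?q - ncexp x - ?\<delta> \<in> order_ge (Suc ?N)"
    using ab brackets
    by (intro side_correction[OF sym_\<sigma>] order_ge_commute_exp[OF _ lie_x]) (auto simp: ren_ncexp)
  have R: "ren \<upsilon> ?r * ncexp y * ginv ?r - ncexp y - ?\<epsilon> \<in> order_ge (Suc ?N)"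
    using ab brackets
    by (intro side_correction[OF sym_\<upsilon>] order_ge_commute_exp[OF _ lie_y]) (auto simp: ren_ncexp)
  have \<delta>: "?\<delta> \<in> order_ge ?N" and \<epsilon>: "?\<epsilon> \<in> order_ge ?N"
    using brackets lie_order_ge[OF ab(1)] lie_order_ge[OF ab(2)]
      lie_order_ge[OF lie_ren[OF sym_\<sigma> ab(1)]] lie_order_ge[OF lie_ren[OF sym_\<upsilon> ab(2)]]
    by (auto intro!: order_ge_add order_ge_diff)
  have new: "defect (g * ?q) (h * ?r) - defect g h - (?\<delta> + ?\<epsilon>) \<in> order_ge (Suc ?N)"
    by (rule defect_correction[OF gh _ P \<delta> _ R \<epsilon>]) simp_all
  have "defect g h - 1 - e \<in> order_ge (Suc ?N)"
  proof (rule order_ge_SucI)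
    show "defect g h - 1 - e \<in> order_ge ?N"
      unfolding e_def by (intro order_ge_diff small hpart_order_ge)
    have "hpart ?N (1::('x, 'k) ncs) = 0"
      by (rule ncs_eqI) simp
    moreover have "hpart ?N (hpart ?N (defect g h)) = hpart ?N (defect g h)"
      by (rule ncs_eqI) simp
    ultimately show "hpart ?N (defect g h - 1 - e) = 0"
      by (simp add: hpart_simps e_def)
  qed
  from order_ge_add[OF new this] have "defect (g * ?q) (h * ?r) - 1 - (e + ?\<delta> + ?\<epsilon>) \<in> order_ge (Suc ?N)"
    by (simp add: algebra_simps)
  then have "defect (g * ?q) (h * ?r) - 1 \<in> order_ge (Suc ?N)"
    unfolding zero by simp
  moreover have near: "f * (ncexp c' * ncexp c) - f \<in> order_ge (Suc n)"
    if "lie X ?N c" "lie X (Suc n) c'" for f c c' :: "('x, 'k) ncs"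
  proof -
    have "ncexp c' * ncexp c - 1 * 1 \<in> order_ge (Suc n)"
      using ncexp_minus_one[OF that(1)] ncexp_minus_one[OF that(2)] 
      by (intro order_ge_mult_cong) (auto elim: order_ge_mono)
    from order_ge_mult_left[OF this, of f] show ?thesis by (simp add: right_diff_distrib)
  qed
  ultimately show ?thesis
    using gh q r near[OF ab(1,3)] near[OF ab(2,4)] by (metis grp_mult)
qed

text \<open>The instance p = 1, c = 0 of \<open>side_correction\<close>, starting from g = h = 1,
  where the defect is 1 + (x + y - z) up to order 2.\<close>

lemma first_step:
  "\<exists>g \<in> grp X. \<exists>h \<in> grp X. defect g h - 1 \<in> order_ge (Suc (Suc 0))"
proof -
  obtain a b where ab: "lie X (Suc 0) a" "lie X (Suc 0) b"
    and zero: "x + y - z + (ren \<sigma> a - a) + (ren \<upsilon> b - b) = 0"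
    using degree_one by blast
  let ?\<delta> = "ren \<sigma> a - a + 0" and ?\<epsilon> = "ren \<upsilon> b - b + 0"
  have P: "ren \<sigma> (1 * ncexp a) * ncexp x * ginv (1 * ncexp a) - ncexp x - ?\<delta> \<in> order_ge (Suc (Suc 0))"
    using ab by (intro side_correction[OF sym_\<sigma>]) (auto simp: ren_simps)
  have R: "ren \<upsilon> (1 * ncexp b) * ncexp y * ginv (1 * ncexp b) - ncexp y - ?\<epsilon> \<in> order_ge (Suc (Suc 0))"
    using ab by (intro side_correction[OF sym_\<upsilon>]) (auto simp: ren_simps)
  have \<delta>: "?\<delta> \<in> order_ge (Suc 0)" and \<epsilon>: "?\<epsilon> \<in> order_ge (Suc 0)"
    using lie_order_ge[OF ab(1)] lie_order_ge[OF ab(2)]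
      lie_order_ge[OF lie_ren[OF sym_\<sigma> ab(1)]] lie_order_ge[OF lie_ren[OF sym_\<upsilon> ab(2)]]
    by (auto intro!: order_ge_diff)
  have new: "defect (1 * (1 * ncexp a)) (1 * (1 * ncexp b)) - defect 1 1 - (?\<delta> + ?\<epsilon>) \<in> order_ge (Suc (Suc 0))"
    by (rule defect_correction[OF _ _ _ P \<delta> _ R \<epsilon>]) simp_all
  have lin: "ncexp c - (1 + c) \<in> order_ge (Suc (Suc 0))" if "lie X (Suc 0) c" for c :: "('x, 'k) ncs"
    using ncexp_minus_linear[OF that] by (simp add: numeral_2_eq_2 algebra_simps)
  have "(ncexp x * ncexp y - ncexp z) * ginv (ncexp z) - (x + y - z) \<in> order_ge (Suc (Suc 0))"
  proof (rule order_ge_trans[OF order_ge_unit_right])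
    have xy: "x * y \<in> order_ge (Suc (Suc 0))"
      using order_ge_mult[OF lie_order_ge[OF lie_x] lie_order_ge[OF lie_y]] by simp
    have "ncexp x * ncexp y - (1 + x) * (1 + y) - (ncexp z - (1 + z)) + x * y \<in> order_ge (Suc (Suc 0))"
      by (intro order_ge_add order_ge_diff order_ge_mult_cong lin lie_x lie_y lie_z xy)
    then show *: "ncexp x * ncexp y - ncexp z - (x + y - z) \<in> order_ge (Suc (Suc 0))"
      by (simp add: algebra_simps)
    have "x + y - z \<in> order_ge (Suc 0)"
      by (intro order_ge_add order_ge_diff lie_order_ge[OF lie_x] lie_order_ge[OF lie_y] lie_order_ge[OF lie_z])
    from order_ge_add[OF order_ge_mono[OF *, of "Suc 0"] this]
    show "ncexp x * ncexp y - ncexp z \<in> order_ge (Suc 0)" by simp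
  qed simp
  then have "defect 1 1 - 1 - (x + y - z) \<in> order_ge (Suc (Suc 0))"
    by (simp add: defect_def ren_simps left_diff_distrib ginv_right)
  from order_ge_add[OF new this]
  have "defect (ncexp a) (ncexp b) - 1 - (x + y - z + (ren \<sigma> a - a) + (ren \<upsilon> b - b)) \<in> order_ge (Suc (Suc 0))"
    by (simp add: algebra_simps)
  then have "defect (ncexp a) (ncexp b) - 1 \<in> order_ge (Suc (Suc 0))"
    unfolding zero by simp
  then show ?thesis
    using ab grp_ncexp by metis
qed

theorem product_equation_solution:
  "\<exists>g \<in> grp X. \<exists>h \<in> grp X. ren \<sigma> g * ncexp x * ginv g * ren \<upsilon> h * ncexp y * ginv h = ncexp z"
proof -
  define P where "P n gh \<longleftrightarrow> fst gh \<in> grp X \<and> snd gh \<in> grp X \<and>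
    defect (fst gh) (snd gh) - 1 \<in> order_ge (Suc (Suc n))" for n gh
  define Q where "Q n gh gh' \<longleftrightarrow> fst gh' - fst gh \<in> order_ge (Suc n) \<and> snd gh' - snd gh \<in> order_ge (Suc n)"
    for n and gh gh' :: "('x, 'k) ncs \<times> ('x, 'k) ncs"
  obtain G where G: "\<And>n. P n (G n)" "\<And>n. Q n (G n) (G (Suc n))"
  proof (rule exE[OF dependent_nat_choice[of P Q]])
    show "\<exists>gh. P 0 gh"
      using first_step by (auto simp: P_def)
    show "\<exists>gh'. P (Suc n) gh' \<and> Q n gh gh'" if "P n gh" for gh n
      using correction_step[of "fst gh" "snd gh" n] that by (auto simp: P_def Q_def)
  qed auto
  \<comment> \<open>In the sequences below, the coefficients at words of length n stay constant from
    step n on, so they can be read off from the n-th approximation.\<close>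
  define lim where "lim F = Ncs (\<lambda>w. coeff (F (length w)) w)" for F :: "nat \<Rightarrow> ('x, 'k) ncs"
  have lim: "lim F - F n \<in> order_ge (Suc n)" if F: "\<And>n. F (Suc n) - F n \<in> order_ge (Suc n)" for F n
  proof -
    have "F (k + i) - F k \<in> order_ge (Suc k)" for k i
    proof (induction i)
      case (Suc i)
      have "F (Suc (k + i)) - F (k + i) \<in> order_ge (Suc k)"
        by (rule order_ge_mono[OF F]) simp
      with Suc show ?case using order_ge_trans by force
    qed simp
    from this[of _ "n - _"] have "coeff (F n) w = coeff (F (length w)) w" if "length w \<le> n" for w
      using that unfolding order_ge_def
      by (metis (mono_tags, lifting) coeff_simps(4) eq_iff_diff_eq_0 le_add_diff_inverse lessI mem_Collect_eq)
    then show ?thesis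
      by (simp add: order_ge_def lim_def Ncs_inverse)
  qed
  define g where "g = lim (\<lambda>n. fst (G n))"
  define h where "h = lim (\<lambda>n. snd (G n))"
  have g: "g - fst (G n) \<in> order_ge (Suc n)" and h: "h - snd (G n) \<in> order_ge (Suc n)" for n
    unfolding g_def h_def using G(2) by (auto simp: Q_def intro!: lim)
  have grp: "g \<in> grp X" "h \<in> grp X"
    using G(1) g h unfolding P_def by (meson grp_limit order_ge_mono le_SucI order.refl)+
  have "defect g h = 1"
  proof (rule eq_if_order_ge)
    fix n
    have "defect g h - defect (fst (G n)) (snd (G n)) \<in> order_ge (Suc n)"
      using G(1) unfolding P_def by (intro defect_cong grp g h) auto
    moreover have "defect (fst (G n)) (snd (G n)) - 1 \<in> order_ge (Suc n)"
      using G(1)[of n] unfolding P_def by (auto elim: order_ge_mono)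
    ultimately have "defect g h - 1 \<in> order_ge (Suc n)"
      by (rule order_ge_trans)
    then show "defect g h - 1 \<in> order_ge n"
      by (rule order_ge_mono) simp
  qed
  then have "defect g h * ncexp z = ncexp z" by simp
  then show ?thesis
    using grp by (auto simp: defect_def mult.assoc ginv_left)
qed

end

section \<open>Dihedral symmetries of the free Lie algebra and its coinvariants\<close>

section \<open>The dihedral product equations\<close>

text \<open>Extending by the identity outside \<open>{0..<m}\<close> makes these maps permutations of all integers.\<close>

definition dperm :: "nat \<Rightarrow> int \<Rightarrow> int \<Rightarrow> int \<Rightarrow> int" where
  "dperm m \<epsilon> k r = (if 0 \<le> r \<and> r < int m then (\<epsilon> * r + k) mod int m else r)"

lemma dperm_range: "0 \<le> r \<Longrightarrow> r < int m \<Longrightarrow> 0 \<le> dperm m \<epsilon> k r \<and> dperm m \<epsilon> k r < int m"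
  by (simp add: dperm_def)

lemma dperm_comp: "dperm m \<epsilon> k \<circ> dperm m \<epsilon>' k' = dperm m (\<epsilon> * \<epsilon>') (\<epsilon> * k' + k)"
proof
  fix r
  have "(\<epsilon> * ((\<epsilon>' * r + k') mod int m) + k) mod int m = (\<epsilon> * \<epsilon>' * r + (\<epsilon> * k' + k)) mod int m"
    by (metis (no_types, lifting) add.assoc distrib_left mod_add_left_eq mod_mult_right_eq mult.assoc)
  then show "(dperm m \<epsilon> k \<circ> dperm m \<epsilon>' k') r = dperm m (\<epsilon> * \<epsilon>') (\<epsilon> * k' + k) r"
    by (auto simp: dperm_def)
qed

lemma dperm_cong: "k mod int m = k' mod int m \<Longrightarrow> dperm m \<epsilon> k = dperm m \<epsilon> k'"
  unfolding dperm_def by (intro ext) (metis mod_add_right_eq)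

lemma dperm_id: "dperm m 1 0 = id"
  by (rule ext) (simp add: dperm_def)

text \<open>For \<epsilon> = 1 or -1 the inverse of r -> \<epsilon> r + k is r -> \<epsilon> r -
  \<epsilon> k; the reflections, with \<epsilon> = -1, are their own inverses.\<close>

lemma dperm_sym:
  assumes "\<epsilon> * \<epsilon> = 1"
  shows "letter_sym {0..<int m} (dperm m \<epsilon> k) (dperm m \<epsilon> (- \<epsilon> * k))"
proof -
  have k: "\<epsilon> * (- \<epsilon> * k) + k = 0" "\<epsilon> * k + - \<epsilon> * k = 0"
    using assms by (simp_all add: mult.assoc[symmetric])
  show ?thesis
    unfolding letter_sym_def dperm_comp k assms dperm_id using dperm_range[of _ m] by auto
qed

lemma ren_dperm_var:
  assumes "\<epsilon> * \<epsilon> = 1"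
  shows "ren (dperm m \<epsilon> k) (var r) = var (dperm m \<epsilon> (- \<epsilon> * k) r)"
  by (rule letter_sym_ren_var[OF dperm_sym[OF assms]])

text \<open>The second symmetry \<upsilon> is r -> j - r, so the product of \<sigma> and \<upsilon>
  rotates the letters by j. The instances are j = 2, y = t_1 for even m and j = 1, y = 0 for odd m;
  by \<open>orbits\<close>, rotations bring every letter to 0, or to 1 when y = t_1.\<close>

locale dihedral_equation =
  fixes m j :: nat and y :: "(int, 'k::field_char_0) ncs"
  assumes m: "m \<ge> 3" and lie_y: "lie {0..<int m} (Suc 0) y"
    and orbits: "\<And>r. 0 \<le> r \<Longrightarrow> r < int m \<Longrightarrow> \<exists>k. r = int (j * k) \<or> (r = int (j * k) + 1 \<and> j = 2 \<and> y = var 1)"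
begin

abbreviation "X \<equiv> {0..<int m}"
abbreviation "\<sigma> \<equiv> dperm m (- 1) 0"
abbreviation "\<upsilon> \<equiv> dperm m (- 1) (int j)"

lemma sym_s: "letter_sym X \<sigma> \<sigma>" and sym_v: "letter_sym X \<upsilon> \<upsilon>"
  using dperm_sym[of "- 1" m 0] dperm_sym[of "- 1" m "int j"] by simp_all

text \<open>The sum of the images of \<sigma> - 1 and \<upsilon> - 1 in degree n; the quotient by it
  is the space of coinvariants of the group generated by the two reflections.\<close>

definition aug :: "nat \<Rightarrow> (int, 'k) ncs \<Rightarrow> bool" where
  "aug n e \<longleftrightarrow> (\<exists>a b. lie X n a \<and> lie X n b \<and> e = (ren \<sigma> a - a) + (ren \<upsilon> b - b))"

lemma aug_add: "aug n e \<Longrightarrow> aug n f \<Longrightarrow> aug n (e + f)"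
  unfolding aug_def
proof (elim exE conjE)
  fix a b a' b'
  assume "lie X n a" "lie X n b" "lie X n a'" "lie X n b'"
    "e = (ren \<sigma> a - a) + (ren \<upsilon> b - b)" "f = (ren \<sigma> a' - a') + (ren \<upsilon> b' - b')"
  then show "\<exists>a b. lie X n a \<and> lie X n b \<and> e + f = (ren \<sigma> a - a) + (ren \<upsilon> b - b)"
    by (intro exI[of _ "a + a'"] exI[of _ "b + b'"]) (simp add: ren_simps lie.add)
qed

lemma aug_scl: "aug n e \<Longrightarrow> aug n (scl c e)"
  unfolding aug_def
proof (elim exE conjE)
  fix a b
  assume "lie X n a" "lie X n b" "e = (ren \<sigma> a - a) + (ren \<upsilon> b - b)"
  then show "\<exists>a b. lie X n a \<and> lie X n b \<and> scl c e = (ren \<sigma> a - a) + (ren \<upsilon> b - b)"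
    by (intro exI[of _ "scl c a"] exI[of _ "scl c b"]) (simp add: ren_simps scl_simps lie.scl)
qed

lemma aug_zero: "aug n 0"
  unfolding aug_def using lie.zero by (force simp: ren_simps)

lemma aug_s: "lie X n a \<Longrightarrow> aug n (ren \<sigma> a - a)"
  unfolding aug_def using lie.zero by (force simp: ren_simps)

lemma aug_v: "lie X n a \<Longrightarrow> aug n (ren \<upsilon> a - a)"
  unfolding aug_def using lie.zero by (force simp: ren_simps)

lemma aug_uminus: "aug n e \<Longrightarrow> aug n (- e)"
  using aug_scl[of n e "- 1"] by (simp add: scl_simps(3)[symmetric, of _ e] scl_simps(6)) 
    (metis add.inverse_inverse add_eq_0_iff2 scl_simps(4,6,7) ab_left_minus)

lemma aug_sum: "(\<And>i. i \<in> A \<Longrightarrow> aug n (F i)) \<Longrightarrow> aug n (sum F A)"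
  by (induction A rule: infinite_finite_induct) (auto intro: aug_zero aug_add)

text \<open>The rotation by j is a product of the two reflections, and u v w - 1 = (u - 1) v w + (v
  - 1) w + (w - 1).\<close>

lemma aug_rotation: "lie X n a \<Longrightarrow> aug n (ren (dperm m 1 (int (j * k))) a - a)"
proof (induction k arbitrary: a)
  case 0
  have "dperm m 1 (int (j * 0)) = id" by (simp add: dperm_id)
  then show ?case by (simp only: ren_simps(10)) (simp add: aug_zero)
next
  case (Suc k)
  let ?b = "ren \<sigma> (ren \<upsilon> a)"
  have b: "lie X n ?b" "lie X n (ren \<upsilon> a)"
    by (intro lie_ren[OF sym_s] lie_ren[OF sym_v] Suc.prems)+
  have "ren (dperm m 1 (int (j * k))) ?b = ren (dperm m 1 (int (j * Suc k))) a"
    by (simp add: ren_simps dperm_comp algebra_simps)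
  then have "ren (dperm m 1 (int (j * Suc k))) a - a
      = (ren (dperm m 1 (int (j * k))) ?b - ?b) + (ren \<sigma> (ren \<upsilon> a) - ren \<upsilon> a) + (ren \<upsilon> a - a)"
    by simp
  then show ?case
    using aug_add[OF aug_add[OF Suc.IH[OF b(1)] aug_s[OF b(2)]] aug_v[OF Suc.prems]] by simp
qed

lemma var_zero_fixed: "ren \<sigma> (var 0) = (var 0 :: (int, 'k) ncs)"
  using ren_dperm_var[of "- 1" m 0 0] m by (simp add: dperm_def)

lemma var_one_fixed: "j = 2 \<Longrightarrow> ren \<upsilon> (var 1) = (var 1 :: (int, 'k) ncs)"
  using ren_dperm_var[of "- 1" m "int j" 1] m by (simp add: dperm_def)

lemma rotate_var:
  assumes "int (j * k) \<le> r" "r < int m"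
  shows "ren (dperm m 1 (int (j * k))) (var r) = (var (r - int (j * k)) :: (int, 'k) ncs)"
proof -
  have "r - int (j * k) < int m" "0 \<le> r"
    using assms by (auto intro: order_trans[OF _ assms(1)] le_less_trans[OF _ assms(2)])
  then show ?thesis
    using ren_dperm_var[of 1 m "int (j * k)" r] assms by (simp add: dperm_def del: of_nat_mult)
qed

text \<open>In the coinvariants, \<open>[t, b]\<close> only depends on the average of \<open>b\<close> over a symmetry fixing \<open>t\<close>.\<close>

lemma bracket_average:
  assumes \<rho>: "letter_sym X \<rho> \<rho>" and t: "ren \<rho> t = t" and b: "lie X n b" and h: "c + c = (1::'k)"
  shows "t * b - b * t = (t * scl c (b + ren \<rho> b) - scl c (b + ren \<rho> b) * t)
      - scl c (ren \<rho> (t * b - b * t) - (t * b - b * t))"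
    and "ren \<rho> (scl c (b + ren \<rho> b)) = scl c (b + ren \<rho> b)"
proof -
  have half: "scl c f + scl c f = f" for f :: "(int, 'k) ncs"
    by (simp only: scl_simps(4)[symmetric] h scl_simps(6))
  have "(t * scl c (b + ren \<rho> b) - scl c (b + ren \<rho> b) * t)
      - scl c (ren \<rho> (t * b - b * t) - (t * b - b * t))
      = (scl c (t * b) + scl c (t * b)) - (scl c (b * t) + scl c (b * t))"
    by (simp add: ren_simps(2,7) t scl_simps(1,2) mult_scl_left mult_scl_right distrib_left distrib_right)
  then show "t * b - b * t = (t * scl c (b + ren \<rho> b) - scl c (b + ren \<rho> b) * t)
      - scl c (ren \<rho> (t * b - b * t) - (t * b - b * t))"
    unfolding half by simp
  show "ren \<rho> (scl c (b + ren \<rho> b)) = scl c (b + ren \<rho> b)"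
    by (simp add: ren_simps(1,6) letter_sym_ren_inverse[OF \<rho>] add.commute)
qed

text \<open>The linearized problem behind \<open>degree_Suc\<close>, posed as a predicate that is
  closed under linear combinations, so that it can be checked on the generators of the free Lie
  algebra.\<close>

definition solvable :: "nat \<Rightarrow> (int, 'k) ncs \<Rightarrow> bool" where
  "solvable n e \<longleftrightarrow> (\<exists>d a b. aug (Suc n) d \<and> lie X n a \<and> lie X n b \<and> ren \<sigma> a = a \<and> ren \<upsilon> b = b \<and>
     e = d + (a * var 0 - var 0 * a) + (b * y - y * b))"

lemma solvableI:
  "aug (Suc n) d \<Longrightarrow> lie X n a \<Longrightarrow> lie X n b \<Longrightarrow> ren \<sigma> a = a \<Longrightarrow> ren \<upsilon> b = b \<Longrightarrow>
     e = d + (a * var 0 - var 0 * a) + (b * y - y * b) \<Longrightarrow> solvable n e"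
  unfolding solvable_def by blast

lemma solvable_add:
  assumes "solvable n e" "solvable n f"
  shows "solvable n (e + f)"
proof -
  obtain d a b where 1: "aug (Suc n) d" "lie X n a" "lie X n b" "ren \<sigma> a = a" "ren \<upsilon> b = b"
    "e = d + (a * var 0 - var 0 * a) + (b * y - y * b)"
    using assms(1) by (auto simp: solvable_def)
  obtain d' a' b' where 2: "aug (Suc n) d'" "lie X n a'" "lie X n b'" "ren \<sigma> a' = a'" "ren \<upsilon> b' = b'"
    "f = d' + (a' * var 0 - var 0 * a') + (b' * y - y * b')"
    using assms(2) by (auto simp: solvable_def)
  show ?thesis
    by (rule solvableI[of n "d + d'" "a + a'" "b + b'"])
      (use 1(1-5) 2(1-5) in \<open>simp_all add: 1(6) 2(6) aug_add lie.add ren_simps(1) algebra_simps\<close>)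
qed

lemma solvable_scl:
  assumes "solvable n e"
  shows "solvable n (scl c e)"
proof -
  obtain d a b where 1: "aug (Suc n) d" "lie X n a" "lie X n b" "ren \<sigma> a = a" "ren \<upsilon> b = b"
    "e = d + (a * var 0 - var 0 * a) + (b * y - y * b)"
    using assms by (auto simp: solvable_def)
  show ?thesis
    by (rule solvableI[of n "scl c d" "scl c a" "scl c b"])
      (use 1 in \<open>simp_all add: aug_scl lie.scl ren_simps(6) scl_simps mult_scl_left mult_scl_right\<close>)
qed

lemma solvable_aug: "aug (Suc n) e \<Longrightarrow> solvable n e"
  by (rule solvableI[of n e 0 0]) (simp_all add: lie.zero ren_simps)

text \<open>Modulo \<open>aug\<close>, b may be replaced in [t, b] by its average over the
  reflection fixing t, and this average is invariant as \<open>solvable\<close> demands.\<close>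

lemma solvable_bracket_fixed:
  assumes b: "lie X n b" and t: "t = var 0 \<or> (j = 2 \<and> y = var 1 \<and> t = y)"
  shows "solvable n (t * b - b * t)"
proof -
  define c :: 'k where "c = 1 / 2"
  have c: "c + c = 1" by (simp add: c_def)
  from t obtain \<rho> where \<rho>: "letter_sym X \<rho> \<rho>" "ren \<rho> t = t" "lie X (Suc 0) t"
    "(t = var 0 \<and> \<rho> = \<sigma>) \<or> (t = y \<and> \<rho> = \<upsilon>)"
    using sym_s sym_v var_zero_fixed var_one_fixed lie_y m lie.var[of 0 X] by fastforce
  let ?b = "scl c (b + ren \<rho> b)" and ?C = "t * b - b * t"
  note avg = bracket_average[OF \<rho>(1,2) b c]
  have lb: "lie X n ?b" "lie X n (- ?b)"
    using b lie_ren[OF \<rho>(1) b] by (auto intro!: lie.scl lie.add lie_uminus)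
  have nb: "ren \<rho> (- ?b) = - ?b"
    using avg(2) by (simp add: ren_simps)
  have "lie X (Suc n) ?C"
    using lie_bracket[OF \<rho>(3) b] by simp
  then have "aug (Suc n) (ren \<rho> ?C - ?C)"
    using \<rho>(4) aug_s aug_v by auto
  then have aug: "aug (Suc n) (- scl c (ren \<rho> ?C - ?C))"
    by (intro aug_uminus aug_scl)
  \<comment> \<open>The sign of the average comes from stating the problem with [a, t] rather than
    [t, a].\<close>
  have eq: "?C = - scl c (ren \<rho> ?C - ?C) + ((- ?b) * t - t * (- ?b))"
    by (subst avg(1)) simp
  from \<rho>(4) show ?thesis
  proof (elim disjE conjE)
    assume "t = var 0" "\<rho> = \<sigma>"
    then show ?thesis
      using aug lb nb eq
      by (intro solvableI[of n "- scl c (ren \<rho> ?C - ?C)" "- ?b" 0]) (simp_all add: lie.zero ren_simps(3))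
  next
    assume "t = y" "\<rho> = \<upsilon>"
    then show ?thesis
      using aug lb nb eq
      by (intro solvableI[of n "- scl c (ren \<rho> ?C - ?C)" 0 "- ?b"]) (simp_all add: lie.zero ren_simps(3))
  qed
qed

text \<open>A rotation takes [t_r, a] to a bracket with t_0 or y as its first entry and changes it
  only by an element of \<open>aug\<close>. A single letter has degree 1, which n > 0
  excludes.\<close>

lemma solvable_lie:
  assumes "lie X N e" "N = Suc n" "n > 0"
  shows "solvable n e"
  using assms
proof (induction rule: lie.induct)
  case (br r k a)
  then have k: "k = n" and a: "lie X n a" and r: "0 \<le> r" "r < int m" by auto
  let ?C = "var r * a - a * var r"
  have C: "lie X (Suc n) ?C" using br k by (intro lie.br) auto
  obtain q where q: "r = int (j * q) \<or> (r = int (j * q) + 1 \<and> j = 2 \<and> y = var 1)"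
    using orbits[OF r] by blast
  define t :: "(int, 'k) ncs" where "t = var (r - int (j * q))"
  let ?\<rho> = "dperm m 1 (int (j * q))"
  have t: "t = var 0 \<or> (j = 2 \<and> y = var 1 \<and> t = y)"
    using q by (auto simp: t_def)
  have "ren ?\<rho> (var r) = t"
    unfolding t_def by (rule rotate_var) (use q r in auto)
  then have \<rho>C: "ren ?\<rho> ?C = t * ren ?\<rho> a - ren ?\<rho> a * t"
    by (simp add: ren_simps(2,7))
  have "lie X n (ren ?\<rho> a)"
    using lie_ren[OF dperm_sym[of 1 m "int (j * q)"] a] by simp
  from solvable_bracket_fixed[OF this t] have "solvable n (ren ?\<rho> ?C)"
    unfolding \<rho>C .
  moreover have "solvable n (- (ren ?\<rho> ?C - ?C))"
    by (intro solvable_aug aug_uminus aug_rotation C)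
  ultimately show ?case
    using solvable_add by fastforce
next
  case zero
  show ?case by (rule solvable_aug[OF aug_zero])
qed (auto intro: solvable_add solvable_scl)

lemma product_equation:
  assumes z: "lie X (Suc 0) z" and zaug: "aug (Suc 0) (var 0 + y - z)"
  shows "product_equation X \<sigma> \<upsilon> \<sigma> \<upsilon> (var 0) y z"
proof
  show "lie X (Suc 0) (var 0 :: (int, 'k) ncs)" using m by (intro lie.var) simp
  obtain a b where ab: "lie X (Suc 0) a" "lie X (Suc 0) b"
    "var 0 + y - z = (ren \<sigma> a - a) + (ren \<upsilon> b - b)"
    using zaug by (auto simp: aug_def)
  then show "\<exists>a b. lie X (Suc 0) a \<and> lie X (Suc 0) b \<and>
      var 0 + y - z + (ren \<sigma> a - a) + (ren \<upsilon> b - b) = 0"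
    by (intro exI[of _ "- a"] exI[of _ "- b"]) (simp add: lie_uminus ren_simps)
next
  fix n and e :: "(int, 'k) ncs"
  assume "n > 0" "lie X (Suc n) e"
  then have "solvable n (- e)"
    by (intro solvable_lie[OF lie_uminus]) auto
  then obtain d a' b' where 1: "aug (Suc n) d" "lie X n a'" "lie X n b'" "ren \<sigma> a' = a'" "ren \<upsilon> b' = b'"
    "- e = d + (a' * var 0 - var 0 * a') + (b' * y - y * b')"
    by (auto simp: solvable_def)
  then obtain a b where 2: "lie X (Suc n) a" "lie X (Suc n) b" "d = (ren \<sigma> a - a) + (ren \<upsilon> b - b)"
    by (auto simp: aug_def)
  have "e = - ((ren \<sigma> a - a) + (ren \<upsilon> b - b) + (a' * var 0 - var 0 * a') + (b' * y - y * b'))"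
    using 1(6) 2(3) by (metis add.inverse_inverse)
  then have "e + (ren \<sigma> a - a + (a' * var 0 - var 0 * a')) + (ren \<upsilon> b - b + (b' * y - y * b')) = 0"
    by simp
  then show "\<exists>a b a' b'. lie X (Suc n) a \<and> lie X (Suc n) b \<and> lie X n a' \<and> lie X n b' \<and>
      ren \<sigma> a' = a' \<and> ren \<upsilon> b' = b' \<and>
      e + (ren \<sigma> a - a + (a' * var 0 - var 0 * a')) + (ren \<upsilon> b - b + (b' * y - y * b')) = 0"
    using 1 2 by blast
qed (use sym_s sym_v lie_y z in auto)

end

definition tsum :: "nat \<Rightarrow> (int, 'k::comm_ring_1) ncs" where
  "tsum m = (\<Sum>r\<in>{0..<int m}. var r)"

lemma lie_tsum: "lie {0..<int m} (Suc 0) (tsum m :: (int, 'k::field) ncs)"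
  unfolding tsum_def by (intro lie_sum lie.var)

lemma ren_tsum:
  assumes "letter_sym {0..<int m} \<sigma> \<tau>"
  shows "ren \<sigma> (tsum m) = tsum m"
proof -
  have "bij_betw \<tau> {0..<int m} {0..<int m}"
    using assms unfolding letter_sym_def fun_eq_iff
    by (intro bij_betw_byWitness[of _ \<sigma>]) auto
  then show ?thesis
    unfolding tsum_def ren_sum letter_sym_ren_var[OF assms] by (rule sum.reindex_bij_betw)
qed

lemma sum_int_even_odd: "(\<Sum>r\<in>{0..<int (2 * p)}. f (r mod 2)) = of_nat p * (f 0 + f 1 :: 'a::ring_1)"
proof (induction p)
  case (Suc p)
  have "{0..<int (2 * Suc p)} = insert (int (2 * p)) (insert (int (2 * p) + 1) {0..<int (2 * p)})"
    by auto
  moreover have "(int (2 * p) + 1) mod 2 = 1" by presburger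
  ultimately show ?case using Suc by (simp add: algebra_simps)
qed simp

theorem even_dihedral_equation:
  assumes "m \<ge> 3" "m = 2 * p"
  shows "\<exists>g \<in> grp {0..<int m}. \<exists>h \<in> grp {0..<int m}.
    ren (dperm m (- 1) 0) g * ncexp (var 0) * ginv g * ren (dperm m (- 1) 2) h * ncexp (var 1) * ginv h
      = (ncexp (scl (1 / of_nat p) (tsum m)) :: (int, 'k::field_char_0) ncs)"
proof -
  interpret dihedral_equation m 2 "var 1 :: (int, 'k) ncs"
  proof
    show "lie {0..<int m} (Suc 0) (var 1 :: (int, 'k) ncs)" using assms by (intro lie.var) simp
    fix r :: int
    assume "0 \<le> r" "r < int m"
    then have "r = int (2 * nat (r div 2)) \<or> r = int (2 * nat (r div 2)) + 1"
      by (simp add: pos_imp_zdiv_nonneg_iff) presburger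
    then show "\<exists>k. r = int (2 * k) \<or> (r = int (2 * k) + 1 \<and> (2::nat) = 2 \<and> (var 1 :: (int, 'k) ncs) = var 1)"
      by blast
  qed (use assms in simp)
  have p: "p > 0" using assms by simp
  have "aug (Suc 0) (var (r mod 2) - var r :: (int, 'k) ncs)" if r: "r \<in> X" for r
  proof -
    define k where "k = nat (r div 2)"
    have k: "r - int (2 * k) = r mod 2" "int (2 * k) \<le> r"
      using r by (auto simp: k_def pos_imp_zdiv_nonneg_iff minus_mult_div_eq_mod)
    from aug_rotation[OF lie.var[OF r], of k] show ?thesis
      using rotate_var[of k r] k r by simp
  qed
  then have "aug (Suc 0) (scl (1 / of_nat p) (\<Sum>r\<in>X. var (r mod 2) - var r :: (int, 'k) ncs))"
    by (intro aug_scl aug_sum) blast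
  \<comment> \<open>Of the 2 p letters, p are rotated to t_0 and p to t_1.\<close>
  also have "(\<Sum>r\<in>X. var (r mod 2) - var r :: (int, 'k) ncs) = of_nat p * (var 0 + var 1) - tsum m"
    using sum_int_even_odd[of "var :: int \<Rightarrow> (int, 'k) ncs" p] by (simp add: sum_subtractf tsum_def assms(2))
  finally have "aug (Suc 0) (var 0 + var 1 - scl (1 / of_nat p) (tsum m) :: (int, 'k) ncs)"
    using p by (simp add: of_nat_mult_ncs scl_simps)
  from product_equation.product_equation_solution[OF product_equation[OF lie.scl[OF lie_tsum] this]]
  show ?thesis by simp
qed

theorem odd_dihedral_equation:
  assumes "m \<ge> 3"
  shows "\<exists>g \<in> grp {0..<int m}. \<exists>h \<in> grp {0..<int m}.
    ren (dperm m (- 1) 0) g * ncexp (var 0) * ginv g * ren (dperm m (- 1) 1) h * ginv h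
      = (ncexp (scl (1 / of_nat m) (tsum m)) :: (int, 'k::field_char_0) ncs)"
proof -
  interpret dihedral_equation m 1 "0 :: (int, 'k) ncs"
  proof
    fix r :: int
    assume "0 \<le> r" "r < int m"
    then have "r = int (1 * nat r)" by simp
    then show "\<exists>k. r = int (1 * k) \<or> (r = int (1 * k) + 1 \<and> (1::nat) = 2 \<and> (0 :: (int, 'k) ncs) = var 1)"
      by blast
  qed (use assms in \<open>simp_all add: lie.zero\<close>)
  have "aug (Suc 0) (var 0 - var r :: (int, 'k) ncs)" if r: "r \<in> X" for r
    using aug_rotation[OF lie.var[OF r], of "nat r"] rotate_var[of "nat r" r] r by simp
  then have "aug (Suc 0) (scl (1 / of_nat m) (\<Sum>r\<in>X. var 0 - var r :: (int, 'k) ncs))"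
    by (intro aug_scl aug_sum) blast
  also have "(\<Sum>r\<in>X. var 0 - var r :: (int, 'k) ncs) = of_nat m * var 0 - tsum m"
    by (simp add: sum_subtractf tsum_def)
  finally have "aug (Suc 0) (var 0 + 0 - scl (1 / of_nat m) (tsum m) :: (int, 'k) ncs)"
    using assms by (simp add: of_nat_mult_ncs scl_simps)
  from product_equation.product_equation_solution[OF product_equation[OF lie.scl[OF lie_tsum] this]]
  show ?thesis by simp
qed

section \<open>Algebras given by generators and relations, and their tensor products\<close>

section \<open>Presented algebras\<close>

locale kalgebra = ring A for A :: "('k::field, 'a) module" (structure) +
  assumes smult_closed [simp, intro]: "x \<in> carrier A \<Longrightarrow> c \<odot> x \<in> carrier A"
    and smult_add_left: "x \<in> carrier A \<Longrightarrow> (c + d) \<odot> x = c \<odot> x \<oplus> d \<odot> x"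
    and smult_add_right: "x \<in> carrier A \<Longrightarrow> y \<in> carrier A \<Longrightarrow> c \<odot> (x \<oplus> y) = c \<odot> x \<oplus> c \<odot> y"
    and smult_smult: "x \<in> carrier A \<Longrightarrow> c \<odot> (d \<odot> x) = (c * d) \<odot> x"
    and smult_one [simp]: "x \<in> carrier A \<Longrightarrow> 1 \<odot> x = x"
    and smult_mult_left: "x \<in> carrier A \<Longrightarrow> y \<in> carrier A \<Longrightarrow> (c \<odot> x) \<otimes> y = c \<odot> (x \<otimes> y)"
    and smult_mult_right: "x \<in> carrier A \<Longrightarrow> y \<in> carrier A \<Longrightarrow> x \<otimes> (c \<odot> y) = c \<odot> (x \<otimes> y)"
begin

lemma smult_zero_right [simp]: "c \<odot> \<zero> = \<zero>"
proof -
  have "c \<odot> \<zero> \<oplus> c \<odot> \<zero> = c \<odot> \<zero>"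
    using smult_add_right[of \<zero> \<zero> c] by simp
  then show ?thesis by (metis add.l_cancel_one zero_closed smult_closed)
qed

lemma smult_zero_left [simp]: "x \<in> carrier A \<Longrightarrow> 0 \<odot> x = \<zero>"
proof -
  assume x: "x \<in> carrier A"
  have "0 \<odot> x \<oplus> 0 \<odot> x = 0 \<odot> x"
    using smult_add_left[OF x, of 0 0] by simp
  then show ?thesis by (metis add.l_cancel_one x smult_closed)
qed

lemma smult_minus_one: "x \<in> carrier A \<Longrightarrow> x \<oplus> (- 1) \<odot> x = \<zero>"
  using smult_add_left[of x 1 "- 1"] by simp

lemma smult_finsum: "F \<in> I \<rightarrow> carrier A \<Longrightarrow> c \<odot> finsum A F I = (\<Oplus>i\<in>I. c \<odot> F i)"
proof (induction I rule: infinite_finite_induct)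
  case (insert i I)
  then show ?case
    by (subst (1 2) finsum_insert) (auto simp: smult_add_right Pi_iff finsum_closed)
qed (simp_all add: finsum_infinite)

lemma smult_left_cancel:
  "c \<noteq> 0 \<Longrightarrow> x \<in> carrier A \<Longrightarrow> y \<in> carrier A \<Longrightarrow> c \<odot> x = c \<odot> y \<Longrightarrow> x = y"
  by (metis left_inverse smult_one smult_smult)

end

lemma alg_homE:
  assumes "f \<in> alg_hom A B"
  shows "x \<in> carrier A \<Longrightarrow> f x \<in> carrier B"
    and "x \<in> carrier A \<Longrightarrow> y \<in> carrier A \<Longrightarrow> f (x \<oplus>\<^bsub>A\<^esub> y) = f x \<oplus>\<^bsub>B\<^esub> f y"
    and "x \<in> carrier A \<Longrightarrow> y \<in> carrier A \<Longrightarrow> f (x \<otimes>\<^bsub>A\<^esub> y) = f x \<otimes>\<^bsub>B\<^esub> f y"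
    and "f \<one>\<^bsub>A\<^esub> = \<one>\<^bsub>B\<^esub>"
    and "x \<in> carrier A \<Longrightarrow> f (c \<odot>\<^bsub>A\<^esub> x) = c \<odot>\<^bsub>B\<^esub> f x"
  using assms by (auto simp: alg_hom_def ring_hom_def)

lemma alg_hom_zero:
  assumes "kalgebra A" "kalgebra B" "f \<in> alg_hom A B"
  shows "f \<zero>\<^bsub>A\<^esub> = \<zero>\<^bsub>B\<^esub>"
proof -
  interpret A: kalgebra A by fact
  interpret B: kalgebra B by fact
  have "f (0 \<odot>\<^bsub>A\<^esub> \<zero>\<^bsub>A\<^esub>) = 0 \<odot>\<^bsub>B\<^esub> f \<zero>\<^bsub>A\<^esub>"
    by (rule alg_homE(5)[OF assms(3)]) simp
  then show ?thesis using alg_homE(1)[OF assms(3), of "\<zero>\<^bsub>A\<^esub>"] by simp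
qed

lemma alg_hom_finsum:
  assumes "kalgebra A" "kalgebra B" "f \<in> alg_hom A B" "F \<in> I \<rightarrow> carrier A"
  shows "f (finsum A F I) = (\<Oplus>\<^bsub>B\<^esub>i\<in>I. f (F i))"
proof -
  interpret A: kalgebra A by fact
  interpret B: kalgebra B by fact
  show ?thesis using assms(4)
  proof (induction I rule: infinite_finite_induct)
    case (insert i I)
    then show ?case
      using alg_homE(1,2)[OF assms(3)]
      by (subst A.finsum_insert, simp_all add: Pi_iff)
  qed (simp_all add: A.finsum_infinite B.finsum_infinite alg_hom_zero[OF assms(1-3)])
qed

lemma alg_class_eqI: "alg_eq R a b \<Longrightarrow> alg_class X R a = alg_class X R b"
  unfolding alg_class_def by (auto intro: alg_eq.trans alg_eq.sym)

lemma alg_class_self: "alg_gens a \<subseteq> X \<Longrightarrow> a \<in> alg_class X R a"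
  by (simp add: alg_class_def alg_eq.refl)

lemma presented_carrier: "alg_gens a \<subseteq> X \<Longrightarrow> alg_class X R a \<in> carrier (presented_algebra X R)"
  by (auto simp: presented_algebra_def)

lemma presented_cases:
  assumes "x \<in> carrier (presented_algebra X R)"
  obtains a where "alg_gens a \<subseteq> X" "x = alg_class X R a"
  using assms by (auto simp: presented_algebra_def)

lemma presented_zero: "\<zero>\<^bsub>presented_algebra X R\<^esub> = alg_class X R AZero"
  and presented_one: "\<one>\<^bsub>presented_algebra X R\<^esub> = alg_class X R AOne"
  by (simp_all add: presented_algebra_def)

text \<open>Operations on classes are unions over representatives; such a union collapses once all
  its members agree and a representative exists.\<close>

lemma UN_eq_const: "a \<in> A \<Longrightarrow> (\<And>x. x \<in> A \<Longrightarrow> f x = K) \<Longrightarrow> (\<Union>x\<in>A. f x) = K"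
  by (subst SUP_cong[OF HOL.refl, of A f "\<lambda>_. K"]) auto

lemma presented_mult:
  assumes "alg_gens a \<subseteq> X" "alg_gens b \<subseteq> X"
  shows "alg_class X R a \<otimes>\<^bsub>presented_algebra X R\<^esub> alg_class X R b = alg_class X R (AMult a b)"
proof -
  have eq: "alg_class X R (AMult a' b') = alg_class X R (AMult a b)"
    if "a' \<in> alg_class X R a" "b' \<in> alg_class X R b" for a' b'
    using that by (intro alg_class_eqI[symmetric] alg_eq.cong_mult) (simp_all add: alg_class_def)
  show ?thesis
    by (simp add: presented_algebra_def) (rule UN_eq_const[OF alg_class_self[OF assms(1)]], rule UN_eq_const[OF alg_class_self[OF assms(2)]], rule eq)
qed

lemma presented_add:
  assumes "alg_gens a \<subseteq> X" "alg_gens b \<subseteq> X"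
  shows "alg_class X R a \<oplus>\<^bsub>presented_algebra X R\<^esub> alg_class X R b = alg_class X R (AAdd a b)"
proof -
  have eq: "alg_class X R (AAdd a' b') = alg_class X R (AAdd a b)"
    if "a' \<in> alg_class X R a" "b' \<in> alg_class X R b" for a' b'
    using that by (intro alg_class_eqI[symmetric] alg_eq.cong_add) (simp_all add: alg_class_def)
  show ?thesis
    by (simp add: presented_algebra_def) (rule UN_eq_const[OF alg_class_self[OF assms(1)]], rule UN_eq_const[OF alg_class_self[OF assms(2)]], rule eq)
qed

lemma presented_smult:
  assumes "alg_gens a \<subseteq> X"
  shows "c \<odot>\<^bsub>presented_algebra X R\<^esub> alg_class X R a = alg_class X R (ASmult c a)"
proof -
  have eq: "alg_class X R (ASmult c a') = alg_class X R (ASmult c a)"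
    if "a' \<in> alg_class X R a" for a'
    using that by (intro alg_class_eqI[symmetric] alg_eq.cong_smult) (simp add: alg_class_def)
  show ?thesis
    by (simp add: presented_algebra_def) (rule UN_eq_const[OF alg_class_self[OF assms]], rule eq)
qed

lemmas presented_simps =
  presented_zero presented_one presented_mult presented_add presented_smult presented_carrier

lemma presented_kalgebra: "kalgebra (presented_algebra X R)"
proof -
  let ?P = "presented_algebra X R"
  note simps = presented_simps
  note axioms = alg_eq.add_assoc alg_eq.add_zero alg_eq.smult_one alg_eq.smult_smult
    alg_eq.smult_add_left alg_eq.smult_add_right alg_eq.mult_assoc alg_eq.mult_one_left
    alg_eq.mult_one_right alg_eq.mult_add_left alg_eq.mult_add_right alg_eq.mult_smult_left
    alg_eq.mult_smult_right
  have "abelian_group ?P"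
  proof (rule abelian_groupI)
    show "x \<oplus>\<^bsub>?P\<^esub> y = y \<oplus>\<^bsub>?P\<^esub> x" if "x \<in> carrier ?P" "y \<in> carrier ?P" for x y
      using that alg_class_eqI[OF alg_eq.add_comm] by (metis presented_add presented_cases)
  next
    fix x assume "x \<in> carrier ?P"
    then obtain a where a: "alg_gens a \<subseteq> X" "x = alg_class X R a" by (rule presented_cases)
    show "\<exists>y\<in>carrier ?P. y \<oplus>\<^bsub>?P\<^esub> x = \<zero>\<^bsub>?P\<^esub>"
      by (rule bexI[of _ "alg_class X R (ASmult (- 1) a)"])
        (simp_all add: simps a alg_class_eqI[OF alg_eq.trans[OF alg_eq.add_comm alg_eq.add_neg]])
  qed (auto elim!: presented_cases simp: simps axioms[THEN alg_class_eqI])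
  moreover have "monoid ?P"
    by (rule monoidI) (auto elim!: presented_cases simp: simps axioms[THEN alg_class_eqI])
  ultimately have "ring ?P"
    by (rule ringI) (auto elim!: presented_cases simp: simps axioms[THEN alg_class_eqI])
  then show ?thesis
    unfolding kalgebra_def kalgebra_axioms_def
    by (auto elim!: presented_cases simp: simps axioms[THEN alg_class_eqI])
qed

lemma (in kalgebra) alg_eval_closed:
  "(\<And>x. x \<in> alg_gens a \<Longrightarrow> \<phi> x \<in> carrier A) \<Longrightarrow> alg_eval A \<phi> a \<in> carrier A"
  by (induction a) auto

lemma alg_eval_cong:
  "(\<And>x. x \<in> alg_gens a \<Longrightarrow> \<phi> x = \<psi> x) \<Longrightarrow> alg_eval A \<phi> a = alg_eval A \<psi> a"
  by (induction a) auto

lemma (in kalgebra) alg_eval_respects: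
  assumes \<phi>: "\<And>x. \<phi> x \<in> carrier A" and R: "\<And>a b. (a, b) \<in> R \<Longrightarrow> alg_eval A \<phi> a = alg_eval A \<phi> b"
    and eq: "alg_eq R a b"
  shows "alg_eval A \<phi> a = alg_eval A \<phi> b"
proof -
  have [simp]: "alg_eval A \<phi> c \<in> carrier A" for c
    by (rule alg_eval_closed) (rule \<phi>)
  show ?thesis using eq
  proof (induction rule: alg_eq.induct)
    case (rel a b)
    then show ?case by (rule R)
  next
    case (add_comm a b)
    then show ?case by (simp add: a_comm)
  qed (simp_all add: a_assoc m_assoc l_distr r_distr smult_minus_one smult_smult
        smult_add_left smult_add_right smult_mult_left smult_mult_right)
qed

text \<open>A derivation of \<open>alg_eq R a b\<close> may pass through terms with generators outside \<open>X\<close>; they are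
  evaluated at \<open>\<zero>\<close>.\<close>

lemma (in kalgebra)
  assumes \<phi>: "\<And>x. x \<in> X \<Longrightarrow> \<phi> x \<in> carrier A"
    and R: "\<And>a b. (a, b) \<in> R \<Longrightarrow>
      alg_gens a \<subseteq> X \<and> alg_gens b \<subseteq> X \<and> alg_eval A \<phi> a = alg_eval A \<phi> b"
  shows alg_lift_class: "alg_gens a \<subseteq> X \<Longrightarrow> alg_lift A \<phi> (alg_class X R a) = alg_eval A \<phi> a"
    and alg_lift_hom: "alg_lift A \<phi> \<in> alg_hom (presented_algebra X R) A"
proof -
  let ?\<phi> = "\<lambda>x. if x \<in> X then \<phi> x else \<zero>"
  have ext: "alg_eval A ?\<phi> c = alg_eval A \<phi> c" if "alg_gens c \<subseteq> X" for c
    using that by (intro alg_eval_cong) auto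
  have eq: "alg_eval A \<phi> b = alg_eval A \<phi> a" if "alg_gens a \<subseteq> X" "alg_gens b \<subseteq> X" "alg_eq R a b" for a b
    using alg_eval_respects[of ?\<phi> R a b] that \<phi> R by (simp add: ext)
  have cls: "alg_lift A \<phi> (alg_class X R a) = alg_eval A \<phi> a" if "alg_gens a \<subseteq> X" for a
  proof -
    have "alg_eval A \<phi> ` alg_class X R a = (\<lambda>_. alg_eval A \<phi> a) ` alg_class X R a"
      by (rule image_cong[OF HOL.refl]) (auto simp: alg_class_def intro: eq[OF that])
    also have "\<dots> = {alg_eval A \<phi> a}"
      using alg_class_self[OF that, of R] by blast
    finally show ?thesis by (simp add: alg_lift_def)
  qed
  then show "alg_gens a \<subseteq> X \<Longrightarrow> alg_lift A \<phi> (alg_class X R a) = alg_eval A \<phi> a" .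
  have "alg_eval A \<phi> a \<in> carrier A" if "alg_gens a \<subseteq> X" for a
    using that \<phi> by (intro alg_eval_closed) auto
  then show "alg_lift A \<phi> \<in> alg_hom (presented_algebra X R) A"
    unfolding alg_hom_def ring_hom_def
    by (auto elim!: presented_cases simp: presented_simps cls)
qed

lemma ground_kalgebra: "kalgebra (ground_algebra :: ('k::field, 'k) module)"
proof -
  let ?G = "ground_algebra :: ('k::field, 'k) module"
  have "abelian_group ?G"
  proof (rule abelian_groupI)
    show "\<exists>y\<in>carrier ?G. y \<oplus>\<^bsub>?G\<^esub> x = \<zero>\<^bsub>?G\<^esub>" for x
      by (rule bexI[of _ "- x"]) (simp_all add: ground_algebra_def)
  qed (simp_all add: ground_algebra_def)
  moreover have "monoid ?G"
    by (rule monoidI) (auto simp: ground_algebra_def)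
  ultimately have "ring ?G"
    by (rule ringI) (auto simp: ground_algebra_def algebra_simps)
  then show ?thesis
    by (auto simp: kalgebra_def kalgebra_axioms_def ground_algebra_def algebra_simps)
qed

subsection \<open>Tensor squares\<close>

lemma tensor_kalgebra: "kalgebra (tensor_algebra A B)"
  unfolding tensor_algebra_def by (rule presented_kalgebra)

lemma pure_tensor_closed:
  "a \<in> carrier A \<Longrightarrow> b \<in> carrier B \<Longrightarrow> pure_tensor A B a b \<in> carrier (tensor_algebra A B)"
  unfolding pure_tensor_def tensor_algebra_def by (rule presented_carrier) (simp add: tensor_gens_def)

lemma pure_tensor_add_left:
  "a \<in> carrier A \<Longrightarrow> a' \<in> carrier A \<Longrightarrow> b \<in> carrier B \<Longrightarrow>
    pure_tensor A B (a \<oplus>\<^bsub>A\<^esub> a') b = pure_tensor A B a b \<oplus>\<^bsub>tensor_algebra A B\<^esub> pure_tensor A B a' b"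
  unfolding pure_tensor_def tensor_algebra_def
  by (subst presented_add) (auto simp: tensor_gens_def tensor_rels_def intro!: alg_class_eqI alg_eq.rel)

lemma pure_tensor_add_right:
  "a \<in> carrier A \<Longrightarrow> b \<in> carrier B \<Longrightarrow> b' \<in> carrier B \<Longrightarrow>
    pure_tensor A B a (b \<oplus>\<^bsub>B\<^esub> b') = pure_tensor A B a b \<oplus>\<^bsub>tensor_algebra A B\<^esub> pure_tensor A B a b'"
  unfolding pure_tensor_def tensor_algebra_def
  by (subst presented_add) (auto simp: tensor_gens_def tensor_rels_def intro!: alg_class_eqI alg_eq.rel)

lemma pure_tensor_smult_left:
  "a \<in> carrier A \<Longrightarrow> b \<in> carrier B \<Longrightarrow>
    pure_tensor A B (c \<odot>\<^bsub>A\<^esub> a) b = c \<odot>\<^bsub>tensor_algebra A B\<^esub> pure_tensor A B a b"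
  unfolding pure_tensor_def tensor_algebra_def
  by (subst presented_smult) (auto simp: tensor_gens_def tensor_rels_def intro!: alg_class_eqI alg_eq.rel)

lemma pure_tensor_smult_right:
  "a \<in> carrier A \<Longrightarrow> b \<in> carrier B \<Longrightarrow>
    pure_tensor A B a (c \<odot>\<^bsub>B\<^esub> b) = c \<odot>\<^bsub>tensor_algebra A B\<^esub> pure_tensor A B a b"
  unfolding pure_tensor_def tensor_algebra_def
  by (subst presented_smult) (auto simp: tensor_gens_def tensor_rels_def intro!: alg_class_eqI alg_eq.rel)

lemma pure_tensor_mult:
  "a \<in> carrier A \<Longrightarrow> a' \<in> carrier A \<Longrightarrow> b \<in> carrier B \<Longrightarrow> b' \<in> carrier B \<Longrightarrow>
    pure_tensor A B a b \<otimes>\<^bsub>tensor_algebra A B\<^esub> pure_tensor A B a' b'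
      = pure_tensor A B (a \<otimes>\<^bsub>A\<^esub> a') (b \<otimes>\<^bsub>B\<^esub> b')"
  unfolding pure_tensor_def tensor_algebra_def
  by (subst presented_mult) (auto simp: tensor_gens_def tensor_rels_def intro!: alg_class_eqI alg_eq.rel)

lemma pure_tensor_one: "pure_tensor A B \<one>\<^bsub>A\<^esub> \<one>\<^bsub>B\<^esub> = \<one>\<^bsub>tensor_algebra A B\<^esub>"
  unfolding pure_tensor_def tensor_algebra_def presented_one
  by (auto simp: tensor_rels_def intro!: alg_class_eqI alg_eq.rel)

lemma pure_tensor_zero:
  assumes "kalgebra A" "kalgebra B"
  shows "a \<in> carrier A \<Longrightarrow> pure_tensor A B a \<zero>\<^bsub>B\<^esub> = \<zero>\<^bsub>tensor_algebra A B\<^esub>"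
    and "b \<in> carrier B \<Longrightarrow> pure_tensor A B \<zero>\<^bsub>A\<^esub> b = \<zero>\<^bsub>tensor_algebra A B\<^esub>"
proof -
  interpret A: kalgebra A by fact
  interpret B: kalgebra B by fact
  interpret T: kalgebra "tensor_algebra A B" by (rule tensor_kalgebra)
  show "pure_tensor A B a \<zero>\<^bsub>B\<^esub> = \<zero>\<^bsub>tensor_algebra A B\<^esub>" if "a \<in> carrier A"
    using pure_tensor_smult_right[OF that B.zero_closed, of 0] pure_tensor_closed[OF that B.zero_closed]
    by simp
  show "pure_tensor A B \<zero>\<^bsub>A\<^esub> b = \<zero>\<^bsub>tensor_algebra A B\<^esub>" if "b \<in> carrier B"
    using pure_tensor_smult_left[OF A.zero_closed that, of 0] pure_tensor_closed[OF A.zero_closed that]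
    by simp
qed

lemma pure_tensor_finsum_left:
  assumes "kalgebra A" "kalgebra B" "F \<in> I \<rightarrow> carrier A" "b \<in> carrier B"
  shows "pure_tensor A B (finsum A F I) b = (\<Oplus>\<^bsub>tensor_algebra A B\<^esub>i\<in>I. pure_tensor A B (F i) b)"
proof -
  interpret A: kalgebra A by fact
  interpret T: kalgebra "tensor_algebra A B" by (rule tensor_kalgebra)
  show ?thesis using assms(3)
  proof (induction I rule: infinite_finite_induct)
    case (insert i I)
    then show ?case
      using assms(4) by (subst A.finsum_insert)
        (simp_all add: Pi_iff pure_tensor_add_left pure_tensor_closed)
  qed (use assms in \<open>simp_all add: A.finsum_infinite T.finsum_infinite pure_tensor_zero\<close>)
qed

lemma pure_tensor_finsum_right:
  assumes "kalgebra A" "kalgebra B" "F \<in> I \<rightarrow> carrier B" "a \<in> carrier A"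
  shows "pure_tensor A B a (finsum B F I) = (\<Oplus>\<^bsub>tensor_algebra A B\<^esub>i\<in>I. pure_tensor A B a (F i))"
proof -
  interpret B: kalgebra B by fact
  interpret T: kalgebra "tensor_algebra A B" by (rule tensor_kalgebra)
  show ?thesis using assms(3)
  proof (induction I rule: infinite_finite_induct)
    case (insert i I)
    then show ?case
      using assms(4) by (subst B.finsum_insert)
        (simp_all add: Pi_iff pure_tensor_add_right pure_tensor_closed)
  qed (use assms in \<open>simp_all add: B.finsum_infinite T.finsum_infinite pure_tensor_zero\<close>)
qed

lemma (in abelian_monoid) finsum_triangle:
  assumes "\<And>i j. F i j \<in> carrier G"
  shows "(\<Oplus>j\<in>{..n::nat}. \<Oplus>i\<in>{..n - j}. F j i) = (\<Oplus>k\<in>{..n}. \<Oplus>j\<in>{..k}. F j (k - j))"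
proof (induction n)
  case (Suc n)
  have closed: "finsum G (F' :: nat \<Rightarrow> 'a) I \<in> carrier G" if "\<And>i. F' i \<in> carrier G" for F' I
    using that by simp
  have "(\<Oplus>j\<in>{..n}. \<Oplus>i\<in>{..Suc n - j}. F j i)
      = (\<Oplus>j\<in>{..n}. F j (Suc n - j) \<oplus> (\<Oplus>i\<in>{..n - j}. F j i))"
  proof (rule finsum_cong'[OF HOL.refl])
    fix j assume "j \<in> {..n}"
    then have "Suc n - j = Suc (n - j)" by auto
    then show "(\<Oplus>i\<in>{..Suc n - j}. F j i) = F j (Suc n - j) \<oplus> (\<Oplus>i\<in>{..n - j}. F j i)"
      using assms by simp
  qed (use assms in simp)
  also have "\<dots> = (\<Oplus>j\<in>{..n}. F j (Suc n - j)) \<oplus> (\<Oplus>k\<in>{..n}. \<Oplus>j\<in>{..k}. F j (k - j))"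
    using assms by (subst finsum_addf) (simp_all add: Suc)
  finally have *: "(\<Oplus>j\<in>{..n}. \<Oplus>i\<in>{..Suc n - j}. F j i)
      = (\<Oplus>j\<in>{..n}. F j (Suc n - j)) \<oplus> (\<Oplus>k\<in>{..n}. \<Oplus>j\<in>{..k}. F j (k - j))" .
  have "(\<Oplus>j\<in>{..Suc n}. \<Oplus>i\<in>{..Suc n - j}. F j i)
      = F (Suc n) 0 \<oplus> (\<Oplus>j\<in>{..n}. \<Oplus>i\<in>{..Suc n - j}. F j i)"
    using assms by (subst finsum_Suc) simp_all
  also have "\<dots> = (\<Oplus>j\<in>{..Suc n}. F j (Suc n - j)) \<oplus> (\<Oplus>k\<in>{..n}. \<Oplus>j\<in>{..k}. F j (k - j))"
    using assms unfolding * by (simp add: a_assoc)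
  also have "\<dots> = (\<Oplus>k\<in>{..Suc n}. \<Oplus>j\<in>{..k}. F j (k - j))"
    using assms by (subst finsum_Suc[of "\<lambda>k. \<Oplus>j\<in>{..k}. F j (k - j)"]) simp_all
  finally show ?case .
qed (use assms in simp)

section \<open>Symmetry of the holonomy relations, and centrality of T\<close>

section \<open>The holonomy Lie algebra and its enveloping algebra\<close>

lemma lie_class_eqI: "lie_eq R a b \<Longrightarrow> lie_class X R a = lie_class X R b"
  unfolding lie_class_def by (auto intro: lie_eq.trans lie_eq.sym)

lemma lie_class_self: "lie_gens a \<subseteq> X \<Longrightarrow> a \<in> lie_class X R a"
  by (simp add: lie_class_def lie_eq.refl)

lemma presented_lie_carrier: "lie_gens a \<subseteq> X \<Longrightarrow> lie_class X R a \<in> lie_carrier (presented_lie_algebra X R)"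
  by (auto simp: presented_lie_algebra_def)

lemma presented_lie_cases:
  assumes "x \<in> lie_carrier (presented_lie_algebra X R)"
  obtains a where "lie_gens a \<subseteq> X" "x = lie_class X R a"
  using assms by (auto simp: presented_lie_algebra_def)

lemma presented_lie_zero: "lie_zero (presented_lie_algebra X R) = lie_class X R LZero"
  by (simp add: presented_lie_algebra_def)

lemma presented_lie_add:
  assumes "lie_gens a \<subseteq> X" "lie_gens b \<subseteq> X"
  shows "lie_add (presented_lie_algebra X R) (lie_class X R a) (lie_class X R b) = lie_class X R (LAdd a b)"
proof -
  have eq: "lie_class X R (LAdd a' b') = lie_class X R (LAdd a b)"
    if "a' \<in> lie_class X R a" "b' \<in> lie_class X R b" for a' b'
    using that by (intro lie_class_eqI[symmetric] lie_eq.cong_add) (simp_all add: lie_class_def)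
  show ?thesis
    by (simp add: presented_lie_algebra_def) (rule UN_eq_const[OF lie_class_self[OF assms(1)]], rule UN_eq_const[OF lie_class_self[OF assms(2)]], rule eq)
qed

lemma presented_lie_bracket:
  assumes "lie_gens a \<subseteq> X" "lie_gens b \<subseteq> X"
  shows "lie_bracket (presented_lie_algebra X R) (lie_class X R a) (lie_class X R b) = lie_class X R (LBr a b)"
proof -
  have eq: "lie_class X R (LBr a' b') = lie_class X R (LBr a b)"
    if "a' \<in> lie_class X R a" "b' \<in> lie_class X R b" for a' b'
    using that by (intro lie_class_eqI[symmetric] lie_eq.cong_br) (simp_all add: lie_class_def)
  show ?thesis
    by (simp add: presented_lie_algebra_def) (rule UN_eq_const[OF lie_class_self[OF assms(1)]], rule UN_eq_const[OF lie_class_self[OF assms(2)]], rule eq)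
qed

lemma presented_lie_smult:
  assumes "lie_gens a \<subseteq> X"
  shows "lie_smult (presented_lie_algebra X R) c (lie_class X R a) = lie_class X R (LSmult c a)"
proof -
  have eq: "lie_class X R (LSmult c a') = lie_class X R (LSmult c a)"
    if "a' \<in> lie_class X R a" for a'
    using that by (intro lie_class_eqI[symmetric] lie_eq.cong_smult) (simp add: lie_class_def)
  show ?thesis
    by (simp add: presented_lie_algebra_def) (rule UN_eq_const[OF lie_class_self[OF assms]], rule eq)
qed

lemmas presented_lie_simps =
  presented_lie_zero presented_lie_add presented_lie_bracket presented_lie_smult presented_lie_carrier

subsection \<open>Renaming generators\<close>

definition lsub :: "('x \<Rightarrow> 'x) \<Rightarrow> ('k, 'x) lie_term \<Rightarrow> ('k, 'x) lie_term" where
  "lsub = map_lie_term (\<lambda>c. c)"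

lemma lsub_simps [simp]:
  "lsub f (LGen x) = LGen (f x)" "lsub f LZero = LZero" "lsub f (LAdd a b) = LAdd (lsub f a) (lsub f b)"
  "lsub f (LSmult c a) = LSmult c (lsub f a)" "lsub f (LBr a b) = LBr (lsub f a) (lsub f b)"
  by (simp_all add: lsub_def)

lemma lie_gens_lsub: "lie_gens (lsub f a) = f ` lie_gens a"
  by (induction a) auto

lemma lie_eq_lsub:
  assumes R: "\<And>a b. (a, b) \<in> R \<Longrightarrow> lie_eq R (lsub f a) (lsub f b)"
  shows "lie_eq R a b \<Longrightarrow> lie_eq R (lsub f a) (lsub f b)"
proof (induction rule: lie_eq.induct)
  case (trans a b c)
  then show ?case by (blast intro: lie_eq.trans)
qed (simp_all add: R lie_eq.intros(1,2,5-))

definition lsum :: "'x list \<Rightarrow> ('k, 'x) lie_term" where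
  "lsum xs = foldr (\<lambda>r a. LAdd (LGen r) a) xs LZero"

lemma lsum_simps [simp]: "lsum [] = LZero" "lsum (x # xs) = LAdd (LGen x) (lsum xs)"
  by (simp_all add: lsum_def)

lemma lsub_lsum: "lsub f (lsum xs) = lsum (map f xs)"
  by (induction xs) simp_all

lemma lsum_remove1: "x \<in> set xs \<Longrightarrow> lie_eq R (lsum xs) (LAdd (LGen x) (lsum (remove1 x xs)))"
proof (induction xs)
  case (Cons y xs)
  show ?case
  proof (cases "x = y")
    case False
    then have "lie_eq R (lsum (y # xs)) (LAdd (LGen y) (LAdd (LGen x) (lsum (remove1 x xs))))"
      using Cons by (auto intro: lie_eq.cong_add lie_eq.refl)
    also have "\<And>a b c. lie_eq R (LAdd a (LAdd b c)) (LAdd b (LAdd a c))"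
      by (meson lie_eq.add_assoc lie_eq.add_comm lie_eq.cong_add lie_eq.refl lie_eq.sym lie_eq.trans)
    note lie_eq.trans[OF calculation this]
    then show ?thesis using False by auto
  qed (simp add: lie_eq.refl)
qed simp

text \<open>T is a term with a fixed order of summation, so a permutation of the generators
  preserves it only up to \<open>lie_eq\<close>.\<close>

lemma lsum_set_eq:
  "distinct xs \<Longrightarrow> distinct ys \<Longrightarrow> set xs = set ys \<Longrightarrow> lie_eq R (lsum xs) (lsum ys)"
proof (induction xs arbitrary: ys)
  case (Cons x xs)
  have "lie_eq R (lsum xs) (lsum (remove1 x ys))"
    by (rule Cons.IH) (use Cons.prems in \<open>auto simp: distinct_remove1\<close>)
  then have "lie_eq R (lsum (x # xs)) (LAdd (LGen x) (lsum (remove1 x ys)))"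
    by (auto intro: lie_eq.cong_add lie_eq.refl)
  moreover have "lie_eq R (lsum ys) (LAdd (LGen x) (lsum (remove1 x ys)))"
    using Cons.prems by (intro lsum_remove1) auto
  ultimately show ?case by (blast intro: lie_eq.trans lie_eq.sym)
qed (simp add: lie_eq.refl)

lemma hol_T_lsum: "hol_T m = lsum [0..int m - 1]"
  by (simp add: hol_T_def lsum_def)

lemma lie_gens_lsum: "lie_gens (lsum xs) = set xs"
  by (induction xs) auto

lemma lie_gens_hol_T: "lie_gens (hol_T m) = hol_gens m"
  by (auto simp: hol_T_lsum lie_gens_lsum hol_gens_def)

text \<open>A permutation of the generators reorders the summands of T, so up to
  \<open>lie_eq\<close> it turns each relation [T, t_r] = 0 into another one of them.\<close>

lemma hol_rels_lsub:
  assumes "letter_sym {0..<int m} \<sigma> \<tau>" "lie_eq (hol_rels m) a b"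
  shows "lie_eq (hol_rels m) (lsub \<sigma> a) (lsub \<sigma> b)"
  using assms(2)
proof (rule lie_eq_lsub[rotated])
  fix a b :: "('a, int) lie_term"
  assume "(a, b) \<in> hol_rels m"
  then obtain r where r: "r \<in> hol_gens m" "a = LBr (hol_T m) (LGen r)" "b = LZero"
    by (auto simp: hol_rels_def)
  have inv: "\<sigma> (\<tau> x) = x" "\<tau> (\<sigma> x) = x" for x
    using assms(1) by (auto simp: letter_sym_def fun_eq_iff)
  have sub: "\<sigma> ` {0..<int m} \<subseteq> {0..<int m}" "\<tau> ` {0..<int m} \<subseteq> {0..<int m}"
    using assms(1) by (auto simp: letter_sym_def)
  have "\<sigma> ` \<tau> ` {0..<int m} \<subseteq> \<sigma> ` {0..<int m}"
    by (intro image_mono sub)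
  then have bij: "inj \<sigma>" "\<sigma> ` {0..<int m} = {0..<int m}"
    using sub inv inj_on_inverseI[of UNIV \<tau> \<sigma>] by (auto simp: image_image)
  have upto: "set [0..int m - 1] = {0..<int m}" by auto
  have "lie_eq (hol_rels m) (lsub \<sigma> (hol_T m)) (hol_T m :: ('a, int) lie_term)"
    unfolding hol_T_lsum lsub_lsum
    using bij by (intro lsum_set_eq) (simp_all only: distinct_map set_map upto distinct_upto, auto intro: inj_on_subset)
  then have "lie_eq (hol_rels m) (lsub \<sigma> a) (LBr (hol_T m) (LGen (\<sigma> r)))"
    by (auto simp: r intro: lie_eq.cong_br lie_eq.refl)
  moreover have "(LBr (hol_T m) (LGen (\<sigma> r)), LZero) \<in> (hol_rels m :: (('a, int) lie_term \<times> _) set)"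
    using r bij by (auto simp: hol_rels_def hol_gens_def)
  ultimately show "lie_eq (hol_rels m) (lsub \<sigma> a) (lsub \<sigma> b)"
    by (auto simp: r intro: lie_eq.trans lie_eq.rel)
qed

subsection \<open>The enveloping algebra\<close>

lemma Ug_kalgebra: "kalgebra (Ug m)"
  unfolding Ug_def enveloping_algebra_def by (rule presented_kalgebra)

lemma hol_carrier: "lie_gens a \<subseteq> hol_gens m \<Longrightarrow> lie_class (hol_gens m) (hol_rels m) a \<in> lie_carrier (hol_lie m)"
  unfolding hol_lie_def by (rule presented_lie_carrier)

lemma hol_cases:
  assumes "x \<in> lie_carrier (hol_lie m)"
  obtains a where "lie_gens a \<subseteq> hol_gens m" "x = lie_class (hol_gens m) (hol_rels m) a"
  using assms unfolding hol_lie_def by (rule presented_lie_cases)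

lemma enveloping_incl_closed: "x \<in> lie_carrier (hol_lie m) \<Longrightarrow> enveloping_incl (hol_lie m) x \<in> carrier (Ug m)"
  unfolding Ug_def enveloping_algebra_def enveloping_incl_def by (rule presented_carrier) simp

lemma enveloping_incl_simps:
  assumes "x \<in> lie_carrier L" "y \<in> lie_carrier L"
  shows "enveloping_incl L (lie_add L x y) = enveloping_incl L x \<oplus>\<^bsub>enveloping_algebra L\<^esub> enveloping_incl L y"
    and "enveloping_incl L (lie_smult L c x) = c \<odot>\<^bsub>enveloping_algebra L\<^esub> enveloping_incl L x"
    and "enveloping_incl L (lie_bracket L x y) =
      enveloping_incl L x \<otimes>\<^bsub>enveloping_algebra L\<^esub> enveloping_incl L y
      \<oplus>\<^bsub>enveloping_algebra L\<^esub> (- 1) \<odot>\<^bsub>enveloping_algebra L\<^esub>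
        (enveloping_incl L y \<otimes>\<^bsub>enveloping_algebra L\<^esub> enveloping_incl L x)"
  unfolding enveloping_algebra_def enveloping_incl_def using assms
  by (auto simp: presented_mult presented_add presented_smult enveloping_rels_def simp del: alg_class_def
      intro!: alg_class_eqI[OF alg_eq.rel])

definition hcls :: "nat \<Rightarrow> ('k::field, int) lie_term \<Rightarrow> 'k Uhol" where
  "hcls m a = enveloping_incl (hol_lie m) (lie_class (hol_gens m) (hol_rels m) a)"

lemma hcls_closed: "lie_gens a \<subseteq> hol_gens m \<Longrightarrow> hcls m a \<in> carrier (Ug m)"
  unfolding hcls_def by (intro enveloping_incl_closed hol_carrier)

lemma hcls_eqI: "lie_eq (hol_rels m) a b \<Longrightarrow> hcls m a = hcls m b"
  unfolding hcls_def by (simp add: lie_class_eqI)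

lemma
  assumes "lie_gens a \<subseteq> hol_gens m" "lie_gens b \<subseteq> hol_gens m"
  shows hcls_add: "hcls m (LAdd a b) = hcls m a \<oplus>\<^bsub>Ug m\<^esub> hcls m b"
    and hcls_br: "hcls m (LBr a b) = hcls m a \<otimes>\<^bsub>Ug m\<^esub> hcls m b \<oplus>\<^bsub>Ug m\<^esub> (- 1) \<odot>\<^bsub>Ug m\<^esub> (hcls m b \<otimes>\<^bsub>Ug m\<^esub> hcls m a)"
    and hcls_smult: "hcls m (LSmult c a) = c \<odot>\<^bsub>Ug m\<^esub> hcls m a"
  using enveloping_incl_simps[of "lie_class (hol_gens m) (hol_rels m) a" "hol_lie m"
      "lie_class (hol_gens m) (hol_rels m) b"] hol_carrier[OF assms(1)] hol_carrier[OF assms(2)] assms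
  by (simp_all add: hcls_def Ug_def hol_lie_def presented_lie_simps)

lemma hcls_zero: "hcls m LZero = \<zero>\<^bsub>Ug m :: ('k::field, 'k Uhol) module\<^esub>"
proof -
  interpret kalgebra "Ug m :: ('k, 'k Uhol) module" by (rule Ug_kalgebra)
  have "hcls m (LAdd LZero LZero) = (hcls m LZero :: 'k Uhol)"
    by (intro hcls_eqI lie_eq.add_zero)
  then have "hcls m LZero \<oplus>\<^bsub>Ug m\<^esub> hcls m LZero = (hcls m LZero :: 'k Uhol)"
    by (simp add: hcls_add)
  then show "hcls m LZero = \<zero>\<^bsub>Ug m :: ('k, 'k Uhol) module\<^esub>"
    using hcls_closed[of "LZero :: ('k, int) lie_term" m] by simp
qed

definition ugen :: "nat \<Rightarrow> int \<Rightarrow> 'k::field Uhol" where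
  "ugen m r = hcls m (LGen r)"

lemma ugen_closed: "0 \<le> r \<Longrightarrow> r < int m \<Longrightarrow> ugen m r \<in> carrier (Ug m)"
  unfolding ugen_def by (rule hcls_closed) (simp add: hol_gens_def)

lemma ugen_eq: "0 \<le> r \<Longrightarrow> r < int m \<Longrightarrow> ugen m r = enveloping_incl (hol_lie m) (hol_t m r)"
  by (simp add: ugen_def hcls_def hol_t_def)

lemma (in abelian_monoid) finsum_swap:
  assumes "\<And>i j. i \<in> I \<Longrightarrow> j \<in> J \<Longrightarrow> F i j \<in> carrier G"
  shows "(\<Oplus>i\<in>I. \<Oplus>j\<in>J. F i j) = (\<Oplus>j\<in>J. \<Oplus>i\<in>I. F i j)"
  using assms
proof (induction I rule: infinite_finite_induct)
  case (insert i I)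
  have "(\<Oplus>j\<in>J. \<Oplus>i\<in>insert i I. F i j) = (\<Oplus>j\<in>J. F i j \<oplus> (\<Oplus>i\<in>I. F i j))"
    by (rule finsum_cong'[OF HOL.refl]) (use insert in \<open>simp_all add: Pi_iff\<close>)
  also have "\<dots> = (\<Oplus>j\<in>J. F i j) \<oplus> (\<Oplus>j\<in>J. \<Oplus>i\<in>I. F i j)"
    by (rule finsum_addf) (use insert in \<open>simp_all add: Pi_iff\<close>)
  finally show ?case
    using insert by (simp add: Pi_iff)
qed (simp_all add: finsum_infinite)

lemma finsum_insert_commute:
  assumes "kalgebra A" "F \<in> I \<rightarrow> carrier A" "x \<in> carrier A"
    and "\<And>i. i \<in> I \<Longrightarrow> x \<otimes>\<^bsub>A\<^esub> F i = F i \<otimes>\<^bsub>A\<^esub> x"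
  shows "x \<otimes>\<^bsub>A\<^esub> finsum A F I = finsum A F I \<otimes>\<^bsub>A\<^esub> x"
proof -
  interpret kalgebra A by fact
  show ?thesis
    using assms(2,4)
  proof (induction I rule: infinite_finite_induct)
    case (insert i I)
    then show ?case
      using assms(3) by (subst (1 2) finsum_insert) (auto simp: Pi_iff l_distr r_distr)
  qed (use assms(3) in \<open>simp_all add: finsum_infinite\<close>)
qed

lemma hcls_lsum:
  assumes "distinct xs" "set xs \<subseteq> hol_gens m"
  shows "hcls m (lsum xs) = (\<Oplus>\<^bsub>Ug m\<^esub>r\<in>set xs. ugen m r :: 'k::field Uhol)"
proof -
  interpret kalgebra "Ug m :: ('k, 'k Uhol) module" by (rule Ug_kalgebra)
  show ?thesis using assms
  proof (induction xs)
    case (Cons x xs)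
    then show ?case
      by (simp add: hcls_add lie_gens_lsum ugen_def hcls_closed Pi_iff subset_iff)
  qed (simp add: hcls_zero)
qed

lemma ugen_sum: "hcls m (hol_T m) = (\<Oplus>\<^bsub>Ug m\<^esub>r\<in>{0..<int m}. ugen m r)"
proof -
  have "set [0..int m - 1] = {0..<int m}" by auto
  then show ?thesis
    using hcls_lsum[of "[0..int m - 1]" m] by (simp only: hol_T_lsum hol_gens_def) simp
qed

lemma hol_T_commutes:
  assumes "0 \<le> r" "r < int m"
  shows "hcls m (hol_T m) \<otimes>\<^bsub>Ug m\<^esub> ugen m r = ugen m r \<otimes>\<^bsub>Ug m\<^esub> (hcls m (hol_T m) :: 'k::field Uhol)"
proof -
  interpret kalgebra "Ug m :: ('k, 'k Uhol) module" by (rule Ug_kalgebra)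
  let ?T = "hcls m (hol_T m) :: 'k Uhol" and ?r = "ugen m r :: 'k Uhol"
  have T: "?T \<in> carrier (Ug m)" by (rule hcls_closed) (simp add: lie_gens_hol_T)
  have r: "?r \<in> carrier (Ug m)" using assms by (rule ugen_closed)
  have "hcls m (LBr (hol_T m) (LGen r)) = (hcls m LZero :: 'k Uhol)"
    by (intro hcls_eqI lie_eq.rel) (use assms in \<open>auto simp: hol_rels_def hol_gens_def\<close>)
  then have "?T \<otimes>\<^bsub>Ug m\<^esub> ?r \<oplus>\<^bsub>Ug m\<^esub> (- 1) \<odot>\<^bsub>Ug m\<^esub> (?r \<otimes>\<^bsub>Ug m\<^esub> ?T) = \<zero>\<^bsub>Ug m\<^esub>"
    using assms by (simp add: hcls_br lie_gens_hol_T hol_gens_def hcls_zero ugen_def)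
  moreover have "?r \<otimes>\<^bsub>Ug m\<^esub> ?T \<oplus>\<^bsub>Ug m\<^esub> (- 1) \<odot>\<^bsub>Ug m\<^esub> (?r \<otimes>\<^bsub>Ug m\<^esub> ?T) = \<zero>\<^bsub>Ug m\<^esub>"
    using T r by (intro smult_minus_one) simp
  ultimately show ?thesis
    using T r by (metis add.right_cancel m_closed smult_closed)
qed

section \<open>The evaluation map from power series onto the completed enveloping algebra\<close>

section \<open>Evaluation of power series in the completed enveloping algebra\<close>

text \<open>The recursion follows \<open>f = f\<^sub>0 + \<Sum>r. t\<^sub>r \<partial>\<^sub>r f\<close> with \<open>\<partial>\<^sub>r = lder r\<close>.\<close>

primrec Psi :: "nat \<Rightarrow> nat \<Rightarrow> (int, 'k::field) ncs \<Rightarrow> 'k Uhol" where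
  "Psi m 0 f = coeff f [] \<odot>\<^bsub>Ug m\<^esub> \<one>\<^bsub>Ug m\<^esub>"
| "Psi m (Suc n) f = (\<Oplus>\<^bsub>Ug m\<^esub>r\<in>{0..<int m}. ugen m r \<otimes>\<^bsub>Ug m\<^esub> Psi m n (lder r f))"

context
  fixes m :: nat and U :: "('k::field, 'k Uhol) module" (structure)
  defines "U \<equiv> Ug m"
begin

interpretation U: kalgebra U
  unfolding U_def by (rule Ug_kalgebra)

lemma ugen_closed' [simp]: "r \<in> {0..<int m} \<Longrightarrow> ugen m r \<in> carrier U"
  unfolding U_def by (simp add: ugen_closed)

lemma Psi_closed [simp]: "Psi m n f \<in> carrier U"
  unfolding U_def[symmetric]
  by (induction n arbitrary: f) (auto simp flip: U_def intro!: U.finsum_closed)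

lemma Psi_add: "Psi m n (f + g) = Psi m n f \<oplus> Psi m n g"
proof (induction n arbitrary: f g)
  case (Suc n)
  have "Psi m (Suc n) (f + g)
      = (\<Oplus>r\<in>{0..<int m}. ugen m r \<otimes> Psi m n (lder r f) \<oplus> ugen m r \<otimes> Psi m n (lder r g))"
    unfolding Psi.simps U_def[symmetric] by (rule U.finsum_cong') (auto simp: lder_simps Suc U.r_distr)
  then show ?case
    by (simp add: U.finsum_addf Pi_iff flip: U_def)
qed (simp add: U.smult_add_left flip: U_def)

lemma Psi_scl: "Psi m n (scl c f) = c \<odot> Psi m n f"
proof (induction n arbitrary: f)
  case (Suc n)
  have "Psi m (Suc n) (scl c f) = (\<Oplus>r\<in>{0..<int m}. c \<odot> (ugen m r \<otimes> Psi m n (lder r f)))"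
    unfolding Psi.simps U_def[symmetric] by (rule U.finsum_cong') (auto simp: lder_simps Suc U.smult_mult_right)
  then show ?case
    by (simp add: U.smult_finsum Pi_iff flip: U_def)
qed (simp add: U.smult_smult flip: U_def)

lemma Psi_zero [simp]: "Psi m n 0 = \<zero>"
  using Psi_scl[of n 0 0] by (simp add: scl_simps)

lemma Psi_cong: "(\<And>w. length w = n \<Longrightarrow> coeff f w = coeff g w) \<Longrightarrow> Psi m n f = Psi m n g"
proof (induction n arbitrary: f g)
  case (Suc n)
  then have "Psi m n (lder r f) = Psi m n (lder r g)" for r
    by (metis coeff_simps(10) length_Cons)
  then show ?case by simp
qed simp

lemma Psi_eq_0: "(\<And>w. length w = n \<Longrightarrow> coeff f w = 0) \<Longrightarrow> Psi m n f = \<zero>"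
  using Psi_cong[of n f 0] by simp

lemma Psi_one: "Psi m n 1 = (if n = 0 then \<one> else \<zero>)"
proof (cases n)
  case 0
  then show ?thesis by (simp flip: U_def)
next
  case (Suc k)
  have "Psi m (Suc k) 1 = \<zero>" by (rule Psi_eq_0) auto
  then show ?thesis by (simp only: Suc) simp
qed

lemma Psi_sum: "Psi m n (sum F I) = (\<Oplus>i\<in>I. Psi m n (F i))"
  by (induction I rule: infinite_finite_induct) (simp_all add: Psi_add U.finsum_infinite)

lemma Psi_var: "r \<in> {0..<int m} \<Longrightarrow> Psi m n (var r) = (if n = 1 then ugen m r else \<zero>)"
proof (cases "n = 1")
  case True
  assume r: "r \<in> {0..<int m}"
  have "Psi m (Suc 0) (var r) = (\<Oplus>x\<in>{0..<int m}. if r = x then ugen m x else \<zero>)"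
    unfolding Psi.simps U_def[symmetric]
    by (rule U.finsum_cong') (auto simp: lder_simps)
  also have "\<dots> = ugen m r"
    by (rule U.finsum_singleton[OF r]) (auto intro: ugen_closed')
  finally show ?thesis using True by simp
next
  case False
  have "Psi m n (var r) = \<zero>" by (rule Psi_eq_0) (use False in auto)
  then show ?thesis using False by simp
qed

text \<open>Induction on the degree by the product rule for \<open>lder\<close>: the term with the
  constant coefficient of f gives the summand i = 0, and the other term gives the summands i > 0
  after the sums over r and i are exchanged.\<close>

lemma Psi_mult: "Psi m n (f * g) = (\<Oplus>i\<in>{..n}. Psi m i f \<otimes> Psi m (n - i) g)"
proof (induction n arbitrary: f g)
  case (Suc n)
  let ?X = "{0..<int m}"
  have "Psi m (Suc n) (f * g) = (\<Oplus>r\<in>?X. coeff f [] \<odot> (ugen m r \<otimes> Psi m n (lder r g))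
      \<oplus> ugen m r \<otimes> (\<Oplus>i\<in>{..n}. Psi m i (lder r f) \<otimes> Psi m (n - i) g))"
    unfolding Psi.simps U_def[symmetric]
    by (rule U.finsum_cong')
      (auto simp: lder_simps Psi_add Psi_scl Suc U.r_distr U.smult_mult_right Pi_iff)
  also have "\<dots> = coeff f [] \<odot> Psi m (Suc n) g
      \<oplus> (\<Oplus>r\<in>?X. ugen m r \<otimes> (\<Oplus>i\<in>{..n}. Psi m i (lder r f) \<otimes> Psi m (n - i) g))"
    unfolding Psi.simps U_def[symmetric]
    by (subst U.finsum_addf) (auto simp: U.smult_finsum Pi_iff)
  also have "(\<Oplus>r\<in>?X. ugen m r \<otimes> (\<Oplus>i\<in>{..n}. Psi m i (lder r f) \<otimes> Psi m (n - i) g))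
      = (\<Oplus>r\<in>?X. \<Oplus>i\<in>{..n}. (ugen m r \<otimes> Psi m i (lder r f)) \<otimes> Psi m (n - i) g)"
    by (rule U.finsum_cong') (auto simp: U.finsum_rdistr Pi_iff U.m_assoc)
  also have "\<dots> = (\<Oplus>i\<in>{..n}. \<Oplus>r\<in>?X. (ugen m r \<otimes> Psi m i (lder r f)) \<otimes> Psi m (n - i) g)"
    by (rule U.finsum_swap) simp
  also have "\<dots> = (\<Oplus>i\<in>{..n}. Psi m (Suc i) f \<otimes> Psi m (n - i) g)"
    unfolding Psi.simps U_def[symmetric]
    by (rule U.finsum_cong') (auto simp: U.finsum_ldistr Pi_iff)
  also have "coeff f [] \<odot> Psi m (Suc n) g = Psi m 0 f \<otimes> Psi m (Suc n) g"
    unfolding Psi.simps(1) U_def[symmetric] using Psi_closed[of "Suc n" g] by (simp only: U.smult_mult_left U.one_closed U.l_one)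
  finally show ?case
    by (subst U.finsum_Suc2) (simp_all add: Pi_iff U.a_comm del: Psi.simps)
qed (simp add: U.smult_mult_left U.smult_smult flip: U_def)

end

lemma presented_part_simps:
  shows "\<zero>\<^bsub>presented_algebra X R\<^esub> \<in> alg_part X R D n"
    and "\<one>\<^bsub>presented_algebra X R\<^esub> \<in> alg_part X R D 0"
    and "x \<in> alg_part X R D n \<Longrightarrow> y \<in> alg_part X R D n \<Longrightarrow> x \<oplus>\<^bsub>presented_algebra X R\<^esub> y \<in> alg_part X R D n"
    and "x \<in> alg_part X R D n \<Longrightarrow> c \<odot>\<^bsub>presented_algebra X R\<^esub> x \<in> alg_part X R D n"
    and "x \<in> alg_part X R D i \<Longrightarrow> y \<in> alg_part X R D j \<Longrightarrow> x \<otimes>\<^bsub>presented_algebra X R\<^esub> y \<in> alg_part X R D (i + j)"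
    and "z \<in> X \<Longrightarrow> z \<in> D n \<Longrightarrow> alg_class X R (AGen z) \<in> alg_part X R D n"
    and "x \<in> alg_part X R D n \<Longrightarrow> x \<in> carrier (presented_algebra X R)"
  unfolding alg_part_def
  by (auto simp: presented_simps image_iff intro: alg_homogeneous.intros)
    (metis alg_homogeneous.intros alg_term.set Un_least empty_subsetI insert_subset)+

lemmas Ug_part_simps =
  presented_part_simps[where X = "lie_carrier (hol_lie m)" and R = "enveloping_rels (hol_lie m)"
    and D = "lie_part (hol_gens m) (hol_rels m)" for m,
    folded enveloping_algebra_def enveloping_part_def, folded Ug_def Ug_part_def]

lemma ugen_part: "0 \<le> r \<Longrightarrow> r < int m \<Longrightarrow> ugen m r \<in> Ug_part m (Suc 0)"
  unfolding ugen_def hcls_def enveloping_incl_def Ug_part_def enveloping_part_def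
  using hol_carrier[of "LGen r" m]
  by (intro presented_part_simps(6))
    (auto simp: lie_part_def hol_gens_def lie_homogeneous.intros(1)[simplified] intro!: imageI)

context
  fixes m :: nat and U :: "('k::field, 'k Uhol) module" (structure)
  defines "U \<equiv> Ug m"
begin

interpretation U: kalgebra U
  unfolding U_def by (rule Ug_kalgebra)

lemma finsum_part:
  "(\<And>i. i \<in> I \<Longrightarrow> F i \<in> Ug_part m n) \<Longrightarrow> finsum U F I \<in> Ug_part m n"
proof (induction I rule: infinite_finite_induct)
  case (insert i I)
  have "F j \<in> carrier U" if "j \<in> insert i I" for j
    using insert.prems[OF that] unfolding U_def by (rule Ug_part_simps(7))
  then show ?case
    using insert Ug_part_simps(3)[of "F i" m n "finsum U F I", folded U_def]
    by (subst U.finsum_insert) (auto simp: Pi_iff)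
qed (simp_all add: U.finsum_infinite, simp_all add: U_def Ug_part_simps(1))

lemma Psi_part: "Psi m n f \<in> (Ug_part m n :: 'k Uhol set)"
proof (induction n arbitrary: f)
  case 0
  show ?case unfolding Psi.simps by (intro Ug_part_simps)
next
  case (Suc n)
  have "ugen m r \<otimes>\<^bsub>Ug m\<^esub> Psi m n (lder r f) \<in> (Ug_part m (Suc n) :: 'k Uhol set)" if "r \<in> {0..<int m}" for r
    using Ug_part_simps(5)[OF ugen_part Suc, of r] that by simp
  then show ?case
    unfolding Psi.simps by (rule finsum_part[unfolded U_def])
qed

lemma Psi_hpart: "Psi m n (hpart n f) = (Psi m n f :: 'k Uhol)"
  by (rule Psi_cong) simp

lemma Psi_hpart_neq: "i \<noteq> n \<Longrightarrow> Psi m n (hpart i f) = \<zero>"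
  unfolding U_def by (rule Psi_eq_0) simp

text \<open>Cutting both factors down to one degree leaves a single summand of the convolution, so a
  product of homogeneous elements lifts to a product of series.\<close>

lemma Psi_mult_hpart: "Psi m (i + j) (hpart i f * hpart j g) = Psi m i f \<otimes> Psi m j g"
proof -
  have cl: "Psi m k h \<in> carrier U" for k h unfolding U_def by (rule Psi_closed)
  have "Psi m (i + j) (hpart i f * hpart j g)
      = (\<Oplus>k\<in>{..i + j}. Psi m k (hpart i f) \<otimes> Psi m (i + j - k) (hpart j g))"
    unfolding U_def by (rule Psi_mult)
  also have "\<dots> = (\<Oplus>k\<in>{..i + j}. if i = k then Psi m k f \<otimes> Psi m (i + j - k) g else \<zero>)"
    using cl
    by (intro U.finsum_cong') (auto simp: Psi_hpart Psi_hpart_neq simp flip: U_def)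
  also have "\<dots> = Psi m i f \<otimes> Psi m (i + j - i) g"
    by (rule U.finsum_singleton) (use cl in auto)
  finally show ?thesis by simp
qed

lemma hcls_Psi:
  "lie_homogeneous n a \<Longrightarrow> lie_gens a \<subseteq> hol_gens m \<Longrightarrow> \<exists>f. (hcls m a :: 'k Uhol) = Psi m n f"
proof (induction rule: lie_homogeneous.induct)
  case (1 r)
  then have "r \<in> {0..<int m}" by (simp add: hol_gens_def)
  then have "hcls m (LGen r) = (Psi m 1 (var r) :: 'k Uhol)"
    using Psi_var[of r m 1, where ?'k = 'k] by (simp add: ugen_def)
  then show ?case by blast
next
  case (2 n)
  have "hcls m LZero = (Psi m n 0 :: 'k Uhol)" by (simp add: hcls_zero Psi_zero)
  then show ?case by blast
next
  case (3 n a b)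
  then obtain f g where "hcls m a = (Psi m n f :: 'k Uhol)" "hcls m b = (Psi m n g :: 'k Uhol)" by auto
  then have "hcls m (LAdd a b) = (Psi m n (f + g) :: 'k Uhol)"
    using 3 by (simp add: hcls_add Psi_add)
  then show ?case by blast
next
  case (4 n a c)
  then obtain f where "hcls m a = (Psi m n f :: 'k Uhol)" by auto
  then have "hcls m (LSmult c a) = (Psi m n (scl c f) :: 'k Uhol)"
    using 4 by (simp add: hcls_smult Psi_scl)
  then show ?case by blast
next
  case (5 i a j b)
  then obtain f g where fg: "hcls m a = (Psi m i f :: 'k Uhol)" "hcls m b = (Psi m j g :: 'k Uhol)" by auto
  have "hcls m (LBr a b) = (Psi m (i + j) (hpart i f * hpart j g + scl (- 1) (hpart j g * hpart i f)) :: 'k Uhol)"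
    using 5 Psi_mult_hpart[of j i g f] by (simp add: hcls_br fg Psi_add Psi_scl Psi_mult_hpart U_def add.commute)
  then show ?case by blast
qed

text \<open>Through this every element of the completion comes from a series, so identities there
  and in the semidirect product can be computed with series, whose ring laws are already
  available.\<close>

lemma Psi_surj:
  assumes "x \<in> (Ug_part m n :: 'k Uhol set)"
  shows "\<exists>f. x = Psi m n f"
proof -
  let ?X = "lie_carrier (hol_lie m) :: 'k hol set" and ?R = "enveloping_rels (hol_lie m)"
  let ?c = "alg_class ?X ?R"
  have "\<exists>f. ?c a = Psi m n f"
    if "alg_homogeneous (lie_part (hol_gens m) (hol_rels m)) n a" "alg_gens a \<subseteq> ?X" for n a
    using that
  proof (induction rule: alg_homogeneous.induct)
    case (1 z n)
    then obtain b where "lie_gens b \<subseteq> hol_gens m" "lie_homogeneous n b" "z = lie_class (hol_gens m) (hol_rels m) b"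
      by (auto simp: lie_part_def)
    with hcls_Psi[of n b] show ?case by (auto simp: hcls_def enveloping_incl_def)
  next
    case (2 n)
    have "?c AZero = Psi m n 0"
      using Psi_zero[of m n, where ?'k = 'k] by (simp add: Ug_def enveloping_algebra_def presented_zero)
    then show ?case by blast
  next
    case 3
    have "?c AOne = Psi m 0 1"
      using Psi_one[of m 0, where ?'k = 'k] by (simp add: Ug_def enveloping_algebra_def presented_one del: Psi.simps)
    then show ?case by blast
  next
    case (4 n a b)
    then obtain f g where "?c a = Psi m n f" "?c b = Psi m n g" by auto
    then have "?c (AAdd a b) = Psi m n (f + g)"
      using 4 presented_add[of a ?X b ?R] by (simp add: Psi_add Ug_def enveloping_algebra_def)
    then show ?case by blast
  next
    case (5 n a d)
    then obtain f where "?c a = Psi m n f" by auto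
    then have "?c (ASmult d a) = Psi m n (scl d f)"
      using 5 presented_smult[of a ?X ?R d] by (simp add: Psi_scl Ug_def enveloping_algebra_def)
    then show ?case by blast
  next
    case (6 i a j b)
    then obtain f g where "?c a = Psi m i f" "?c b = Psi m j g" by auto
    then have "?c (AMult a b) = Psi m (i + j) (hpart i f * hpart j g)"
      using 6 presented_mult[of a ?X b ?R] by (simp add: Psi_mult_hpart U_def Ug_def enveloping_algebra_def)
    then show ?case by blast
  qed
  then show ?thesis
    using assms by (auto simp: Ug_part_def enveloping_part_def alg_part_def)
qed

text \<open>The sum of the generators is central in the enveloping algebra, but not among the power series.\<close>

lemma Psi_tsum_comm: "Psi m n (tsum m * f) = (Psi m n (f * tsum m) :: 'k Uhol)"
proof -
  have cl: "Psi m k h \<in> carrier U" for k h unfolding U_def by (rule Psi_closed)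
  have ug: "ugen m r \<in> carrier U" if "r \<in> {0..<int m}" for r
    unfolding U_def using that by (simp add: ugen_closed)
  let ?T = "hcls m (hol_T m) :: 'k Uhol"
  have T: "?T \<in> carrier U" unfolding U_def by (rule hcls_closed) (simp add: lie_gens_hol_T)
  have comm: "?T \<otimes> Psi m n f = Psi m n f \<otimes> ?T" for n f
  proof (induction n arbitrary: f)
    case 0
    then show ?case using T by (simp add: U.smult_mult_left U.smult_mult_right flip: U_def)
  next
    case (Suc n)
    have "?T \<otimes> (ugen m r \<otimes> Psi m n (lder r f)) = (ugen m r \<otimes> Psi m n (lder r f)) \<otimes> ?T"
      if "r \<in> {0..<int m}" for r
      using hol_T_commutes[of r m, where ?'k = 'k, folded U_def] that Suc T ug[OF that] cl
      by (simp add: U.m_assoc[symmetric]) (simp add: U.m_assoc)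
    then show ?case
      unfolding Psi.simps U_def[symmetric]
      by (intro finsum_insert_commute T U.kalgebra_axioms) (use ug cl in auto)
  qed
  have t: "Psi m k (tsum m) = (if k = 1 then ?T else \<zero>)" for k
  proof (cases "k = 1")
    case True
    have "Psi m 1 (tsum m) = (\<Oplus>r\<in>{0..<int m}. Psi m 1 (var r))"
      unfolding tsum_def U_def by (rule Psi_sum)
    also have "\<dots> = (\<Oplus>r\<in>{0..<int m}. ugen m r)"
      using ug by (intro U.finsum_cong') (simp_all add: Psi_var del: Psi.simps One_nat_def)
    finally show ?thesis using True by (simp add: ugen_sum U_def)
  next
    case False
    have "Psi m k (tsum m) = \<zero>"
      unfolding U_def by (rule Psi_eq_0) (use False in \<open>auto simp: tsum_def intro!: sum.neutral\<close>)
    then show ?thesis using False by simp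
  qed
  show ?thesis
  proof (cases n)
    case 0
    then show ?thesis by (simp add: tsum_def)
  next
    case (Suc k)
    have "Psi m (1 + k) (tsum m * f) = (\<Oplus>i\<in>{..1 + k}. Psi m i (tsum m) \<otimes> Psi m (1 + k - i) f)"
      unfolding U_def by (rule Psi_mult)
    also have "\<dots> = (\<Oplus>i\<in>{..1 + k}. if 1 = i then ?T \<otimes> Psi m (1 + k - i) f else \<zero>)"
      using cl T by (intro U.finsum_cong') (auto simp: t)
    also have "\<dots> = ?T \<otimes> Psi m k f"
      using cl T by (subst U.finsum_singleton) auto
    finally have 1: "Psi m (Suc k) (tsum m * f) = ?T \<otimes> Psi m k f" by simp
    have "Psi m (k + 1) (f * tsum m) = (\<Oplus>i\<in>{..k + 1}. Psi m i f \<otimes> Psi m (k + 1 - i) (tsum m))"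
      unfolding U_def by (rule Psi_mult)
    also have "\<dots> = (\<Oplus>i\<in>{..k + 1}. if k = i then Psi m i f \<otimes> ?T else \<zero>)"
      using cl T by (intro U.finsum_cong') (auto simp: t)
    also have "\<dots> = Psi m k f \<otimes> ?T"
      using cl T by (subst U.finsum_singleton) auto
    finally show ?thesis using 1 comm Suc by simp
  qed
qed

end

subsection \<open>The map to the completion\<close>

definition PsiA :: "nat \<Rightarrow> (int, 'k::field) ncs \<Rightarrow> 'k Ahol" where
  "PsiA m f = (\<lambda>n. Psi m n f)"

lemma PsiA_closed [simp]: "PsiA m f \<in> carrier (Acal m)"
  by (simp add: PsiA_def Acal_def completion_def Psi_part)

lemma PsiA_surj:
  assumes "x \<in> carrier (Acal m)"
  obtains f where "x = PsiA m f"
proof -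
  have "\<forall>n. \<exists>f. x n = Psi m n f"
    using assms Psi_surj by (force simp: Acal_def completion_def)
  then obtain F where F: "\<And>n. x n = Psi m n (F n)" by metis
  \<comment> \<open>The preimages chosen for the single degrees are glued together;
    \<open>Psi\<close> in degree n sees only words of length n.\<close>
  have "x = PsiA m (Ncs (\<lambda>w. coeff (F (length w)) w))"
    unfolding PsiA_def by (rule ext) (simp add: F, rule Psi_cong, simp add: Ncs_inverse)
  then show ?thesis by (rule that)
qed

lemma PsiA_mult: "PsiA m f \<otimes>\<^bsub>Acal m\<^esub> PsiA m g = PsiA m (f * g)"
  by (rule ext) (simp add: PsiA_def Acal_def completion_def Psi_mult)

lemma PsiA_add: "PsiA m f \<oplus>\<^bsub>Acal m\<^esub> PsiA m g = PsiA m (f + g)"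
  by (rule ext) (simp add: PsiA_def Acal_def completion_def Psi_add)

lemma PsiA_scl: "c \<odot>\<^bsub>Acal m\<^esub> PsiA m f = PsiA m (scl c f)"
  by (rule ext) (simp add: PsiA_def Acal_def completion_def Psi_scl)

lemma PsiA_one: "\<one>\<^bsub>Acal m\<^esub> = PsiA m 1"
  by (rule ext) (simp add: PsiA_def Acal_def completion_def Psi_one)

lemma PsiA_zero: "\<zero>\<^bsub>Acal m\<^esub> = PsiA m 0"
  by (rule ext) (simp add: PsiA_def Acal_def completion_def Psi_zero)

lemma PsiA_var: "0 \<le> r \<Longrightarrow> r < int m \<Longrightarrow> Acal_t m r = PsiA m (var r)"
  by (rule ext) (simp add: PsiA_def Acal_t_def in_degree_def Psi_var ugen_eq)

lemma PsiA_power: "PsiA m f [^]\<^bsub>Acal m\<^esub> (k::nat) = PsiA m (f ^ k)"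
  by (induction k) (simp_all add: nat_pow_def PsiA_one PsiA_mult power_commutes)

lemma PsiA_tsum_comm: "PsiA m (tsum m * f) = PsiA m (f * tsum m)"
  by (simp add: PsiA_def Psi_tsum_comm)

lemma PsiA_exp:
  fixes f :: "(int, 'k::field_char_0) ncs"
  assumes "f \<in> order_ge (Suc 0)"
  shows "Acal_exp m (PsiA m f) = PsiA m (ncexp f)"
proof
  fix n
  have "Acal_exp m (PsiA m f) n = (\<Oplus>\<^bsub>Ug m\<^esub>k\<in>{..n}. Psi m n (scl (1 / fact k) (f ^ k)))"
    unfolding Acal_exp_def completed_exp_def Acal_def[symmetric] PsiA_power by (simp add: PsiA_def Psi_scl)
  also have "\<dots> = Psi m n (\<Sum>k\<le>n. scl (1 / fact k) (f ^ k))"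
    by (simp add: Psi_sum)
  also have "\<dots> = Psi m n (ncexp f)"
    using ncexp_approx[OF assms, of n] by (intro Psi_cong) (simp add: order_ge_def)
  finally show "Acal_exp m (PsiA m f) n = PsiA m (ncexp f) n"
    by (simp add: PsiA_def)
qed

section \<open>Compatibility of evaluation with counit, coproduct and dihedral action\<close>

section \<open>The Hopf structure and the action under the evaluation map\<close>

lemma (in abelian_monoid) finsum_triangle_swap:
  assumes "\<And>i j. F i j \<in> carrier G"
  shows "(\<Oplus>j\<in>{..n::nat}. \<Oplus>i\<in>{..n - j}. F j i) = (\<Oplus>i\<in>{..n}. \<Oplus>j\<in>{..n - i}. F j i)"
proof -
  have cut: "(\<Oplus>i\<in>{..n - j}. H i) = (\<Oplus>i\<in>{..n}. if i + j \<le> n then H i else \<zero>)"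
    if "j \<in> {..n}" "\<And>i. H i \<in> carrier G" for j and H :: "nat \<Rightarrow> 'a"
    by (rule add.finprod_mono_neutral_cong_left[simplified]) (use that in auto)
  have "(\<Oplus>j\<in>{..n}. \<Oplus>i\<in>{..n - j}. F j i) = (\<Oplus>j\<in>{..n}. \<Oplus>i\<in>{..n}. if i + j \<le> n then F j i else \<zero>)"
    by (rule finsum_cong'[OF HOL.refl]) (use assms cut in auto)
  also have "\<dots> = (\<Oplus>i\<in>{..n}. \<Oplus>j\<in>{..n}. if i + j \<le> n then F j i else \<zero>)"
    by (rule finsum_swap) (use assms in auto)
  also have "\<dots> = (\<Oplus>i\<in>{..n}. \<Oplus>j\<in>{..n}. if j + i \<le> n then F j i else \<zero>)"
    by (simp only: add.commute)
  also have "\<dots> = (\<Oplus>i\<in>{..n}. \<Oplus>j\<in>{..n - i}. F j i)"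
    by (rule finsum_cong'[OF HOL.refl]) (use assms cut in \<open>auto simp: Pi_iff\<close>)
  finally show ?thesis .
qed

lemma hol_carrier_ops:
  assumes "x \<in> lie_carrier (hol_lie m)" "y \<in> lie_carrier (hol_lie m)"
  shows "lie_add (hol_lie m) x y \<in> lie_carrier (hol_lie m)"
    and "lie_smult (hol_lie m) c x \<in> lie_carrier (hol_lie m)"
    and "lie_bracket (hol_lie m) x y \<in> lie_carrier (hol_lie m)"
  using assms unfolding hol_lie_def
  by (auto elim!: presented_lie_cases simp: presented_lie_simps intro!: presented_lie_carrier)

text \<open>The universal property of the enveloping algebra: \<phi> is a Lie morphism to A with the
  commutator bracket.\<close>

lemma Ug_lift:
  fixes A :: "('k::field, 'a) module"
  assumes "kalgebra A" and "\<And>x. x \<in> lie_carrier (hol_lie m) \<Longrightarrow> \<phi> x \<in> carrier A"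
    and "\<And>x y. x \<in> lie_carrier (hol_lie m) \<Longrightarrow> y \<in> lie_carrier (hol_lie m) \<Longrightarrow>
      \<phi> (lie_add (hol_lie m) x y) = \<phi> x \<oplus>\<^bsub>A\<^esub> \<phi> y"
    and "\<And>c x. x \<in> lie_carrier (hol_lie m) \<Longrightarrow> \<phi> (lie_smult (hol_lie m) c x) = c \<odot>\<^bsub>A\<^esub> \<phi> x"
    and "\<And>x y. x \<in> lie_carrier (hol_lie m) \<Longrightarrow> y \<in> lie_carrier (hol_lie m) \<Longrightarrow>
      \<phi> (lie_bracket (hol_lie m) x y) = \<phi> x \<otimes>\<^bsub>A\<^esub> \<phi> y \<oplus>\<^bsub>A\<^esub> (- 1) \<odot>\<^bsub>A\<^esub> (\<phi> y \<otimes>\<^bsub>A\<^esub> \<phi> x)"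
  shows "alg_lift A \<phi> \<in> alg_hom (Ug m) A"
    and "x \<in> lie_carrier (hol_lie m) \<Longrightarrow> alg_lift A \<phi> (enveloping_incl (hol_lie m) x) = \<phi> x"
proof -
  interpret kalgebra A by fact
  let ?X = "lie_carrier (hol_lie m)" and ?R = "enveloping_rels (hol_lie m)"
  have R: "alg_gens a \<subseteq> ?X \<and> alg_gens b \<subseteq> ?X \<and> alg_eval A \<phi> a = alg_eval A \<phi> b" if "(a, b) \<in> ?R" for a b
    using that assms hol_carrier_ops unfolding enveloping_rels_def by fastforce
  show "alg_lift A \<phi> \<in> alg_hom (Ug m) A"
    unfolding Ug_def enveloping_algebra_def using assms(2) R by (rule alg_lift_hom)
  show "alg_lift A \<phi> (enveloping_incl (hol_lie m) x) = \<phi> x" if "x \<in> ?X"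
    using alg_lift_class[of ?X \<phi> ?R "AGen x"] assms(2) R that by (auto simp: enveloping_incl_def)
qed

lemma counit_hom: "enveloping_counit (hol_lie m) \<in> alg_hom (Ug m) (ground_algebra :: ('k::field, 'k) module)"
  unfolding enveloping_counit_def
  by (rule Ug_lift[OF ground_kalgebra]) (simp_all add: ground_algebra_def)

lemma Acal_counit_PsiA: "Acal_counit m (PsiA m f) = coeff f []"
proof -
  interpret kalgebra "Ug m :: ('a, 'a Uhol) module" by (rule Ug_kalgebra)
  show ?thesis
    using alg_homE(4,5)[OF counit_hom[where ?'k = 'a]]
    by (simp add: Acal_counit_def PsiA_def) (simp add: ground_algebra_def)
qed

subsection \<open>Grouplike elements\<close>

abbreviation ptensor :: "('k::field, 'a) module \<Rightarrow> 'a \<Rightarrow> 'a \<Rightarrow> ('k, 'a \<times> 'a) alg_term set"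
    (infixl "\<otimes>t\<index>" 75) where
  "a \<otimes>t\<^bsub>A\<^esub> b \<equiv> pure_tensor A A a b"

context
  fixes m :: nat and U :: "('k::field_char_0, 'k Uhol) module" and UU :: "('k, 'k UUhol) module" (structure)
  defines "U \<equiv> Ug m" and "UU \<equiv> tensor_algebra U U"
begin

interpretation U: kalgebra U
  unfolding U_def by (rule Ug_kalgebra)

interpretation UU: kalgebra UU
  unfolding UU_def by (rule tensor_kalgebra)

lemma ptensor_closed [simp]: "a \<in> carrier U \<Longrightarrow> b \<in> carrier U \<Longrightarrow> a \<otimes>t\<^bsub>U\<^esub> b \<in> carrier UU"
  unfolding UU_def by (rule pure_tensor_closed)

lemma ptensor_mult: "a \<in> carrier U \<Longrightarrow> b \<in> carrier U \<Longrightarrow> c \<in> carrier U \<Longrightarrow> d \<in> carrier U \<Longrightarrow>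
    (a \<otimes>t\<^bsub>U\<^esub> b) \<otimes> (c \<otimes>t\<^bsub>U\<^esub> d) = (a \<otimes>\<^bsub>U\<^esub> c) \<otimes>t\<^bsub>U\<^esub> (b \<otimes>\<^bsub>U\<^esub> d)"
  unfolding UU_def by (rule pure_tensor_mult)

lemma ptensor_add_left: "a \<in> carrier U \<Longrightarrow> b \<in> carrier U \<Longrightarrow> c \<in> carrier U \<Longrightarrow>
    (a \<oplus>\<^bsub>U\<^esub> b) \<otimes>t\<^bsub>U\<^esub> c = a \<otimes>t\<^bsub>U\<^esub> c \<oplus> b \<otimes>t\<^bsub>U\<^esub> c"
  unfolding UU_def by (rule pure_tensor_add_left)

lemma ptensor_add_right: "a \<in> carrier U \<Longrightarrow> b \<in> carrier U \<Longrightarrow> c \<in> carrier U \<Longrightarrow>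
    a \<otimes>t\<^bsub>U\<^esub> (b \<oplus>\<^bsub>U\<^esub> c) = a \<otimes>t\<^bsub>U\<^esub> b \<oplus> a \<otimes>t\<^bsub>U\<^esub> c"
  unfolding UU_def by (rule pure_tensor_add_right)

lemma ptensor_smult: "a \<in> carrier U \<Longrightarrow> b \<in> carrier U \<Longrightarrow> (c \<odot>\<^bsub>U\<^esub> a) \<otimes>t\<^bsub>U\<^esub> b = c \<odot> (a \<otimes>t\<^bsub>U\<^esub> b)"
  "a \<in> carrier U \<Longrightarrow> b \<in> carrier U \<Longrightarrow> a \<otimes>t\<^bsub>U\<^esub> (c \<odot>\<^bsub>U\<^esub> b) = c \<odot> (a \<otimes>t\<^bsub>U\<^esub> b)"
  unfolding UU_def by (rule pure_tensor_smult_left pure_tensor_smult_right; assumption)+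

lemma ptensor_zero: "a \<in> carrier U \<Longrightarrow> a \<otimes>t\<^bsub>U\<^esub> \<zero>\<^bsub>U\<^esub> = \<zero>" "a \<in> carrier U \<Longrightarrow> \<zero>\<^bsub>U\<^esub> \<otimes>t\<^bsub>U\<^esub> a = \<zero>"
  unfolding UU_def by (rule pure_tensor_zero[OF U.kalgebra_axioms U.kalgebra_axioms]; assumption)+

definition prim :: "'k Uhol \<Rightarrow> 'k UUhol" where
  "prim a = a \<otimes>t\<^bsub>U\<^esub> \<one>\<^bsub>U\<^esub> \<oplus> \<one>\<^bsub>U\<^esub> \<otimes>t\<^bsub>U\<^esub> a"

lemma prim_closed [simp]: "a \<in> carrier U \<Longrightarrow> prim a \<in> carrier UU"
  by (simp add: prim_def)

lemma prim_add: "a \<in> carrier U \<Longrightarrow> b \<in> carrier U \<Longrightarrow> prim (a \<oplus>\<^bsub>U\<^esub> b) = prim a \<oplus> prim b"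
  by (simp add: prim_def ptensor_add_left ptensor_add_right UU.a_ac)

lemma prim_smult: "a \<in> carrier U \<Longrightarrow> prim (c \<odot>\<^bsub>U\<^esub> a) = c \<odot> prim a"
  by (simp add: prim_def ptensor_smult UU.smult_add_right)

lemma prim_zero: "prim \<zero>\<^bsub>U\<^esub> = \<zero>"
  by (simp add: prim_def ptensor_zero)

text \<open>The mixed terms of \<open>prim a \<otimes> prim b\<close> are symmetric in a and b, so
  they cancel in the commutator.\<close>

lemma prim_bracket:
  assumes a: "a \<in> carrier U" and b: "b \<in> carrier U"
  shows "prim (a \<otimes>\<^bsub>U\<^esub> b \<oplus>\<^bsub>U\<^esub> (- 1) \<odot>\<^bsub>U\<^esub> (b \<otimes>\<^bsub>U\<^esub> a)) = prim a \<otimes> prim b \<oplus> (- 1) \<odot> (prim b \<otimes> prim a)"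
proof -
  have mult: "prim a \<otimes> prim b = prim (a \<otimes>\<^bsub>U\<^esub> b) \<oplus> (a \<otimes>t\<^bsub>U\<^esub> b \<oplus> b \<otimes>t\<^bsub>U\<^esub> a)"
    if "a \<in> carrier U" "b \<in> carrier U" for a b
    using that by (simp add: prim_def UU.l_distr UU.r_distr ptensor_mult UU.a_ac)
  have cancel: "(P \<oplus> S) \<oplus> (- 1) \<odot> (Q \<oplus> S) = P \<oplus> (- 1) \<odot> Q"
    if "P \<in> carrier UU" "Q \<in> carrier UU" "S \<in> carrier UU" for P Q S
  proof -
    have "(P \<oplus> S) \<oplus> (- 1) \<odot> (Q \<oplus> S) = P \<oplus> (- 1) \<odot> Q \<oplus> (S \<oplus> (- 1) \<odot> S)"
      using that by (simp add: UU.smult_add_right UU.a_ac)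
    then show ?thesis using that by (simp add: UU.smult_minus_one)
  qed
  have "b \<otimes>t\<^bsub>U\<^esub> a \<oplus> a \<otimes>t\<^bsub>U\<^esub> b = a \<otimes>t\<^bsub>U\<^esub> b \<oplus> b \<otimes>t\<^bsub>U\<^esub> a" using a b by (simp add: UU.a_comm)
  then have "prim a \<otimes> prim b \<oplus> (- 1) \<odot> (prim b \<otimes> prim a) = prim (a \<otimes>\<^bsub>U\<^esub> b) \<oplus> (- 1) \<odot> prim (b \<otimes>\<^bsub>U\<^esub> a)"
    using a b by (simp add: mult cancel)
  then show ?thesis
    using a b by (simp add: prim_add prim_smult)
qed

lemma incl_closed: "x \<in> lie_carrier (hol_lie m) \<Longrightarrow> enveloping_incl (hol_lie m) x \<in> carrier U"
  unfolding U_def by (rule enveloping_incl_closed)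

lemma coproduct_lift: "enveloping_coproduct (hol_lie m) = alg_lift UU (\<lambda>x. prim (enveloping_incl (hol_lie m) x))"
  by (simp add: enveloping_coproduct_def Let_def prim_def UU_def U_def Ug_def)

lemma
  shows coproduct_hom: "enveloping_coproduct (hol_lie m) \<in> alg_hom U UU"
    and coproduct_incl: "x \<in> lie_carrier (hol_lie m) \<Longrightarrow>
      enveloping_coproduct (hol_lie m) (enveloping_incl (hol_lie m) x) = prim (enveloping_incl (hol_lie m) x)"
proof -
  note incl = enveloping_incl_simps[where L = "hol_lie m", folded Ug_def]
  let ?\<phi> = "\<lambda>x. prim (enveloping_incl (hol_lie m) x)"
  have 1: "?\<phi> (lie_add (hol_lie m) x y) = ?\<phi> x \<oplus> ?\<phi> y"
    "?\<phi> (lie_bracket (hol_lie m) x y) = ?\<phi> x \<otimes> ?\<phi> y \<oplus> (- 1) \<odot> (?\<phi> y \<otimes> ?\<phi> x)"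
    if "x \<in> lie_carrier (hol_lie m)" "y \<in> lie_carrier (hol_lie m)" for x y
    using incl_closed[OF that(1)] incl_closed[OF that(2)] incl[OF that]
      prim_bracket[OF incl_closed[OF that(1)] incl_closed[OF that(2)]]
    by (simp_all only: flip: U_def) (simp_all add: prim_add)
  have 2: "?\<phi> (lie_smult (hol_lie m) c x) = c \<odot> ?\<phi> x" if "x \<in> lie_carrier (hol_lie m)" for c x
    using incl_closed[OF that] incl[OF that that] by (simp add: prim_smult flip: U_def)
  have 3: "?\<phi> x \<in> carrier UU" if "x \<in> lie_carrier (hol_lie m)" for x
    by (intro prim_closed incl_closed that)
  show "enveloping_coproduct (hol_lie m) \<in> alg_hom U UU"
    unfolding coproduct_lift U_def by (rule Ug_lift(1)[OF UU.kalgebra_axioms 3 1(1) 2 1(2)])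
  show "enveloping_coproduct (hol_lie m) (enveloping_incl (hol_lie m) x) = ?\<phi> x"
    if "x \<in> lie_carrier (hol_lie m)"
    unfolding coproduct_lift by (rule Ug_lift(2)[OF UU.kalgebra_axioms 3 1(1) 2 1(2) that])
qed

lemma Psi_bracket_var:
  assumes "r \<in> {0..<int m}" "hpart n a = a"
  shows "Psi m (Suc n) (var r * a - a * var r)
    = ugen m r \<otimes>\<^bsub>U\<^esub> Psi m n a \<oplus>\<^bsub>U\<^esub> (- 1) \<odot>\<^bsub>U\<^esub> (Psi m n a \<otimes>\<^bsub>U\<^esub> ugen m r)"
proof -
  have v: "hpart 1 (var r) = (var r :: (int, 'k) ncs)" by (rule ncs_eqI) auto
  have "Psi m (1 + n) (hpart 1 (var r) * hpart n a) = ugen m r \<otimes>\<^bsub>U\<^esub> Psi m n a"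
    "Psi m (n + 1) (hpart n a * hpart 1 (var r)) = Psi m n a \<otimes>\<^bsub>U\<^esub> ugen m r"
    unfolding Psi_mult_hpart U_def by (simp_all only: Psi_var[OF assms(1)], simp_all)
  then have *: "Psi m (Suc n) (var r * a) = ugen m r \<otimes>\<^bsub>U\<^esub> Psi m n a"
    "Psi m (Suc n) (a * var r) = Psi m n a \<otimes>\<^bsub>U\<^esub> ugen m r"
    by (simp_all only: v assms(2), simp_all)
  have "var r * a - a * var r = var r * a + scl (- 1) (a * var r)"
    by (rule ncs_eqI) simp
  then have "Psi m (Suc n) (var r * a - a * var r)
      = Psi m (Suc n) (var r * a) \<oplus>\<^bsub>U\<^esub> (- 1) \<odot>\<^bsub>U\<^esub> Psi m (Suc n) (a * var r)"
    by (simp only: Psi_add Psi_scl U_def)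
  then show ?thesis by (simp only: *)
qed

text \<open>The easy half of Friedrichs' criterion: Lie elements are primitive.\<close>

lemma coproduct_lie:
  "lie {0..<int m} n a \<Longrightarrow> enveloping_coproduct (hol_lie m) (Psi m n a) = prim (Psi m n a)"
proof (induction rule: lie.induct)
  have cl: "Psi m k h \<in> carrier U" for k h unfolding U_def by (rule Psi_closed)
  note hom = alg_homE[OF coproduct_hom]
  have gen: "enveloping_coproduct (hol_lie m) (ugen m r) = prim (ugen m r)" if "r \<in> {0..<int m}" for r
    using coproduct_incl[OF hol_carrier[of "LGen r"]] that by (simp add: ugen_def hcls_def hol_gens_def)
  {
    case (var r)
    then show ?case using gen[of r] Psi_var[of r m 1, where ?'k = 'k] by simp
  next
    case (zero n)
    show ?case
      using alg_hom_zero[OF U.kalgebra_axioms UU.kalgebra_axioms coproduct_hom]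
      by (simp add: Psi_zero prim_zero flip: U_def)
  next
    case (add n a b)
    then show ?case using cl by (simp add: Psi_add hom prim_add flip: U_def)
  next
    case (scl n a c)
    then show ?case using cl by (simp add: Psi_scl hom prim_smult flip: U_def)
  next
    case (br r n a)
    then have r: "ugen m r \<in> carrier U" unfolding U_def by (simp add: ugen_closed)
    show ?case
      unfolding Psi_bracket_var[OF br(1) lie_hpart[OF br(2)]]
      using r cl by (simp add: hom gen[OF br(1)] br(3) prim_bracket)
  }
qed

text \<open>With D multiplying degree n by n, both the coproduct of g and g \<otimes> g solve D F =
  (l \<otimes> 1 + 1 \<otimes> l) F with constant term 1, because l is primitive. In degree n this
  is a recursion for n F_n, and characteristic 0 allows division by n.\<close>

lemma Psi_grp:
  assumes "g \<in> grp {0..<int m}"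
  shows "enveloping_coproduct (hol_lie m) (Psi m n g) = (\<Oplus>i\<in>{..n}. Psi m i g \<otimes>t\<^bsub>U\<^esub> Psi m (n - i) g)"
proof -
  obtain l where l: "degder g = l * g" "liehat {0..<int m} l" and g1: "coeff g [] = 1"
    using grpE[OF assms] by metis
  note hom = alg_homE[OF coproduct_hom]
  let ?\<Delta> = "enveloping_coproduct (hol_lie m) :: 'k Uhol \<Rightarrow> 'k UUhol"
  define G where "G n = Psi m n g" for n
  define L where "L n = Psi m n l" for n
  have G [simp]: "G n \<in> carrier U" and L [simp]: "L n \<in> carrier U" for n
    unfolding U_def G_def L_def by (rule Psi_closed)+
  have \<Delta>L: "?\<Delta> (L n) = prim (L n)" for n
    using coproduct_lie[of n "hpart n l"] l(2) Psi_hpart[of m n l] by (simp add: L_def liehat_def)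
  \<comment> \<open>The summand j = 0 of the recursion vanishes, so the induction hypothesis is used
    only in degrees n - j < n.\<close>
  have L0: "L 0 = \<zero>\<^bsub>U\<^esub>"
    using lie_0[of "{0..<int m}" "hpart 0 l"] l(2) Psi_hpart[of m 0 l] Psi_zero[of m 0, where ?'k = 'k]
    by (simp add: L_def liehat_def U_def del: Psi.simps)
  have ode: "of_nat n \<odot>\<^bsub>U\<^esub> G n = (\<Oplus>\<^bsub>U\<^esub>j\<in>{..n}. L j \<otimes>\<^bsub>U\<^esub> G (n - j))" for n
  proof -
    have "of_nat n \<odot>\<^bsub>U\<^esub> G n = Psi m n (scl (of_nat n) g)"
      by (simp add: G_def Psi_scl U_def)
    also have "\<dots> = Psi m n (l * g)"
      unfolding l(1)[symmetric] by (rule Psi_cong) simp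
    finally show ?thesis by (simp add: Psi_mult G_def L_def U_def)
  qed
  have "?\<Delta> (G n) = (\<Oplus>i\<in>{..n}. G i \<otimes>t\<^bsub>U\<^esub> G (n - i))" for n
  proof (induction n rule: less_induct)
    case (less n)
    let ?S = "\<lambda>n. \<Oplus>i\<in>{..n}. G i \<otimes>t\<^bsub>U\<^esub> G (n - i)"
    show ?case
    proof (cases "n = 0")
      case True
      have "G 0 = \<one>\<^bsub>U\<^esub>" by (simp add: G_def g1 flip: U_def)
      then show ?thesis
        using True hom(4) pure_tensor_one[of U U, folded UU_def] by simp
    next
      case False
      \<comment> \<open>The two families come from l acting on the left and on the right tensor
        factor.\<close>
      define A where "A j i = (L j \<otimes>\<^bsub>U\<^esub> G i) \<otimes>t\<^bsub>U\<^esub> G (n - j - i)" for j i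
      define B where "B j i = G i \<otimes>t\<^bsub>U\<^esub> (L j \<otimes>\<^bsub>U\<^esub> G (n - j - i))" for j i
      have AB [simp]: "A j i \<in> carrier UU" "B j i \<in> carrier UU" for j i
        by (simp_all add: A_def B_def)
      have summand: "prim (L j) \<otimes> ?\<Delta> (G (n - j)) = (\<Oplus>i\<in>{..n - j}. A j i) \<oplus> (\<Oplus>i\<in>{..n - j}. B j i)"
        if "j \<le> n" for j
      proof -
        have "prim (L j) \<otimes> ?\<Delta> (G (n - j)) = prim (L j) \<otimes> ?S (n - j)"
        proof (cases "j = 0")
          case True
          then show ?thesis by (simp add: L0 prim_zero hom(1))
        next
          case False
          then show ?thesis using less[of "n - j"] that by simp
        qed
        also have "\<dots> = (\<Oplus>i\<in>{..n - j}. prim (L j) \<otimes> (G i \<otimes>t\<^bsub>U\<^esub> G (n - j - i)))"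
          by (rule UU.finsum_rdistr) (simp_all add: Pi_iff)
        also have "\<dots> = (\<Oplus>i\<in>{..n - j}. A j i \<oplus> B j i)"
          by (rule UU.finsum_cong') (simp_all add: prim_def UU.l_distr ptensor_mult A_def B_def)
        also have "\<dots> = (\<Oplus>i\<in>{..n - j}. A j i) \<oplus> (\<Oplus>i\<in>{..n - j}. B j i)"
          by (rule UU.finsum_addf) (simp_all add: Pi_iff)
        finally show ?thesis .
      qed
      have "of_nat n \<odot> ?\<Delta> (G n) = ?\<Delta> (\<Oplus>\<^bsub>U\<^esub>j\<in>{..n}. L j \<otimes>\<^bsub>U\<^esub> G (n - j))"
        by (simp add: hom(5) ode[symmetric])
      also have "\<dots> = (\<Oplus>j\<in>{..n}. ?\<Delta> (L j \<otimes>\<^bsub>U\<^esub> G (n - j)))"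
        by (rule alg_hom_finsum[OF U.kalgebra_axioms UU.kalgebra_axioms coproduct_hom]) (simp add: Pi_iff)
      also have "\<dots> = (\<Oplus>j\<in>{..n}. (\<Oplus>i\<in>{..n - j}. A j i) \<oplus> (\<Oplus>i\<in>{..n - j}. B j i))"
        by (rule UU.finsum_cong') (simp_all add: hom(3) \<Delta>L summand)
      also have "\<dots> = (\<Oplus>j\<in>{..n}. \<Oplus>i\<in>{..n - j}. A j i) \<oplus> (\<Oplus>j\<in>{..n}. \<Oplus>i\<in>{..n - j}. B j i)"
        by (rule UU.finsum_addf) (simp_all add: Pi_iff)
      \<comment> \<open>Regrouped by the degree k of the left tensor factor, the left action amounts
        to k times the term of bidegree (k, n - k), by the recursion for g; the right action gives n
        - k times the same term.\<close>
      also have "(\<Oplus>j\<in>{..n}. \<Oplus>i\<in>{..n - j}. A j i) = (\<Oplus>k\<in>{..n}. of_nat k \<odot> (G k \<otimes>t\<^bsub>U\<^esub> G (n - k)))"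
      proof -
        have "(\<Oplus>j\<in>{..n}. \<Oplus>i\<in>{..n - j}. A j i) = (\<Oplus>k\<in>{..n}. \<Oplus>j\<in>{..k}. A j (k - j))"
          by (rule UU.finsum_triangle) simp
        also have "\<dots> = (\<Oplus>k\<in>{..n}. of_nat k \<odot> (G k \<otimes>t\<^bsub>U\<^esub> G (n - k)))"
        proof (rule UU.finsum_cong'[OF HOL.refl])
          fix k assume k: "k \<in> {..n}"
          have "(\<Oplus>j\<in>{..k}. A j (k - j)) = (\<Oplus>j\<in>{..k}. (L j \<otimes>\<^bsub>U\<^esub> G (k - j)) \<otimes>t\<^bsub>U\<^esub> G (n - k))"
            by (rule UU.finsum_cong') (use k in \<open>simp_all add: A_def\<close>)
          also have "\<dots> = (\<Oplus>\<^bsub>U\<^esub>j\<in>{..k}. L j \<otimes>\<^bsub>U\<^esub> G (k - j)) \<otimes>t\<^bsub>U\<^esub> G (n - k)"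
            unfolding UU_def by (rule pure_tensor_finsum_left[symmetric, OF U.kalgebra_axioms U.kalgebra_axioms])
              (simp_all add: Pi_iff)
          finally show "(\<Oplus>j\<in>{..k}. A j (k - j)) = of_nat k \<odot> (G k \<otimes>t\<^bsub>U\<^esub> G (n - k))"
            by (simp add: ode[symmetric] ptensor_smult)
        qed simp
        finally show ?thesis .
      qed
      also have "(\<Oplus>j\<in>{..n}. \<Oplus>i\<in>{..n - j}. B j i) = (\<Oplus>k\<in>{..n}. of_nat (n - k) \<odot> (G k \<otimes>t\<^bsub>U\<^esub> G (n - k)))"
      proof -
        have "(\<Oplus>j\<in>{..n}. \<Oplus>i\<in>{..n - j}. B j i) = (\<Oplus>i\<in>{..n}. \<Oplus>j\<in>{..n - i}. B j i)"
          by (rule UU.finsum_triangle_swap) simp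
        also have "\<dots> = (\<Oplus>k\<in>{..n}. of_nat (n - k) \<odot> (G k \<otimes>t\<^bsub>U\<^esub> G (n - k)))"
        proof (rule UU.finsum_cong'[OF HOL.refl])
          fix k assume k: "k \<in> {..n}"
          have "(\<Oplus>j\<in>{..n - k}. B j k) = (\<Oplus>j\<in>{..n - k}. G k \<otimes>t\<^bsub>U\<^esub> (L j \<otimes>\<^bsub>U\<^esub> G (n - k - j)))"
            by (rule UU.finsum_cong') (use k in \<open>simp_all add: B_def add.commute\<close>)
          also have "\<dots> = G k \<otimes>t\<^bsub>U\<^esub> (\<Oplus>\<^bsub>U\<^esub>j\<in>{..n - k}. L j \<otimes>\<^bsub>U\<^esub> G (n - k - j))"
            unfolding UU_def by (rule pure_tensor_finsum_right[symmetric, OF U.kalgebra_axioms U.kalgebra_axioms])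
              (simp_all add: Pi_iff)
          finally show "(\<Oplus>j\<in>{..n - k}. B j k) = of_nat (n - k) \<odot> (G k \<otimes>t\<^bsub>U\<^esub> G (n - k))"
            unfolding ode[symmetric] by (simp only: ptensor_smult G)
        qed simp
        finally show ?thesis .
      qed
      also have "(\<Oplus>k\<in>{..n}. of_nat k \<odot> (G k \<otimes>t\<^bsub>U\<^esub> G (n - k))) \<oplus> (\<Oplus>k\<in>{..n}. of_nat (n - k) \<odot> (G k \<otimes>t\<^bsub>U\<^esub> G (n - k)))
          = (\<Oplus>k\<in>{..n}. of_nat k \<odot> (G k \<otimes>t\<^bsub>U\<^esub> G (n - k)) \<oplus> of_nat (n - k) \<odot> (G k \<otimes>t\<^bsub>U\<^esub> G (n - k)))"
        by (rule UU.finsum_addf[symmetric]) (simp_all add: Pi_iff)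
      also have "\<dots> = (\<Oplus>k\<in>{..n}. of_nat n \<odot> (G k \<otimes>t\<^bsub>U\<^esub> G (n - k)))"
      proof (rule UU.finsum_cong'[OF HOL.refl])
        fix k assume "k \<in> {..n}"
        then have "of_nat k + of_nat (n - k) = (of_nat n :: 'k)"
          by (metis atMost_iff le_add_diff_inverse of_nat_add)
        then show "of_nat k \<odot> (G k \<otimes>t\<^bsub>U\<^esub> G (n - k)) \<oplus> of_nat (n - k) \<odot> (G k \<otimes>t\<^bsub>U\<^esub> G (n - k))
            = of_nat n \<odot> (G k \<otimes>t\<^bsub>U\<^esub> G (n - k))"
          using UU.smult_add_left[of "G k \<otimes>t\<^bsub>U\<^esub> G (n - k)" "of_nat k" "of_nat (n - k)"] by simp
      qed simp
      also have "\<dots> = of_nat n \<odot> ?S n"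
        by (rule UU.smult_finsum[symmetric]) (simp add: Pi_iff)
      finally have eq: "of_nat n \<odot> ?\<Delta> (G n) = of_nat n \<odot> ?S n" .
      show ?thesis
        by (rule UU.smult_left_cancel[OF _ _ _ eq]) (use False in \<open>simp_all add: hom(1) Pi_iff\<close>)
    qed
  qed
  then show ?thesis by (simp add: G_def)
qed

end

lemma PsiA_grouplike:
  fixes g :: "(int, 'k::field_char_0) ncs"
  assumes "g \<in> grp {0..<int m}"
  shows "PsiA m g \<in> Acal_grouplike m"
proof -
  have "Acal_coproduct m (PsiA m g) = Acal_tensor m (PsiA m g) (PsiA m g)"
    by (rule ext) (simp add: Acal_coproduct_def Acal_tensor_def PsiA_def UUg_def Psi_grp[OF assms])
  then show ?thesis
    using grp_Nil[OF assms] by (simp add: Acal_grouplike_def Acal_counit_PsiA)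
qed

subsection \<open>The action on the completed enveloping algebra\<close>

context
  fixes m :: nat and w :: "dihedral_gen gword set" and \<sigma> \<tau> :: "int \<Rightarrow> int"
  assumes sym: "letter_sym {0..<int m} \<sigma> \<tau>"
    and index: "\<And>r. r \<in> {0..<int m} \<Longrightarrow> dih_index m w r = \<tau> r"
begin

lemma \<tau>_range: "r \<in> {0..<int m} \<Longrightarrow> \<tau> r \<in> {0..<int m}"
  using sym unfolding letter_sym_def by blast

lemma dih_act_hol_class:
  fixes b :: "('k::field, int) lie_term"
  assumes "lie_gens b \<subseteq> hol_gens m"
  shows "dih_act_hol m w (lie_class (hol_gens m) (hol_rels m) b) = lie_class (hol_gens m) (hol_rels m) (lsub \<tau> b)"
proof -
  let ?X = "hol_gens m" and ?R = "hol_rels m :: (('k, int) lie_term \<times> _) set"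
  let ?\<phi> = "\<lambda>r. hol_t m (dih_index m w r) :: 'k hol"
  have gens: "lie_gens (lsub \<tau> a) \<subseteq> ?X" if "lie_gens a \<subseteq> ?X" for a :: "('k, int) lie_term"
    using that \<tau>_range by (auto simp: lie_gens_lsub hol_gens_def)
  have eval: "lie_eval (hol_lie m) ?\<phi> c = lie_class ?X ?R (lsub \<tau> c)" if "lie_gens c \<subseteq> ?X" for c
    using that
  proof (induction c)
    case (LGen r)
    then have "r \<in> {0..<int m}" by (simp add: hol_gens_def)
    with \<tau>_range[OF this] show ?case by (simp add: hol_t_def index)
  next
    case (LAdd a b)
    then show ?case by (simp add: hol_lie_def presented_lie_add gens)
  next
    case (LSmult k a)
    then show ?case by (simp add: hol_lie_def presented_lie_smult gens)
  next
    case (LBr a b)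
    then show ?case by (simp add: hol_lie_def presented_lie_bracket gens)
  qed (simp add: hol_lie_def presented_lie_zero)
  have "lie_eval (hol_lie m) ?\<phi> ` lie_class ?X ?R b = (\<lambda>_. lie_class ?X ?R (lsub \<tau> b)) ` lie_class ?X ?R b"
  proof (rule image_cong[OF HOL.refl])
    fix c assume "c \<in> lie_class ?X ?R b"
    then have c: "lie_gens c \<subseteq> ?X" "lie_eq ?R b c" by (auto simp: lie_class_def)
    then show "lie_eval (hol_lie m) ?\<phi> c = lie_class ?X ?R (lsub \<tau> b)"
      unfolding eval[OF c(1)]
      by (intro lie_class_eqI[symmetric] hol_rels_lsub[OF letter_sym_flip[OF sym] c(2)])
  qed
  also have "\<dots> = {lie_class ?X ?R (lsub \<tau> b)}"
    using lie_class_self[OF assms, of ?R] by blast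
  finally show ?thesis by (simp add: dih_act_hol_def lie_lift_def)
qed

lemma
  fixes U :: "('k::field, 'k Uhol) module"
  defines "U \<equiv> Ug m"
  shows dih_act_Ug_hom: "dih_act_Ug m w \<in> alg_hom U U"
    and dih_act_Ug_gen: "r \<in> {0..<int m} \<Longrightarrow> dih_act_Ug m w (ugen m r :: 'k Uhol) = ugen m (\<tau> r)"
proof -
  interpret kalgebra "Ug m :: ('k, 'k Uhol) module" by (rule Ug_kalgebra)
  let ?\<phi> = "\<lambda>x. enveloping_incl (hol_lie m) (dih_act_hol m w x) :: 'k Uhol"
  have gens: "lie_gens (lsub \<tau> a) \<subseteq> hol_gens m" if "lie_gens a \<subseteq> hol_gens m" for a :: "('k, int) lie_term"
    using that \<tau>_range by (auto simp: lie_gens_lsub hol_gens_def)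
  have cls: "?\<phi> (lie_class (hol_gens m) (hol_rels m) a) = hcls m (lsub \<tau> a)"
    if "lie_gens a \<subseteq> hol_gens m" for a
    using that by (simp add: dih_act_hol_class hcls_def)
  have ops: "lie_add (hol_lie m) (lie_class (hol_gens m) (hol_rels m) a) (lie_class (hol_gens m) (hol_rels m) b)
      = lie_class (hol_gens m) (hol_rels m) (LAdd a b)"
    "lie_bracket (hol_lie m) (lie_class (hol_gens m) (hol_rels m) a) (lie_class (hol_gens m) (hol_rels m) b)
      = lie_class (hol_gens m) (hol_rels m) (LBr a b)"
    "lie_smult (hol_lie m) c (lie_class (hol_gens m) (hol_rels m) a)
      = lie_class (hol_gens m) (hol_rels m) (LSmult c a)"
    if "lie_gens a \<subseteq> hol_gens m" "lie_gens b \<subseteq> hol_gens m" for a b :: "('k, int) lie_term" and c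
    using that by (simp_all add: hol_lie_def presented_lie_simps)
  have 1: "?\<phi> x \<in> carrier (Ug m)" if x: "x \<in> lie_carrier (hol_lie m)" for x
  proof -
    obtain a where a: "lie_gens a \<subseteq> hol_gens m" "x = lie_class (hol_gens m) (hol_rels m) a"
      using x by (rule hol_cases)
    show ?thesis unfolding a(2) cls[OF a(1)] by (rule hcls_closed[OF gens[OF a(1)]])
  qed
  have 2: "?\<phi> (lie_add (hol_lie m) x y) = ?\<phi> x \<oplus>\<^bsub>Ug m\<^esub> ?\<phi> y"
    "?\<phi> (lie_bracket (hol_lie m) x y) = ?\<phi> x \<otimes>\<^bsub>Ug m\<^esub> ?\<phi> y \<oplus>\<^bsub>Ug m\<^esub> (- 1) \<odot>\<^bsub>Ug m\<^esub> (?\<phi> y \<otimes>\<^bsub>Ug m\<^esub> ?\<phi> x)"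
    if xy: "x \<in> lie_carrier (hol_lie m)" "y \<in> lie_carrier (hol_lie m)" for x y
  proof -
    obtain a where a: "lie_gens a \<subseteq> hol_gens m" "x = lie_class (hol_gens m) (hol_rels m) a"
      using xy(1) by (rule hol_cases)
    obtain b where b: "lie_gens b \<subseteq> hol_gens m" "y = lie_class (hol_gens m) (hol_rels m) b"
      using xy(2) by (rule hol_cases)
    show "?\<phi> (lie_add (hol_lie m) x y) = ?\<phi> x \<oplus>\<^bsub>Ug m\<^esub> ?\<phi> y"
      "?\<phi> (lie_bracket (hol_lie m) x y) = ?\<phi> x \<otimes>\<^bsub>Ug m\<^esub> ?\<phi> y \<oplus>\<^bsub>Ug m\<^esub> (- 1) \<odot>\<^bsub>Ug m\<^esub> (?\<phi> y \<otimes>\<^bsub>Ug m\<^esub> ?\<phi> x)"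
      unfolding a(2) b(2) ops[OF a(1) b(1)] cls[OF a(1)] cls[OF b(1)]
      using a(1) b(1) by (simp_all only: cls lie_term.set Un_least lsub_simps hcls_add hcls_br gens)
  qed
  have 3: "?\<phi> (lie_smult (hol_lie m) c x) = c \<odot>\<^bsub>Ug m\<^esub> ?\<phi> x" if x: "x \<in> lie_carrier (hol_lie m)" for c x
  proof -
    obtain a where a: "lie_gens a \<subseteq> hol_gens m" "x = lie_class (hol_gens m) (hol_rels m) a"
      using x by (rule hol_cases)
    show ?thesis
      unfolding a(2) ops[OF a(1) a(1)] cls[OF a(1)]
      using a(1) by (simp only: cls lie_term.set lsub_simps hcls_smult gens)
  qed
  note lift = Ug_lift[where A = "Ug m" and \<phi> = "?\<phi>" and m = m, OF Ug_kalgebra 1 2(1) 3 2(2)]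
  show "dih_act_Ug m w \<in> alg_hom U U"
    unfolding dih_act_Ug_def U_def by (rule lift(1))
  show "dih_act_Ug m w (ugen m r :: 'k Uhol) = ugen m (\<tau> r)" if "r \<in> {0..<int m}"
  proof -
    have g: "lie_gens (LGen r :: ('k, int) lie_term) \<subseteq> hol_gens m"
      using that by (simp add: hol_gens_def)
    have "alg_lift (Ug m) ?\<phi> (hcls m (LGen r)) = hcls m (lsub \<tau> (LGen r))"
      unfolding cls[OF g, symmetric] hcls_def[of m "LGen r"]
      by (rule lift(2)) (assumption | rule hol_carrier[OF g])+
    then show ?thesis by (simp only: dih_act_Ug_def ugen_def lsub_simps)
  qed
qed

text \<open>Equivariance of evaluation: w sends t_r to the generator with index \<tau> r, which on
  coefficient functions is substitution of the inverse \<sigma>. The induction step reindexes the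
  sum over the generators along \<tau>.\<close>

lemma dih_act_Psi: "dih_act_Ug m w (Psi m n f) = (Psi m n (ren \<sigma> f) :: 'k::field Uhol)"
proof (induction n arbitrary: f)
  note hom = alg_homE[OF dih_act_Ug_hom[where ?'k = 'k]]
  interpret kalgebra "Ug m :: ('k, 'k Uhol) module" by (rule Ug_kalgebra)
  {
    case 0
    then show ?case using hom(4,5) by simp
  next
    case (Suc n)
    have inv: "\<sigma> (\<tau> r) = r" "\<tau> (\<sigma> r) = r" for r
      using sym by (auto simp: letter_sym_def fun_eq_iff)
    have \<sigma>: "\<sigma> r \<in> {0..<int m}" if "r \<in> {0..<int m}" for r
      using sym that unfolding letter_sym_def by blast
    have img: "\<tau> ` {0..<int m} = {0..<int m}"
    proof
      show "{0..<int m} \<subseteq> \<tau> ` {0..<int m}"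
      proof
        fix r assume "r \<in> {0..<int m}"
        then have "\<sigma> r \<in> {0..<int m}" by (rule \<sigma>)
        then have "\<tau> (\<sigma> r) \<in> \<tau> ` {0..<int m}" by (rule imageI)
        then show "r \<in> \<tau> ` {0..<int m}" by (simp only: inv)
      qed
    qed (use \<tau>_range in blast)
    have inj: "inj_on \<tau> {0..<int m}" by (rule inj_on_inverseI[of _ \<sigma>]) (simp add: inv)
    have gen: "ugen m r \<in> carrier (Ug m :: ('k, 'k Uhol) module)" if "r \<in> {0..<int m}" for r
      using that by (simp add: ugen_closed)
    have "dih_act_Ug m w (Psi m (Suc n) f)
        = (\<Oplus>\<^bsub>Ug m\<^esub>r\<in>{0..<int m}. dih_act_Ug m w (ugen m r \<otimes>\<^bsub>Ug m\<^esub> Psi m n (lder r f)))"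
      unfolding Psi.simps
      by (rule alg_hom_finsum[OF Ug_kalgebra Ug_kalgebra dih_act_Ug_hom]) (use gen Psi_closed in auto)
    also have "\<dots> = (\<Oplus>\<^bsub>Ug m\<^esub>r\<in>{0..<int m}. ugen m (\<tau> r) \<otimes>\<^bsub>Ug m\<^esub> Psi m n (lder (\<tau> r) (ren \<sigma> f)))"
    proof (rule finsum_cong'[OF HOL.refl])
      fix r assume r: "r \<in> {0..<int m}"
      have "lder (\<tau> r) (ren \<sigma> f) = ren \<sigma> (lder r f)"
        by (rule ncs_eqI) (simp add: inv)
      then show "dih_act_Ug m w (ugen m r \<otimes>\<^bsub>Ug m\<^esub> Psi m n (lder r f))
          = ugen m (\<tau> r) \<otimes>\<^bsub>Ug m\<^esub> Psi m n (lder (\<tau> r) (ren \<sigma> f))"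
        using hom(3)[OF gen[OF r] Psi_closed] by (simp add: dih_act_Ug_gen[OF r] Suc)
    qed (use gen \<tau>_range Psi_closed in auto)
    also have "\<dots> = (\<Oplus>\<^bsub>Ug m\<^esub>r\<in>\<tau> ` {0..<int m}. ugen m r \<otimes>\<^bsub>Ug m\<^esub> Psi m n (lder r (ren \<sigma> f)))"
      by (rule finsum_reindex[symmetric, OF _ inj]) (use gen \<tau>_range Psi_closed in auto)
    finally show ?case by (simp only: img Psi.simps)
  }
qed

lemma dih_act_PsiA: "dih_act m w (PsiA m f) = PsiA m (ren \<sigma> f)"
  by (rule ext) (simp add: dih_act_def PsiA_def dih_act_Psi)

end

section \<open>Groups given by generators and relations, and their universal property\<close>

section \<open>Presented groups\<close>

lemma gword_class_eqI: "gword_eq R u v \<Longrightarrow> gword_class R u = gword_class R v"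
  unfolding gword_class_def by (auto intro: gword_eq.trans gword_eq.sym)

lemma gword_class_self: "u \<in> gword_class R u"
  by (simp add: gword_class_def gword_eq.refl)

lemma gword_class_eqD:
  assumes "gword_class R u = gword_class R v"
  shows "gword_eq R u v"
proof -
  have "v \<in> gword_class R u" unfolding assms by (rule gword_class_self)
  then show ?thesis by (simp add: gword_class_def)
qed

text \<open>The chosen representative is equivalent to any other, so functions of words that respect
  the relations descend to classes.\<close>

lemma gword_class_some: "gword_eq R (SOME v. gword_class R u = gword_class R v) u"
proof -
  have "gword_class R u = gword_class R (SOME v. gword_class R u = gword_class R v)"
    by (rule someI[of _ u]) (rule HOL.refl)
  then show ?thesis by (rule gword_eq.sym[OF gword_class_eqD])
qed

lemma gword_eq_append_right: "gword_eq R u v \<Longrightarrow> gword_eq R (u @ w) (v @ w)"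
proof (induction rule: gword_eq.induct)
  case (cancel u x b v)
  then show ?case using gword_eq.cancel[of R u x b "v @ w"] by simp
next
  case (rel l r u v)
  then show ?case using gword_eq.rel[of l r R u "v @ w"] by simp
qed (blast intro: gword_eq.intros)+

lemma gword_eq_append_left: "gword_eq R u v \<Longrightarrow> gword_eq R (w @ u) (w @ v)"
proof (induction rule: gword_eq.induct)
  case (cancel u x b v)
  then show ?case using gword_eq.cancel[of R "w @ u" x b v] by simp
next
  case (rel l r u v)
  then show ?case using gword_eq.rel[of l r R "w @ u" v] by simp
qed (blast intro: gword_eq.intros)+

lemma gword_class_carrier: "gword_class R u \<in> carrier (presented_group R)"
  by (simp add: presented_group_def)

lemma presented_group_cases:
  assumes "x \<in> carrier (presented_group R)"
  obtains u where "x = gword_class R u"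
  using assms by (auto simp: presented_group_def)

lemma presented_group_one: "\<one>\<^bsub>presented_group R\<^esub> = gword_class R []"
  by (simp add: presented_group_def)

lemma presented_group_mult:
  "gword_class R u \<otimes>\<^bsub>presented_group R\<^esub> gword_class R v = gword_class R (u @ v)"
proof -
  have eq: "gword_class R (u' @ v') = gword_class R (u @ v)"
    if "u' \<in> gword_class R u" "v' \<in> gword_class R v" for u' v'
    using that by (intro gword_class_eqI[symmetric])
      (auto simp: gword_class_def intro: gword_eq.trans[OF gword_eq_append_right gword_eq_append_left])
  show ?thesis
    by (simp add: presented_group_def) (rule UN_eq_const[OF gword_class_self], rule UN_eq_const[OF gword_class_self], rule eq)
qed

definition winv :: "'x gword \<Rightarrow> 'x gword" where
  "winv u = rev (map (\<lambda>(x, b). (x, \<not> b)) u)"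

lemma winv_cancel: "gword_eq R (winv u @ u) []"
proof (induction u)
  case (Cons a u)
  obtain x b where a: "a = (x, b)" by (cases a)
  have "gword_eq R (winv u @ [(x, \<not> b), (x, \<not> \<not> b)] @ u) (winv u @ u)"
    by (rule gword_eq.cancel)
  then show ?case
    using gword_eq.trans[OF _ Cons] by (simp add: winv_def a)
qed (simp add: winv_def gword_eq.refl)

lemma presented_group_group: "group (presented_group R)"
proof (rule groupI)
  fix x assume "x \<in> carrier (presented_group R)"
  then obtain u where u: "x = gword_class R u" by (rule presented_group_cases)
  show "\<exists>y\<in>carrier (presented_group R). y \<otimes>\<^bsub>presented_group R\<^esub> x = \<one>\<^bsub>presented_group R\<^esub>"
    by (rule bexI[of _ "gword_class R (winv u)"])
      (simp_all add: u presented_group_mult presented_group_one gword_class_carrier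
        gword_class_eqI[OF winv_cancel])
qed (auto elim!: presented_group_cases
      simp: presented_group_mult presented_group_one gword_class_carrier)

primrec (in group) word_eval :: "('x \<Rightarrow> 'a) \<Rightarrow> 'x gword \<Rightarrow> 'a" where
  "word_eval \<phi> [] = \<one>"
| "word_eval \<phi> (a # u) = (if snd a then \<phi> (fst a) else inv (\<phi> (fst a))) \<otimes> word_eval \<phi> u"

context group
begin

lemma word_eval_closed: "range \<phi> \<subseteq> carrier G \<Longrightarrow> word_eval \<phi> u \<in> carrier G"
  by (induction u) (auto simp: image_subset_iff)

lemma word_eval_append:
  "range \<phi> \<subseteq> carrier G \<Longrightarrow> word_eval \<phi> (u @ v) = word_eval \<phi> u \<otimes> word_eval \<phi> v"
  by (induction u) (auto simp: word_eval_closed image_subset_iff m_assoc)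

lemma word_eval_respects:
  assumes \<phi>: "range \<phi> \<subseteq> carrier G"
    and R: "\<And>l r. (l, r) \<in> R \<Longrightarrow> word_eval \<phi> l = word_eval \<phi> r"
  shows "gword_eq R u v \<Longrightarrow> word_eval \<phi> u = word_eval \<phi> v"
proof (induction rule: gword_eq.induct)
  case (cancel u x b v)
  have x: "\<phi> x \<in> carrier G" using \<phi> by auto
  let ?v = "word_eval \<phi> v"
  have "\<phi> x \<otimes> (inv (\<phi> x) \<otimes> ?v) = ?v" "inv (\<phi> x) \<otimes> (\<phi> x \<otimes> ?v) = ?v"
    using x word_eval_closed[OF \<phi>, of v] by (metis inv_closed l_inv l_one m_assoc r_inv)+
  then show ?case
    by (cases b) (simp_all add: word_eval_append[OF \<phi>])
next
  case (rel l r u v)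
  then show ?case by (simp add: word_eval_append[OF \<phi>] R)
qed simp_all

lemma presented_group_hom:
  assumes "range \<phi> \<subseteq> carrier G" "\<And>l r. (l, r) \<in> R \<Longrightarrow> word_eval \<phi> l = word_eval \<phi> r"
  shows "\<exists>\<rho> \<in> hom (presented_group R) G. \<forall>u. \<rho> (gword_class R u) = word_eval \<phi> u"
proof -
  define \<rho> where "\<rho> C = word_eval \<phi> (SOME u. C = gword_class R u)" for C
  have \<rho>: "\<rho> (gword_class R u) = word_eval \<phi> u" for u
  proof -
    show ?thesis unfolding \<rho>_def by (rule word_eval_respects[OF assms gword_class_some])
  qed
  have "\<rho> \<in> hom (presented_group R) G"
    by (auto simp: hom_def presented_group_mult \<rho> word_eval_append assms word_eval_closed
        elim!: presented_group_cases)
  then show ?thesis using \<rho> by blast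
qed

end

section \<open>Finiteness of the dihedral group and its action on letters\<close>

section \<open>The dihedral group\<close>

lemma dihedral_group: "group (dihedral m)"
  unfolding dihedral_def by (rule presented_group_group)

lemma dih_cases:
  assumes "w \<in> carrier (dihedral m)"
  obtains u where "w = gword_class (dihedral_rels m) u"
  using assms unfolding dihedral_def by (rule presented_group_cases)

lemma dih_class_carrier: "gword_class (dihedral_rels m) u \<in> carrier (dihedral m)"
  by (simp add: dihedral_def gword_class_carrier)

lemma dih_class_mult: "gword_class (dihedral_rels m) u \<otimes>\<^bsub>dihedral m\<^esub> gword_class (dihedral_rels m) v
    = gword_class (dihedral_rels m) (u @ v)"
  by (simp add: dihedral_def presented_group_mult)

lemma dih_s_carrier [simp]: "dih_s m \<in> carrier (dihedral m)"
  and dih_omega_carrier [simp]: "dih_omega m \<in> carrier (dihedral m)"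
  by (simp_all add: dih_s_def dih_omega_def dih_class_carrier)

lemma dih_omega_power:
  "dih_omega m [^]\<^bsub>dihedral m\<^esub> (k::nat) = gword_class (dihedral_rels m) (replicate k (Gen_omega, True))"
proof (induction k)
  case (Suc k)
  then show ?case
    by (simp add: nat_pow_def dih_omega_def dih_class_mult replicate_append_same[symmetric])
qed (simp add: nat_pow_def dihedral_def presented_group_one)

lemma
  shows dih_s_square: "dih_s m \<otimes>\<^bsub>dihedral m\<^esub> dih_s m = \<one>\<^bsub>dihedral m\<^esub>"
    and dih_omega_order: "dih_omega m [^]\<^bsub>dihedral m\<^esub> m = \<one>\<^bsub>dihedral m\<^esub>"
    and dih_s_omega: "dih_s m \<otimes>\<^bsub>dihedral m\<^esub> dih_omega m = inv\<^bsub>dihedral m\<^esub> dih_omega m \<otimes>\<^bsub>dihedral m\<^esub> dih_s m"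
proof -
  interpret group "dihedral m" by (rule dihedral_group)
  have rel: "gword_class (dihedral_rels m) l = gword_class (dihedral_rels m) r" if "(l, r) \<in> dihedral_rels m" for l r
    using gword_class_eqI[OF gword_eq.rel[OF that, of "[]" "[]"]] by simp
  have one: "\<one>\<^bsub>dihedral m\<^esub> = gword_class (dihedral_rels m) []"
    by (simp add: dihedral_def presented_group_one)
  have som: "([(Gen_s, True), (Gen_omega, True)], [(Gen_omega, False), (Gen_s, True)]) \<in> dihedral_rels m"
    by (simp add: dihedral_rels_def)
  show "dih_s m \<otimes>\<^bsub>dihedral m\<^esub> dih_s m = \<one>\<^bsub>dihedral m\<^esub>"
    unfolding dih_s_def dih_class_mult one by (rule rel) (simp add: dihedral_rels_def)
  show "dih_omega m [^]\<^bsub>dihedral m\<^esub> m = \<one>\<^bsub>dihedral m\<^esub>"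
    unfolding dih_omega_power one by (rule rel) (simp add: dihedral_rels_def)
  have "gword_class (dihedral_rels m) [(Gen_omega, False)] \<otimes>\<^bsub>dihedral m\<^esub> dih_omega m = \<one>\<^bsub>dihedral m\<^esub>"
    using gword_class_eqI[OF gword_eq.cancel[of "dihedral_rels m" "[]" Gen_omega False "[]"]]
    by (simp add: dih_omega_def dih_class_mult one)
  then have "gword_class (dihedral_rels m) [(Gen_omega, False)] = inv\<^bsub>dihedral m\<^esub> dih_omega m"
    by (intro inv_equality[symmetric]) (simp_all add: dih_class_carrier)
  then show "dih_s m \<otimes>\<^bsub>dihedral m\<^esub> dih_omega m = inv\<^bsub>dihedral m\<^esub> dih_omega m \<otimes>\<^bsub>dihedral m\<^esub> dih_s m"
    by (metis (no_types) dih_s_def dih_omega_def dih_class_mult append_Cons append_Nil rel[OF som])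
qed

lemma dih_inv_s: "inv\<^bsub>dihedral m\<^esub> dih_s m = dih_s m"
proof -
  interpret group "dihedral m" by (rule dihedral_group)
  show ?thesis by (rule inv_equality) (simp_all add: dih_s_square)
qed

lemma dih_inv_omega:
  assumes "m > 0"
  shows "inv\<^bsub>dihedral m\<^esub> dih_omega m = dih_omega m [^]\<^bsub>dihedral m\<^esub> (m - 1)"
proof -
  interpret group "dihedral m" by (rule dihedral_group)
  have "dih_omega m [^]\<^bsub>dihedral m\<^esub> (m - 1) \<otimes>\<^bsub>dihedral m\<^esub> dih_omega m = dih_omega m [^]\<^bsub>dihedral m\<^esub> m"
    using nat_pow_Suc[of "dih_omega m" "m - 1"] assms by simp
  then show ?thesis by (intro inv_equality) (simp_all add: dih_omega_order)
qed

lemma dih_class_Cons: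
  "gword_class (dihedral_rels m) ((x, b) # u) =
    (let g = (case x of Gen_s \<Rightarrow> dih_s m | Gen_omega \<Rightarrow> dih_omega m)
     in (if b then g else inv\<^bsub>dihedral m\<^esub> g)) \<otimes>\<^bsub>dihedral m\<^esub> gword_class (dihedral_rels m) u"
proof -
  interpret group "dihedral m" by (rule dihedral_group)
  have one: "\<one>\<^bsub>dihedral m\<^esub> = gword_class (dihedral_rels m) []"
    by (simp add: dihedral_def presented_group_one)
  have "gword_class (dihedral_rels m) [(x, False)] \<otimes>\<^bsub>dihedral m\<^esub> gword_class (dihedral_rels m) [(x, True)] = \<one>\<^bsub>dihedral m\<^esub>"
    using gword_class_eqI[OF gword_eq.cancel[of "dihedral_rels m" "[]" x False "[]"]]
    by (simp add: dih_class_mult one)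
  then have "gword_class (dihedral_rels m) [(x, False)] = inv\<^bsub>dihedral m\<^esub> (gword_class (dihedral_rels m) [(x, True)])"
    by (intro inv_equality[symmetric]) (simp_all add: dih_class_carrier)
  moreover have "gword_class (dihedral_rels m) [(x, True)] = (case x of Gen_s \<Rightarrow> dih_s m | Gen_omega \<Rightarrow> dih_omega m)"
    by (cases x) (simp_all add: dih_s_def dih_omega_def)
  ultimately have "gword_class (dihedral_rels m) [(x, b)] =
    (let g = (case x of Gen_s \<Rightarrow> dih_s m | Gen_omega \<Rightarrow> dih_omega m) in (if b then g else inv\<^bsub>dihedral m\<^esub> g))"
    by (cases b) (simp_all add: Let_def)
  then show ?thesis
    using dih_class_mult[of m "[(x, b)]" u] by simp
qed

text \<open>The elements \<omega>^j s^i are closed under left multiplication by the generators and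
  their inverses, so they exhaust W, and the exponents matter only modulo m and 2. Finiteness gives
  meaning to the sums over W in the semidirect product.\<close>

lemma dihedral_finite:
  assumes "m > 0"
  shows "finite (carrier (dihedral m))"
proof -
  interpret group "dihedral m" by (rule dihedral_group)
  let ?s = "dih_s m" and ?o = "dih_omega m"
  define N where "N = {?o [^]\<^bsub>dihedral m\<^esub> (j::nat) \<otimes>\<^bsub>dihedral m\<^esub> ?s [^]\<^bsub>dihedral m\<^esub> (i::nat) | i j. True}"
  \<comment> \<open>Writing the inverse of \<omega> as \<omega>^(m - 1) keeps all exponents natural
    numbers.\<close>
  have comm: "?s \<otimes>\<^bsub>dihedral m\<^esub> ?o [^]\<^bsub>dihedral m\<^esub> j = ?o [^]\<^bsub>dihedral m\<^esub> ((m - 1) * j) \<otimes>\<^bsub>dihedral m\<^esub> ?s" for j :: nat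
  proof (induction j)
    case (Suc j)
    have "?s \<otimes>\<^bsub>dihedral m\<^esub> ?o [^]\<^bsub>dihedral m\<^esub> Suc j = (?s \<otimes>\<^bsub>dihedral m\<^esub> ?o [^]\<^bsub>dihedral m\<^esub> j) \<otimes>\<^bsub>dihedral m\<^esub> ?o"
      by (simp add: m_assoc)
    also have "\<dots> = ?o [^]\<^bsub>dihedral m\<^esub> ((m - 1) * j) \<otimes>\<^bsub>dihedral m\<^esub> (?o [^]\<^bsub>dihedral m\<^esub> (m - 1) \<otimes>\<^bsub>dihedral m\<^esub> ?s)"
      by (simp add: Suc m_assoc dih_s_omega dih_inv_omega[OF assms])
    also have "\<dots> = ?o [^]\<^bsub>dihedral m\<^esub> ((m - 1) * Suc j) \<otimes>\<^bsub>dihedral m\<^esub> ?s"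
      by (simp add: m_assoc[symmetric] nat_pow_mult add.commute)
    finally show ?case .
  qed simp
  have mult_o: "?o [^]\<^bsub>dihedral m\<^esub> (k::nat) \<otimes>\<^bsub>dihedral m\<^esub> x \<in> N" if N: "x \<in> N" for x k
  proof -
    obtain i j :: nat where x: "x = ?o [^]\<^bsub>dihedral m\<^esub> j \<otimes>\<^bsub>dihedral m\<^esub> ?s [^]\<^bsub>dihedral m\<^esub> i"
      using N unfolding N_def by blast
    have "?o [^]\<^bsub>dihedral m\<^esub> k \<otimes>\<^bsub>dihedral m\<^esub> x = ?o [^]\<^bsub>dihedral m\<^esub> (k + j) \<otimes>\<^bsub>dihedral m\<^esub> ?s [^]\<^bsub>dihedral m\<^esub> i"
      by (simp add: x m_assoc[symmetric] nat_pow_mult)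
    then show ?thesis unfolding N_def by blast
  qed
  have mult_s: "?s \<otimes>\<^bsub>dihedral m\<^esub> x \<in> N" if N: "x \<in> N" for x
  proof -
    obtain i j :: nat where x: "x = ?o [^]\<^bsub>dihedral m\<^esub> j \<otimes>\<^bsub>dihedral m\<^esub> ?s [^]\<^bsub>dihedral m\<^esub> i"
      using N unfolding N_def by blast
    have "?s \<otimes>\<^bsub>dihedral m\<^esub> x = ?o [^]\<^bsub>dihedral m\<^esub> ((m - 1) * j) \<otimes>\<^bsub>dihedral m\<^esub> (?s \<otimes>\<^bsub>dihedral m\<^esub> ?s [^]\<^bsub>dihedral m\<^esub> i)"
      by (simp add: x m_assoc[symmetric] comm)
    also have "?s \<otimes>\<^bsub>dihedral m\<^esub> ?s [^]\<^bsub>dihedral m\<^esub> i = ?s [^]\<^bsub>dihedral m\<^esub> Suc i"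
      by (rule nat_pow_Suc2[symmetric]) simp
    finally show ?thesis unfolding N_def by blast
  qed
  have "gword_class (dihedral_rels m) u \<in> N" for u
  proof (induction u)
    case Nil
    have "gword_class (dihedral_rels m) [] = ?o [^]\<^bsub>dihedral m\<^esub> (0::nat) \<otimes>\<^bsub>dihedral m\<^esub> ?s [^]\<^bsub>dihedral m\<^esub> (0::nat)"
      by (simp add: dihedral_def presented_group_one[symmetric]) 
        (simp add: dihedral_def[symmetric])
    then show ?case unfolding N_def by blast
  next
    case (Cons a u)
    obtain x b where a: "a = (x, b)" by (cases a)
    show ?case
      using mult_s[OF Cons] mult_o[OF Cons, of 1] mult_o[OF Cons, of "m - 1"]
      by (cases x; cases b) (simp_all add: a dih_class_Cons dih_inv_s dih_inv_omega[OF assms])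
  qed
  then have sub: "carrier (dihedral m) \<subseteq> N"
    by (auto elim!: dih_cases)
  have "N \<subseteq> (\<lambda>(i, j). ?o [^]\<^bsub>dihedral m\<^esub> (j::nat) \<otimes>\<^bsub>dihedral m\<^esub> ?s [^]\<^bsub>dihedral m\<^esub> (i::nat)) ` ({..<2} \<times> {..<m})"
  proof
    fix x assume "x \<in> N"
    obtain i j :: nat where x: "x = ?o [^]\<^bsub>dihedral m\<^esub> j \<otimes>\<^bsub>dihedral m\<^esub> ?s [^]\<^bsub>dihedral m\<^esub> i"
      using \<open>x \<in> N\<close> unfolding N_def by blast
    have red: "g [^]\<^bsub>dihedral m\<^esub> (k mod n) = g [^]\<^bsub>dihedral m\<^esub> k"
      if "g \<in> carrier (dihedral m)" "g [^]\<^bsub>dihedral m\<^esub> n = \<one>\<^bsub>dihedral m\<^esub>" for g and k n :: nat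
    proof -
      have "g [^]\<^bsub>dihedral m\<^esub> (n * (k div n) + k mod n) = g [^]\<^bsub>dihedral m\<^esub> (k mod n)"
        using that by (simp only: nat_pow_mult[symmetric] nat_pow_pow[symmetric]) simp
      then show ?thesis by simp
    qed
    have s2: "?s [^]\<^bsub>dihedral m\<^esub> (2::nat) = \<one>\<^bsub>dihedral m\<^esub>"
      by (simp add: numeral_2_eq_2 dih_s_square)
    have "x = ?o [^]\<^bsub>dihedral m\<^esub> (j mod m) \<otimes>\<^bsub>dihedral m\<^esub> ?s [^]\<^bsub>dihedral m\<^esub> (i mod 2)"
      by (simp only: x red[OF dih_omega_carrier dih_omega_order] red[OF dih_s_carrier s2])
    then show "x \<in> (\<lambda>(i, j). ?o [^]\<^bsub>dihedral m\<^esub> (j::nat) \<otimes>\<^bsub>dihedral m\<^esub> ?s [^]\<^bsub>dihedral m\<^esub> (i::nat)) ` ({..<2} \<times> {..<m})"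
      using assms by (intro image_eqI[of _ _ "(i mod 2, j mod m)"]) auto
  qed
  then have "finite N" by (rule finite_subset) simp
  with sub show ?thesis by (rule finite_subset)
qed

subsection \<open>The action on the letters\<close>

fun lperm :: "nat \<Rightarrow> dihedral_gen \<times> bool \<Rightarrow> int \<Rightarrow> int" where
  "lperm m (Gen_s, b) = dperm m (- 1) 0"
| "lperm m (Gen_omega, True) = dperm m 1 2"
| "lperm m (Gen_omega, False) = dperm m 1 (- 2)"

primrec wperm :: "nat \<Rightarrow> dihedral_gen gword \<Rightarrow> int \<Rightarrow> int" where
  "wperm m [] = id"
| "wperm m (a # u) = lperm m a \<circ> wperm m u"

lemma wperm_append: "wperm m (u @ v) = wperm m u \<circ> wperm m v"
  by (induction u) (auto simp: fun_eq_iff)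

lemma lperm_inverse: "lperm m (x, b) \<circ> lperm m (x, \<not> b) = id"
  by (cases x; cases b) (simp_all add: dperm_comp dperm_id)

lemma wperm_omega: "wperm m (replicate k (Gen_omega, True)) = dperm m 1 (2 * int k)"
  by (induction k) (simp_all add: dperm_id dperm_comp algebra_simps)

lemma wperm_respects: "gword_eq (dihedral_rels m) u v \<Longrightarrow> wperm m u = wperm m v"
proof (induction rule: gword_eq.induct)
  case (cancel u x b v)
  have "wperm m ([(x, b), (x, \<not> b)] @ v) = wperm m v"
    using lperm_inverse[of m x b] by (simp add: comp_assoc[symmetric])
  then show ?case unfolding wperm_append by simp
next
  case (rel l r u v)
  have "dperm m 1 (2 * int m) = id"
    using dperm_cong[of "2 * int m" m 0 1] by (simp add: dperm_id)
  then have "wperm m l = wperm m r"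
    using rel by (auto simp: dihedral_rels_def wperm_omega dperm_comp dperm_id)
  then show ?case unfolding wperm_append by simp
qed simp_all

lemma wperm_sym: "letter_sym {0..<int m} (wperm m (winv u)) (wperm m u)"
proof (induction u)
  case Nil
  show ?case by (simp add: winv_def letter_sym_def fun_eq_iff)
next
  case (Cons a u)
  obtain x b where a: "a = (x, b)" by (cases a)
  have "letter_sym {0..<int m} (lperm m (x, \<not> b)) (lperm m (x, b))"
    using dperm_sym[of "- 1" m 0] dperm_sym[of 1 m 2] dperm_sym[of 1 m "- 2"]
    by (cases x; cases b) simp_all
  from letter_sym_comp[OF Cons this]
  have "letter_sym {0..<int m} (wperm m (winv u) \<circ> lperm m (x, \<not> b)) (lperm m (x, b) \<circ> wperm m u)" .
  moreover have "wperm m (winv (a # u)) = wperm m (winv u) \<circ> lperm m (x, \<not> b)"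
    by (simp add: a winv_def wperm_append fun_eq_iff)
  ultimately show ?case by (simp only: a wperm.simps)
qed

definition cperm :: "nat \<Rightarrow> dihedral_gen gword set \<Rightarrow> int \<Rightarrow> int" where
  "cperm m w = wperm m (SOME u. w = gword_class (dihedral_rels m) u)"

lemma cperm_class: "cperm m (gword_class (dihedral_rels m) u) = wperm m u"
  unfolding cperm_def by (rule wperm_respects[OF gword_class_some])

lemma cperm_mult:
  "w \<in> carrier (dihedral m) \<Longrightarrow> w' \<in> carrier (dihedral m) \<Longrightarrow>
    cperm m (w \<otimes>\<^bsub>dihedral m\<^esub> w') = cperm m w \<circ> cperm m w'"
  by (elim dih_cases) (simp add: dih_class_mult cperm_class wperm_append)

lemma cperm_one: "cperm m \<one>\<^bsub>dihedral m\<^esub> = id"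
  using cperm_class[of m "[]"] by (simp add: dihedral_def presented_group_one)

lemma cperm_sym:
  assumes "w \<in> carrier (dihedral m)"
  shows "letter_sym {0..<int m} (cperm m (inv\<^bsub>dihedral m\<^esub> w)) (cperm m w)"
proof -
  interpret group "dihedral m" by (rule dihedral_group)
  obtain u where u: "w = gword_class (dihedral_rels m) u" using assms by (rule dih_cases)
  have "gword_class (dihedral_rels m) (winv u) \<otimes>\<^bsub>dihedral m\<^esub> w = \<one>\<^bsub>dihedral m\<^esub>"
    by (simp add: u dih_class_mult gword_class_eqI[OF winv_cancel]) (simp add: dihedral_def presented_group_one)
  then have "inv\<^bsub>dihedral m\<^esub> w = gword_class (dihedral_rels m) (winv u)"
    by (rule inv_equality) (simp_all add: assms dih_class_carrier)
  then show ?thesis by (simp add: u cperm_class wperm_sym)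
qed

lemma dih_index_cperm:
  assumes "w \<in> carrier (dihedral m)" "r \<in> {0..<int m}"
  shows "dih_index m w r = cperm m w r"
proof -
  obtain u where u: "w = gword_class (dihedral_rels m) u" using assms(1) by (rule dih_cases)
  have step: "dih_letter_index m a x = lperm m a x" if "x \<in> {0..<int m}" for a x
    using that by (cases "(m, a)" rule: lperm.cases) (simp_all add: dperm_def)
  have range: "wperm m v r \<in> {0..<int m}" for v
    using wperm_sym[of m v] assms(2) unfolding letter_sym_def by blast
  have idx: "foldr (dih_letter_index m) v (r mod int m) = wperm m v r" for v
    by (induction v) (use assms(2) step range in simp_all)
  have "(\<lambda>v. foldr (dih_letter_index m) v (r mod int m)) ` w = (\<lambda>_. wperm m u r) ` w"
    by (rule image_cong[OF HOL.refl]) (simp add: idx u gword_class_def wperm_respects)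
  also have "\<dots> = {wperm m u r}"
    using gword_class_self[of u] by (auto simp: u)
  finally show ?thesis by (simp add: dih_index_def u cperm_class)
qed

text \<open>As substitution into coefficient functions, \<open>ren\<close> reverses composition;
  passing to the inverse gives a left action.\<close>

definition sact :: "nat \<Rightarrow> dihedral_gen gword set \<Rightarrow> (int, 'k::field) ncs \<Rightarrow> (int, 'k) ncs" where
  "sact m w = ren (cperm m (inv\<^bsub>dihedral m\<^esub> w))"

lemma sact_sym:
  "w \<in> carrier (dihedral m) \<Longrightarrow> letter_sym {0..<int m} (cperm m (inv\<^bsub>dihedral m\<^esub> w)) (cperm m w)"
  by (rule cperm_sym)

lemma sact_simps:
  "sact m w (f + g) = sact m w f + sact m w g" "sact m w (f - g) = sact m w f - sact m w g"
  "sact m w 0 = 0" "sact m w 1 = 1" "sact m w (- f) = - sact m w f"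
  "sact m w (scl c f) = scl c (sact m w f)" "sact m w (f * g) = sact m w f * sact m w g"
  by (simp_all add: sact_def ren_simps)

lemma sact_sum: "sact m w (sum F A) = (\<Sum>i\<in>A. sact m w (F i))"
  by (simp add: sact_def ren_sum)

lemma coeff_sact_Nil [simp]: "coeff (sact m w f) [] = coeff f []"
  by (simp add: sact_def)

lemma sact_grp: "w \<in> carrier (dihedral m) \<Longrightarrow> g \<in> grp {0..<int m} \<Longrightarrow> sact m w g \<in> grp {0..<int m}"
  unfolding sact_def by (rule grp_ren[OF sact_sym])

lemma sact_mult_group:
  assumes "w \<in> carrier (dihedral m)" "w' \<in> carrier (dihedral m)"
  shows "sact m (w \<otimes>\<^bsub>dihedral m\<^esub> w') f = sact m w (sact m w' f)"
proof -
  interpret group "dihedral m" by (rule dihedral_group)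
  show ?thesis using assms by (simp add: sact_def ren_simps inv_mult_group cperm_mult)
qed

lemma sact_one [simp]: "sact m \<one>\<^bsub>dihedral m\<^esub> f = f"
proof -
  interpret group "dihedral m" by (rule dihedral_group)
  show ?thesis by (simp only: sact_def inv_one cperm_one ren_simps)
qed

lemma sact_ginv: "coeff f [] = 1 \<Longrightarrow> sact m w (ginv f) = ginv (sact m w f)"
  unfolding sact_def by (rule ren_ginv)

lemma dih_act_sact:
  "w \<in> carrier (dihedral m) \<Longrightarrow> dih_act m w (PsiA m f) = PsiA m (sact m w f)"
  unfolding sact_def by (rule dih_act_PsiA[OF sact_sym dih_index_cperm])

section \<open>The semidirect product, its group-like elements, and maps out of group
  algebras\<close>

section \<open>The semidirect product\<close>

lemma PsiA_cong_sum:
  "(\<And>i. i \<in> I \<Longrightarrow> PsiA m (F i) = PsiA m (G i)) \<Longrightarrow> PsiA m (sum F I) = PsiA m (sum G I)"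
  by (induction I rule: infinite_finite_induct) (simp_all add: PsiA_add[symmetric])

lemma PsiA_cong_mult:
  "PsiA m f = PsiA m f' \<Longrightarrow> PsiA m g = PsiA m g' \<Longrightarrow> PsiA m (f * g) = PsiA m (f' * g')"
  by (simp add: PsiA_mult[symmetric])

lemma PsiA_cong_scl: "PsiA m f = PsiA m f' \<Longrightarrow> PsiA m (scl c f) = PsiA m (scl c f')"
  by (simp add: PsiA_scl[symmetric])

text \<open>The laws are inherited from series through the surjectivity of \<open>PsiA\<close>; they
  make finite sums in the completion available.\<close>

lemma Acal_abelian_monoid: "abelian_monoid (Acal m :: ('k::field, 'k Ahol) module)"
proof (rule abelian_monoidI)
  fix x y z :: "'k Ahol"
  assume "x \<in> carrier (Acal m)" "y \<in> carrier (Acal m)" "z \<in> carrier (Acal m)"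
  then obtain f g h where "x = PsiA m f" "y = PsiA m g" "z = PsiA m h" by (metis PsiA_surj)
  then show "x \<oplus>\<^bsub>Acal m\<^esub> y \<oplus>\<^bsub>Acal m\<^esub> z = x \<oplus>\<^bsub>Acal m\<^esub> (y \<oplus>\<^bsub>Acal m\<^esub> z)"
    by (simp add: PsiA_add add.assoc)
next
  fix x y :: "'k Ahol"
  assume "x \<in> carrier (Acal m)" "y \<in> carrier (Acal m)"
  then obtain f g where "x = PsiA m f" "y = PsiA m g" by (metis PsiA_surj)
  then show "x \<oplus>\<^bsub>Acal m\<^esub> y = y \<oplus>\<^bsub>Acal m\<^esub> x" "x \<oplus>\<^bsub>Acal m\<^esub> y \<in> carrier (Acal m)"
    by (simp_all add: PsiA_add add.commute)
next
  fix x :: "'k Ahol"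
  assume "x \<in> carrier (Acal m)"
  then obtain f where "x = PsiA m f" by (metis PsiA_surj)
  then show "\<zero>\<^bsub>Acal m\<^esub> \<oplus>\<^bsub>Acal m\<^esub> x = x" by (simp add: PsiA_add PsiA_zero)
qed (simp add: PsiA_zero)

lemma PsiA_finsum: "(\<Oplus>\<^bsub>Acal m\<^esub>i\<in>I. PsiA m (F i)) = (PsiA m (sum F I) :: 'k::field Ahol)"
proof -
  interpret abelian_monoid "Acal m :: ('k, 'k Ahol) module" by (rule Acal_abelian_monoid)
  show ?thesis
    by (induction I rule: infinite_finite_induct) (simp_all add: finsum_infinite PsiA_add PsiA_zero)
qed

text \<open>Elements of the semidirect product are represented by families of series, unique up to
  equality under \<open>PsiA\<close>.\<close>

definition Theta :: "nat \<Rightarrow> (dihedral_gen gword set \<Rightarrow> (int, 'k::field) ncs) \<Rightarrow> 'k Bhol" where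
  "Theta m F = (\<lambda>w\<in>carrier (dihedral m). PsiA m (F w))"

lemma Theta_closed: "Theta m F \<in> carrier (Bcal m)"
  by (simp add: Theta_def Bcal_def semidirect_algebra_def)

lemma Theta_surj:
  assumes "f \<in> carrier (Bcal m)"
  obtains F where "f = Theta m F"
proof -
  have f: "f \<in> carrier (dihedral m) \<rightarrow>\<^sub>E carrier (Acal m)"
    using assms by (simp add: Bcal_def semidirect_algebra_def)
  have "\<forall>w\<in>carrier (dihedral m). \<exists>a. f w = PsiA m a"
    using f by (metis PiE_mem PsiA_surj)
  then obtain F where F: "\<And>w. w \<in> carrier (dihedral m) \<Longrightarrow> f w = PsiA m (F w)" by metis
  have "f = Theta m F"
  proof
    fix w
    show "f w = Theta m F w"
      by (cases "w \<in> carrier (dihedral m)") (simp_all add: Theta_def F PiE_arb[OF f])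
  qed
  then show ?thesis by (rule that)
qed

lemma Theta_eqI:
  "(\<And>w. w \<in> carrier (dihedral m) \<Longrightarrow> PsiA m (F w) = PsiA m (G w)) \<Longrightarrow> Theta m F = Theta m G"
  unfolding Theta_def by (rule restrict_ext)

lemma Theta_eqD: "Theta m F = Theta m G \<Longrightarrow> w \<in> carrier (dihedral m) \<Longrightarrow> PsiA m (F w) = PsiA m (G w)"
  by (drule fun_cong[of _ _ w]) (simp add: Theta_def)

lemma Theta_add: "Theta m F \<oplus>\<^bsub>Bcal m\<^esub> Theta m G = Theta m (\<lambda>w. F w + G w)"
  unfolding Theta_def Bcal_def semidirect_algebra_def by (simp add: PsiA_add cong: restrict_cong)

lemma Theta_scl: "c \<odot>\<^bsub>Bcal m\<^esub> Theta m F = Theta m (\<lambda>w. scl c (F w))"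
  unfolding Theta_def Bcal_def semidirect_algebra_def by (simp add: PsiA_scl cong: restrict_cong)

lemma Theta_mult:
  "Theta m F \<otimes>\<^bsub>Bcal m\<^esub> Theta m G =
    Theta m (\<lambda>w. \<Sum>u\<in>carrier (dihedral m). F u * sact m u (G (inv\<^bsub>dihedral m\<^esub> u \<otimes>\<^bsub>dihedral m\<^esub> w)))"
proof -
  interpret D: group "dihedral m" by (rule dihedral_group)
  interpret A: abelian_monoid "Acal m :: ('a, 'a Ahol) module" by (rule Acal_abelian_monoid)
  have "(\<Oplus>\<^bsub>Acal m\<^esub>u\<in>carrier (dihedral m). Theta m F u \<otimes>\<^bsub>Acal m\<^esub> dih_act m u (Theta m G (inv\<^bsub>dihedral m\<^esub> u \<otimes>\<^bsub>dihedral m\<^esub> w)))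
      = (\<Oplus>\<^bsub>Acal m\<^esub>u\<in>carrier (dihedral m). PsiA m (F u * sact m u (G (inv\<^bsub>dihedral m\<^esub> u \<otimes>\<^bsub>dihedral m\<^esub> w))))"
    if "w \<in> carrier (dihedral m)" for w
    by (rule A.finsum_cong'[OF HOL.refl]) (simp_all add: that Theta_def dih_act_sact PsiA_mult)
  then show ?thesis
    by (simp add: Bcal_def semidirect_algebra_def PsiA_finsum) (simp add: Theta_def cong: restrict_cong)
qed

text \<open>The monomial a w, with its coefficient on the left of the group element.\<close>

definition bel :: "nat \<Rightarrow> (int, 'k::field) ncs \<Rightarrow> dihedral_gen gword set \<Rightarrow> 'k Bhol" where
  "bel m a w = Theta m (\<lambda>v. if v = w then a else 0)"

lemma bel_cong: "PsiA m a = PsiA m b \<Longrightarrow> bel m a w = bel m b w"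
  unfolding bel_def by (rule Theta_eqI) simp

lemma Bcal_one: "\<one>\<^bsub>Bcal m\<^esub> = bel m 1 \<one>\<^bsub>dihedral m\<^esub>"
  unfolding bel_def Theta_def Bcal_def semidirect_algebra_def
  by (simp, rule restrict_ext) (simp add: PsiA_one PsiA_zero)

lemma Bcal_A_bel: "Bcal_A m (PsiA m a) = bel m a \<one>\<^bsub>dihedral m\<^esub>"
  unfolding bel_def Theta_def Bcal_A_def semidirect_alg_elem_def
  by (rule restrict_ext) (simp add: PsiA_zero)

lemma Bcal_W_bel: "Bcal_W m w = bel m 1 w"
  unfolding bel_def Theta_def Bcal_W_def semidirect_group_elem_def
  by (rule restrict_ext) (simp add: PsiA_zero PsiA_one)

locale dihedral_setting =
  fixes m :: nat
  assumes m_pos: "m > 0"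
begin

sublocale D: group "dihedral m" by (rule dihedral_group)

abbreviation "W \<equiv> dihedral m"

lemma W_finite: "finite (carrier W)"
  by (rule dihedral_finite[OF m_pos])

lemma Theta_bel:
  assumes "w \<in> carrier W"
  shows "Theta m F \<otimes>\<^bsub>Bcal m\<^esub> bel m b w
    = Theta m (\<lambda>v. F (v \<otimes>\<^bsub>W\<^esub> inv\<^bsub>W\<^esub> w) * sact m (v \<otimes>\<^bsub>W\<^esub> inv\<^bsub>W\<^esub> w) b)"
  unfolding bel_def Theta_mult
proof (rule Theta_eqI)
  fix v assume v: "v \<in> carrier W"
  have "(\<Sum>u\<in>carrier W. F u * sact m u (if inv\<^bsub>W\<^esub> u \<otimes>\<^bsub>W\<^esub> v = w then b else 0))
      = (\<Sum>u\<in>carrier W. if u = v \<otimes>\<^bsub>W\<^esub> inv\<^bsub>W\<^esub> w then F u * sact m u b else 0)"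
  proof (rule sum.cong[OF HOL.refl])
    fix u assume u: "u \<in> carrier W"
    have "inv\<^bsub>W\<^esub> u \<otimes>\<^bsub>W\<^esub> v = w \<longleftrightarrow> u = v \<otimes>\<^bsub>W\<^esub> inv\<^bsub>W\<^esub> w"
      using u v assms by (metis D.inv_closed D.inv_solve_left D.inv_solve_right)
    then show "F u * sact m u (if inv\<^bsub>W\<^esub> u \<otimes>\<^bsub>W\<^esub> v = w then b else 0)
        = (if u = v \<otimes>\<^bsub>W\<^esub> inv\<^bsub>W\<^esub> w then F u * sact m u b else 0)"
      by (simp add: sact_simps)
  qed
  also have "\<dots> = F (v \<otimes>\<^bsub>W\<^esub> inv\<^bsub>W\<^esub> w) * sact m (v \<otimes>\<^bsub>W\<^esub> inv\<^bsub>W\<^esub> w) b"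
    using W_finite v assms by (simp add: sum.delta)
  finally show "PsiA m (\<Sum>u\<in>carrier W. F u * sact m u (if inv\<^bsub>W\<^esub> u \<otimes>\<^bsub>W\<^esub> v = w then b else 0))
      = PsiA m (F (v \<otimes>\<^bsub>W\<^esub> inv\<^bsub>W\<^esub> w) * sact m (v \<otimes>\<^bsub>W\<^esub> inv\<^bsub>W\<^esub> w) b)"
    by simp
qed

lemma bel_mult:
  assumes "w \<in> carrier W" "w' \<in> carrier W"
  shows "bel m a w \<otimes>\<^bsub>Bcal m\<^esub> bel m b w' = bel m (a * sact m w b) (w \<otimes>\<^bsub>W\<^esub> w')"
  unfolding bel_def[of m a w] Theta_bel[OF assms(2)] unfolding bel_def
proof (rule Theta_eqI)
  fix v assume "v \<in> carrier W"
  then have eq: "v \<otimes>\<^bsub>W\<^esub> inv\<^bsub>W\<^esub> w' = w \<longleftrightarrow> v = w \<otimes>\<^bsub>W\<^esub> w'"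
    using assms by (metis D.inv_solve_right)
  show "PsiA m ((if v \<otimes>\<^bsub>W\<^esub> inv\<^bsub>W\<^esub> w' = w then a else 0) * sact m (v \<otimes>\<^bsub>W\<^esub> inv\<^bsub>W\<^esub> w') b)
      = PsiA m (if v = w \<otimes>\<^bsub>W\<^esub> w' then a * sact m w b else 0)"
    unfolding eq[symmetric] by simp
qed

text \<open>The inverse is a definite description over the whole carrier, so uniqueness is shown for
  an arbitrary y. Comparing coefficients at v in y g = 1 gives y_v v(g) = 1 or 0, and v(g) is
  invertible.\<close>

lemma Bcal_A_inverse:
  assumes "coeff g [] = 1"
  shows "inv\<^bsub>Bcal m\<^esub> (bel m g \<one>\<^bsub>W\<^esub>) = bel m (ginv g) \<one>\<^bsub>W\<^esub>"
  unfolding m_inv_def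
proof (rule the_equality)
  show "bel m (ginv g) \<one>\<^bsub>W\<^esub> \<in> carrier (Bcal m) \<and>
      bel m g \<one>\<^bsub>W\<^esub> \<otimes>\<^bsub>Bcal m\<^esub> bel m (ginv g) \<one>\<^bsub>W\<^esub> = \<one>\<^bsub>Bcal m\<^esub> \<and>
      bel m (ginv g) \<one>\<^bsub>W\<^esub> \<otimes>\<^bsub>Bcal m\<^esub> bel m g \<one>\<^bsub>W\<^esub> = \<one>\<^bsub>Bcal m\<^esub>"
    by (simp add: bel_mult Bcal_one ginv_left[OF assms] ginv_right[OF assms]) (simp add: bel_def Theta_closed)
next
  fix y
  assume y: "y \<in> carrier (Bcal m) \<and> bel m g \<one>\<^bsub>W\<^esub> \<otimes>\<^bsub>Bcal m\<^esub> y = \<one>\<^bsub>Bcal m\<^esub> \<and> y \<otimes>\<^bsub>Bcal m\<^esub> bel m g \<one>\<^bsub>W\<^esub> = \<one>\<^bsub>Bcal m\<^esub>"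
  then obtain F where F: "y = Theta m F" using Theta_surj by blast
  have "Theta m (\<lambda>v. F (v \<otimes>\<^bsub>W\<^esub> inv\<^bsub>W\<^esub> \<one>\<^bsub>W\<^esub>) * sact m (v \<otimes>\<^bsub>W\<^esub> inv\<^bsub>W\<^esub> \<one>\<^bsub>W\<^esub>) g) = bel m 1 \<one>\<^bsub>W\<^esub>"
    using y by (simp add: F Theta_bel Bcal_one)
  note eq = Theta_eqD[OF this[unfolded bel_def]]
  show "y = bel m (ginv g) \<one>\<^bsub>W\<^esub>"
    unfolding F bel_def
  proof (rule Theta_eqI)
    fix v assume v: "v \<in> carrier W"
    have g: "coeff (sact m v g) [] = 1" using assms by simp
    have "PsiA m (F v * sact m v g) = PsiA m (if v = \<one>\<^bsub>W\<^esub> then 1 else 0)"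
      using eq[OF v] v by simp
    then have "PsiA m (F v * sact m v g * ginv (sact m v g)) = PsiA m ((if v = \<one>\<^bsub>W\<^esub> then 1 else 0) * ginv (sact m v g))"
      by (rule PsiA_cong_mult) simp
    then show "PsiA m (F v) = PsiA m (if v = \<one>\<^bsub>W\<^esub> then ginv g else 0)"
      by (simp add: mult.assoc ginv_right[OF g] split: if_splits)
  qed
qed

subsection \<open>The group of grouplike elements\<close>

abbreviation "X \<equiv> {0..<int m}"

text \<open>The target of the group morphism. On monomials whose coefficient comes from a group-like
  series, the group laws reduce to those of W and of series.\<close>

definition glike :: "'k::field_char_0 Bhol monoid" where
  "glike = \<lparr>carrier = {bel m a w | a w. a \<in> grp X \<and> w \<in> carrier W}, mult = mult (Bcal m), one = one (Bcal m)\<rparr>"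

lemma glike_cases:
  assumes "x \<in> carrier glike"
  obtains a w where "x = bel m a w" "a \<in> grp X" "w \<in> carrier W"
  using assms unfolding glike_def by auto

lemma glike_carrier: "a \<in> grp X \<Longrightarrow> w \<in> carrier W \<Longrightarrow> bel m a w \<in> carrier glike"
  unfolding glike_def by auto

lemma glike_mult: "w \<in> carrier W \<Longrightarrow> w' \<in> carrier W \<Longrightarrow>
    bel m a w \<otimes>\<^bsub>glike\<^esub> bel m b w' = bel m (a * sact m w b) (w \<otimes>\<^bsub>W\<^esub> w')"
  by (simp add: glike_def bel_mult)

lemma glike_one: "\<one>\<^bsub>glike\<^esub> = bel m 1 \<one>\<^bsub>W\<^esub>"
  by (simp add: glike_def Bcal_one)

lemma glike_group: "group (glike :: 'k::field_char_0 Bhol monoid)"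
proof (rule groupI)
  fix x y z :: "'k Bhol"
  assume "x \<in> carrier glike" "y \<in> carrier glike" "z \<in> carrier glike"
  then obtain a w b u c v where
    "x = bel m a w" "w \<in> carrier W" "y = bel m b u" "u \<in> carrier W" "z = bel m c v" "v \<in> carrier W"
    by (metis glike_cases)
  then show "x \<otimes>\<^bsub>glike\<^esub> y \<otimes>\<^bsub>glike\<^esub> z = x \<otimes>\<^bsub>glike\<^esub> (y \<otimes>\<^bsub>glike\<^esub> z)"
    by (simp add: glike_mult D.m_assoc sact_mult_group sact_simps mult.assoc)
next
  fix x y :: "'k Bhol"
  assume "x \<in> carrier glike" "y \<in> carrier glike"
  then obtain a w b u where
    "x = bel m a w" "a \<in> grp X" "w \<in> carrier W" "y = bel m b u" "b \<in> grp X" "u \<in> carrier W"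
    by (metis glike_cases)
  then show "x \<otimes>\<^bsub>glike\<^esub> y \<in> carrier glike"
    by (simp add: glike_mult glike_carrier grp_mult sact_grp)
next
  fix x :: "'k Bhol"
  assume "x \<in> carrier glike"
  then obtain a w where x: "x = bel m a w" "a \<in> grp X" "w \<in> carrier W" by (metis glike_cases)
  then show "\<one>\<^bsub>glike\<^esub> \<otimes>\<^bsub>glike\<^esub> x = x"
    by (simp add: glike_one glike_mult)
  let ?w = "inv\<^bsub>W\<^esub> w"
  have "sact m ?w (ginv a) * sact m ?w a = 1"
    using ginv_left[OF grp_Nil[OF x(2)]] by (simp add: sact_simps(7)[symmetric] sact_simps(4))
  then have "bel m (sact m ?w (ginv a)) ?w \<otimes>\<^bsub>glike\<^esub> x = \<one>\<^bsub>glike\<^esub>"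
    using x by (simp add: glike_mult glike_one)
  then show "\<exists>y\<in>carrier glike. y \<otimes>\<^bsub>glike\<^esub> x = \<one>\<^bsub>glike\<^esub>"
    using x by (intro bexI[of _ "bel m (sact m ?w (ginv a)) ?w"]) (simp_all add: glike_carrier sact_grp grp_ginv)
qed (simp add: glike_one glike_carrier)

text \<open>The counit of the coefficient is 1, so the component at w is nonzero; this determines
  w.\<close>

lemma bel_inject:
  assumes "bel m a w = bel m b v" "coeff a [] = (1 :: 'k::field)" "w \<in> carrier W"
  shows "w = v \<and> PsiA m a = PsiA m b"
proof -
  have eq: "PsiA m a = PsiA m (if w = v then b else 0)"
    using Theta_eqD[OF assms(1)[unfolded bel_def] assms(3)] by simp
  have "w = v"
  proof (rule ccontr)
    assume "w \<noteq> v"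
    then have "Acal_counit m (PsiA m a) = Acal_counit m (PsiA m 0 :: 'k Ahol)" using eq by simp
    then show False using assms(2) by (simp add: Acal_counit_PsiA)
  qed
  then show ?thesis using eq by simp
qed

lemma Acal_tensor_zero:
  shows "Acal_tensor m (PsiA m 0) (PsiA m b) = (\<lambda>n. \<zero>\<^bsub>UUg m :: ('k::field, 'k UUhol) module\<^esub>)"
    and "Acal_tensor m (PsiA m b) (PsiA m 0) = (\<lambda>n. \<zero>\<^bsub>UUg m :: ('k::field, 'k UUhol) module\<^esub>)"
proof -
  interpret UU: kalgebra "UUg m :: ('k, 'k UUhol) module"
    unfolding UUg_def by (rule tensor_kalgebra)
  have "(\<Oplus>\<^bsub>UUg m\<^esub>i\<in>{..n}. pure_tensor (Ug m) (Ug m) (Psi m i 0) (Psi m (n - i) b)) = \<zero>\<^bsub>UUg m :: ('k, 'k UUhol) module\<^esub>"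
    "(\<Oplus>\<^bsub>UUg m\<^esub>i\<in>{..n}. pure_tensor (Ug m) (Ug m) (Psi m i b) (Psi m (n - i) 0)) = \<zero>\<^bsub>UUg m :: ('k, 'k UUhol) module\<^esub>" for n
    by (rule UU.add.finprod_one_eqI;
        simp add: Psi_zero UUg_def pure_tensor_zero[OF Ug_kalgebra Ug_kalgebra Psi_closed])+
  then show "Acal_tensor m (PsiA m 0) (PsiA m b) = (\<lambda>n. \<zero>\<^bsub>UUg m :: ('k::field, 'k UUhol) module\<^esub>)"
    "Acal_tensor m (PsiA m b) (PsiA m 0) = (\<lambda>n. \<zero>\<^bsub>UUg m :: ('k::field, 'k UUhol) module\<^esub>)"
    by (simp_all add: Acal_tensor_def PsiA_def)
qed

lemma Acal_coproduct_zero: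
  "Acal_coproduct m (PsiA m 0) = (\<lambda>n. \<zero>\<^bsub>UUg m :: ('k::field_char_0, 'k UUhol) module\<^esub>)"
  using alg_hom_zero[OF Ug_kalgebra tensor_kalgebra coproduct_hom[of m, where ?'k = 'k]]
  by (simp add: Acal_coproduct_def PsiA_def Psi_zero UUg_def)

text \<open>The coproduct of a w is that of a times w \<otimes> w, so both sides vanish off the
  diagonal of W and agree on it because a is group-like.\<close>

lemma glike_grouplike:
  assumes "x \<in> carrier (glike :: 'k::field_char_0 Bhol monoid)"
  shows "x \<in> Bcal_grouplike m"
proof -
  obtain a w where x: "x = bel m a w" "a \<in> grp X" "w \<in> carrier W" using assms by (rule glike_cases)
  have val: "x v = PsiA m (if v = w then a else 0)" if "v \<in> carrier W" for v
    using that by (simp add: x bel_def Theta_def)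
  have g: "Acal_coproduct m (PsiA m a) = Acal_tensor m (PsiA m a) (PsiA m a)"
    using PsiA_grouplike[OF x(2)] by (simp add: Acal_grouplike_def)
  have "Bcal_counit m x = (\<Sum>v\<in>carrier W. if v = w then 1 else 0)"
    unfolding Bcal_counit_def
    by (rule sum.cong[OF HOL.refl]) (simp add: val Acal_counit_PsiA grp_Nil[OF x(2)])
  then have "Bcal_counit m x = 1" using W_finite x(3) by (simp add: sum.delta)
  moreover have "Bcal_coproduct m x = Bcal_tensor m x x"
    unfolding Bcal_coproduct_def Bcal_tensor_def
  proof (rule restrict_ext)
    fix p assume "p \<in> carrier W \<times> carrier W"
    then show "(case p of (w, w') \<Rightarrow> if w = w' then Acal_coproduct m (x w) else (\<lambda>n. \<zero>\<^bsub>UUg m\<^esub>))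
        = (case p of (w, w') \<Rightarrow> Acal_tensor m (x w) (x w'))"
      by (auto simp: val g Acal_coproduct_zero Acal_tensor_zero)
  qed
  moreover have "x \<in> carrier (Bcal m)"
    by (simp add: x bel_def Theta_closed)
  ultimately show ?thesis by (simp add: Bcal_grouplike_def)
qed

subsection \<open>Morphisms from a group algebra\<close>

text \<open>The linear extension of the map sending b to the monomial with coefficient
  \<open>a b\<close> and group element \<open>t b\<close>, sorted by group elements.\<close>

definition lin_ext :: "('b \<Rightarrow> (int, 'k::field) ncs) \<Rightarrow> ('b \<Rightarrow> dihedral_gen gword set) \<Rightarrow> ('b \<Rightarrow> 'k) \<Rightarrow> 'k Bhol" where
  "lin_ext a t f = Theta m (\<lambda>w. \<Sum>b | f b \<noteq> 0. if t b = w then scl (f b) (a b) else 0)"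

lemma lin_ext_superset:
  assumes "finite S" "{b. f b \<noteq> 0} \<subseteq> S"
  shows "lin_ext a t f = Theta m (\<lambda>w. \<Sum>b\<in>S. if t b = w then scl (f b) (a b) else 0)"
proof -
  have "(\<Sum>b | f b \<noteq> 0. if t b = w then scl (f b) (a b) else 0)
      = (\<Sum>b\<in>S. if t b = w then scl (f b) (a b) else 0)" for w
    using assms by (intro sum.mono_neutral_left) (auto simp: scl_simps)
  then show ?thesis by (simp add: lin_ext_def)
qed

lemma lin_ext_group_elem: "lin_ext a t (group_elem b) = bel m (a b) (t b)"
proof -
  have "lin_ext a t (group_elem b) = Theta m (\<lambda>w. \<Sum>c\<in>{b}. if t c = w then scl (group_elem b c) (a c) else 0)"
    by (rule lin_ext_superset) (auto simp: group_elem_def)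
  then show ?thesis
    by (simp add: group_elem_def scl_simps bel_def eq_commute[of "t b"] cong: if_cong)
qed

lemma lin_ext_add:
  assumes "finite {b. f b \<noteq> 0}" "finite {b. f' b \<noteq> 0}"
  shows "lin_ext a t (\<lambda>x. f x + f' x) = lin_ext a t f \<oplus>\<^bsub>Bcal m\<^esub> lin_ext a t f'"
proof -
  let ?S = "{b. f b \<noteq> 0} \<union> {b. f' b \<noteq> 0}"
  have S: "finite ?S" using assms by simp
  have "lin_ext a t (\<lambda>x. f x + f' x) = Theta m (\<lambda>w. \<Sum>b\<in>?S. if t b = w then scl (f b + f' b) (a b) else 0)"
    by (rule lin_ext_superset[OF S]) auto
  moreover have "lin_ext a t f = Theta m (\<lambda>w. \<Sum>b\<in>?S. if t b = w then scl (f b) (a b) else 0)"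
    by (rule lin_ext_superset[OF S]) auto
  moreover have "lin_ext a t f' = Theta m (\<lambda>w. \<Sum>b\<in>?S. if t b = w then scl (f' b) (a b) else 0)"
    by (rule lin_ext_superset[OF S]) auto
  ultimately show ?thesis
    by (simp add: Theta_add sum.distrib[symmetric] scl_simps if_distrib cong: if_cong)
qed

lemma lin_ext_smult:
  assumes "finite {b. f b \<noteq> 0}"
  shows "lin_ext a t (\<lambda>x. c * f x) = c \<odot>\<^bsub>Bcal m\<^esub> lin_ext a t f"
proof -
  have "lin_ext a t (\<lambda>x. c * f x) = Theta m (\<lambda>w. \<Sum>b | f b \<noteq> 0. if t b = w then scl (c * f b) (a b) else 0)"
    by (rule lin_ext_superset[OF assms]) auto
  also have "\<dots> = Theta m (\<lambda>w. scl c (\<Sum>b | f b \<noteq> 0. if t b = w then scl (f b) (a b) else 0))"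
    by (rule arg_cong[where f = "Theta m"]) (auto intro!: ext sum.cong simp: scl_simps scl_sum)
  finally show ?thesis by (simp add: lin_ext_def Theta_scl)
qed

text \<open>Both sides become sums over pairs from the two supports. Multiplicativity of the
  coefficients is assumed only after evaluation, because the series \<open>a b\<close> are chosen
  preimages.\<close>

lemma lin_ext_mult:
  fixes G :: "'b monoid" and a :: "'b \<Rightarrow> (int, 'k::field) ncs"
  assumes G: "group G"
    and t: "\<And>b. b \<in> carrier G \<Longrightarrow> t b \<in> carrier W"
    and t_mult: "\<And>b c. b \<in> carrier G \<Longrightarrow> c \<in> carrier G \<Longrightarrow> t (b \<otimes>\<^bsub>G\<^esub> c) = t b \<otimes>\<^bsub>W\<^esub> t c"
    and a_mult: "\<And>b c. b \<in> carrier G \<Longrightarrow> c \<in> carrier G \<Longrightarrow>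
      PsiA m (a (b \<otimes>\<^bsub>G\<^esub> c)) = PsiA m (a b * sact m (t b) (a c))"
    and f: "f \<in> carrier (group_algebra G)" and f': "f' \<in> carrier (group_algebra G)"
  shows "lin_ext a t (f \<otimes>\<^bsub>group_algebra G\<^esub> f') = lin_ext a t f \<otimes>\<^bsub>Bcal m\<^esub> lin_ext a t f'"
proof -
  interpret G: group G by fact
  define S where "S = {b. f b \<noteq> 0}"
  define S' where "S' = {b. f' b \<noteq> 0}"
  have S: "finite S" "S \<subseteq> carrier G" and S': "finite S'" "S' \<subseteq> carrier G"
    using f f' by (auto simp: group_algebra_def S_def S'_def)
  define P where "P = (\<lambda>(b, c). b \<otimes>\<^bsub>G\<^esub> c) ` (S \<times> S')"
  let ?h = "f \<otimes>\<^bsub>group_algebra G\<^esub> f'"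
  have h: "?h x = (\<Sum>(b, c) | (b, c) \<in> S \<times> S' \<and> b \<otimes>\<^bsub>G\<^esub> c = x. f b * f' c)" for x
    by (simp add: group_algebra_def S_def S'_def)
  have hS: "{x. ?h x \<noteq> 0} \<subseteq> P"
  proof
    fix x assume "x \<in> {x. ?h x \<noteq> 0}"
    then have "{(b, c). (b, c) \<in> S \<times> S' \<and> b \<otimes>\<^bsub>G\<^esub> c = x} \<noteq> {}"
      unfolding h by (metis (mono_tags, lifting) mem_Collect_eq sum.empty case_prod_eta)
    then show "x \<in> P" by (force simp: P_def)
  qed
  have finP: "finite P" using S S' by (simp add: P_def)
  have R1: "lin_ext a t f = Theta m (\<lambda>w. \<Sum>b\<in>S. if t b = w then scl (f b) (a b) else 0)"
    by (rule lin_ext_superset[OF S(1)]) (simp add: S_def)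
  have R2: "lin_ext a t f' = Theta m (\<lambda>w. \<Sum>b\<in>S'. if t b = w then scl (f' b) (a b) else 0)"
    by (rule lin_ext_superset[OF S'(1)]) (simp add: S'_def)
  have L: "lin_ext a t ?h = Theta m (\<lambda>w. \<Sum>x\<in>P. if t x = w then scl (?h x) (a x) else 0)"
    by (rule lin_ext_superset[OF finP hS])
  show ?thesis
    unfolding L R1 R2 Theta_mult
  proof (rule Theta_eqI)
    fix w assume w: "w \<in> carrier W"
    let ?g = "\<lambda>(b, c). if t (b \<otimes>\<^bsub>G\<^esub> c) = w then scl (f b * f' c) (a (b \<otimes>\<^bsub>G\<^esub> c)) else 0"
    let ?k = "\<lambda>(b, c). if t b \<otimes>\<^bsub>W\<^esub> t c = w then scl (f b * f' c) (a b * sact m (t b) (a c)) else 0"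
    have "(\<Sum>x\<in>P. if t x = w then scl (?h x) (a x) else 0)
        = (\<Sum>x\<in>P. \<Sum>p\<in>{p \<in> S \<times> S'. (\<lambda>(b, c). b \<otimes>\<^bsub>G\<^esub> c) p = x}. ?g p)"
    proof (rule sum.cong[OF HOL.refl])
      fix x
      have hx: "?h x = (\<Sum>(b, c)\<in>{p \<in> S \<times> S'. (\<lambda>(b, c). b \<otimes>\<^bsub>G\<^esub> c) p = x}. f b * f' c)"
        unfolding h by (rule sum.cong) auto
      have scl_sum_left: "scl (\<Sum>i\<in>I. q i) r = (\<Sum>i\<in>I. scl (q i) r)" for I and q :: "'b \<times> 'b \<Rightarrow> 'k" and r :: "(int, 'k) ncs"
        by (induction I rule: infinite_finite_induct) (simp_all add: scl_simps)
      show "(if t x = w then scl (?h x) (a x) else 0) = (\<Sum>p\<in>{p \<in> S \<times> S'. (\<lambda>(b, c). b \<otimes>\<^bsub>G\<^esub> c) p = x}. ?g p)"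
      proof (cases "t x = w")
        case True
        then show ?thesis unfolding hx scl_sum_left if_P[OF True] by (intro sum.cong) auto
      next
        case False
        then show ?thesis unfolding if_not_P[OF False] by (intro sum.neutral[symmetric]) auto
      qed
    qed
    also have "\<dots> = (\<Sum>p\<in>S \<times> S'. ?g p)"
      unfolding P_def by (rule sum.image_gen[symmetric]) (use S S' in simp)
    finally have left: "(\<Sum>x\<in>P. if t x = w then scl (?h x) (a x) else 0) = (\<Sum>p\<in>S \<times> S'. ?g p)" .
    \<comment> \<open>For fixed u only the b with t b = u contribute, and the condition on c then
      says that t b times t c is w.\<close>
    have "(\<Sum>u\<in>carrier W. (\<Sum>b\<in>S. if t b = u then scl (f b) (a b) else 0) *
          sact m u (\<Sum>c\<in>S'. if t c = inv\<^bsub>W\<^esub> u \<otimes>\<^bsub>W\<^esub> w then scl (f' c) (a c) else 0))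
        = (\<Sum>u\<in>carrier W. \<Sum>b\<in>S. if t b = u then (\<Sum>c\<in>S'. ?k (b, c)) else 0)"
    proof (rule sum.cong[OF HOL.refl])
      fix u assume u: "u \<in> carrier W"
      have "(if t b = u then scl (f b) (a b) else 0) *
          sact m u (\<Sum>c\<in>S'. if t c = inv\<^bsub>W\<^esub> u \<otimes>\<^bsub>W\<^esub> w then scl (f' c) (a c) else 0)
          = (if t b = u then (\<Sum>c\<in>S'. ?k (b, c)) else 0)" if b: "b \<in> S" for b
      proof (cases "t b = u")
        case True
        have "t c = inv\<^bsub>W\<^esub> u \<otimes>\<^bsub>W\<^esub> w \<longleftrightarrow> t b \<otimes>\<^bsub>W\<^esub> t c = w" if "c \<in> S'" for c
        proof -
          have "t c \<in> carrier W" using that S'(2) t by blast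
          then show ?thesis using u w True by (metis D.inv_closed D.inv_solve_left)
        qed
        then have "sact m u (\<Sum>c\<in>S'. if t c = inv\<^bsub>W\<^esub> u \<otimes>\<^bsub>W\<^esub> w then scl (f' c) (a c) else 0)
            = (\<Sum>c\<in>S'. if t b \<otimes>\<^bsub>W\<^esub> t c = w then scl (f' c) (sact m u (a c)) else 0)"
          unfolding sact_sum by (intro sum.cong[OF HOL.refl]) (simp add: sact_simps)
        also have "scl (f b) (a b) * \<dots> = (\<Sum>c\<in>S'. ?k (b, c))"
          unfolding sum_distrib_left
          by (intro sum.cong[OF HOL.refl]) (simp add: True mult_scl_left mult_scl_right scl_simps)
        finally show ?thesis using True by simp
      qed simp
      then show "(\<Sum>b\<in>S. if t b = u then scl (f b) (a b) else 0) *
          sact m u (\<Sum>c\<in>S'. if t c = inv\<^bsub>W\<^esub> u \<otimes>\<^bsub>W\<^esub> w then scl (f' c) (a c) else 0)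
          = (\<Sum>b\<in>S. if t b = u then (\<Sum>c\<in>S'. ?k (b, c)) else 0)"
        unfolding sum_distrib_right by (rule sum.cong[OF HOL.refl])
    qed
    also have "\<dots> = (\<Sum>b\<in>S. \<Sum>u\<in>carrier W. if t b = u then (\<Sum>c\<in>S'. ?k (b, c)) else 0)"
      by (rule sum.swap)
    also have "\<dots> = (\<Sum>b\<in>S. \<Sum>c\<in>S'. ?k (b, c))"
      using W_finite S t by (intro sum.cong[OF HOL.refl]) (auto simp: sum.delta')
    also have "\<dots> = (\<Sum>p\<in>S \<times> S'. ?k p)"
      by (simp add: sum.cartesian_product)
    finally have right: "(\<Sum>u\<in>carrier W. (\<Sum>b\<in>S. if t b = u then scl (f b) (a b) else 0) *
          sact m u (\<Sum>c\<in>S'. if t c = inv\<^bsub>W\<^esub> u \<otimes>\<^bsub>W\<^esub> w then scl (f' c) (a c) else 0))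
        = (\<Sum>p\<in>S \<times> S'. ?k p)" .
    show "PsiA m (\<Sum>x\<in>P. if t x = w then scl (?h x) (a x) else 0)
        = PsiA m (\<Sum>u\<in>carrier W. (\<Sum>b\<in>S. if t b = u then scl (f b) (a b) else 0) *
          sact m u (\<Sum>c\<in>S'. if t c = inv\<^bsub>W\<^esub> u \<otimes>\<^bsub>W\<^esub> w then scl (f' c) (a c) else 0))"
      unfolding left right
    proof (rule PsiA_cong_sum)
      fix p assume "p \<in> S \<times> S'"
      then obtain b c where p: "p = (b, c)" "b \<in> carrier G" "c \<in> carrier G" using S S' by auto
      show "PsiA m (?g p) = PsiA m (?k p)"
        using PsiA_cong_scl[OF a_mult[OF p(2,3)], of "f b * f' c"]
        unfolding p(1) case_prod_conv t_mult[OF p(2,3)] by (simp split: if_split)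
    qed
  qed
qed

text \<open>The universal property of the group algebra. A coefficient and a group element are
  chosen for each value of \<rho>; \<open>bel_inject\<close> turns multiplicativity of \<rho> into
  relations between these choices.\<close>

theorem group_hom_extends:
  fixes G :: "'b monoid"
  assumes G: "group G" and \<rho>: "\<rho> \<in> hom G (glike :: 'k::field_char_0 Bhol monoid)"
  shows "\<exists>\<Phi> \<in> alg_hom (group_algebra G) (Bcal m). \<forall>b\<in>carrier G. \<Phi> (group_elem b) = \<rho> b"
proof -
  interpret G: group G by fact
  interpret H: group "glike :: 'k Bhol monoid" by (rule glike_group)
  have "\<forall>b\<in>carrier G. \<exists>a w. \<rho> b = bel m a w \<and> a \<in> grp X \<and> w \<in> carrier W"
    using \<rho> by (metis glike_cases hom_in_carrier)
  then obtain a t where at: "\<And>b. b \<in> carrier G \<Longrightarrow> \<rho> b = bel m (a b) (t b)"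
    "\<And>b. b \<in> carrier G \<Longrightarrow> a b \<in> grp X" "\<And>b. b \<in> carrier G \<Longrightarrow> t b \<in> carrier W"
    by metis
  have mult: "t (b \<otimes>\<^bsub>G\<^esub> c) = t b \<otimes>\<^bsub>W\<^esub> t c \<and> PsiA m (a (b \<otimes>\<^bsub>G\<^esub> c)) = PsiA m (a b * sact m (t b) (a c))"
    if "b \<in> carrier G" "c \<in> carrier G" for b c
  proof (rule bel_inject)
    have "\<rho> (b \<otimes>\<^bsub>G\<^esub> c) = \<rho> b \<otimes>\<^bsub>glike\<^esub> \<rho> c" using \<rho> that by (simp add: hom_mult)
    then show "bel m (a (b \<otimes>\<^bsub>G\<^esub> c)) (t (b \<otimes>\<^bsub>G\<^esub> c)) = bel m (a b * sact m (t b) (a c)) (t b \<otimes>\<^bsub>W\<^esub> t c)"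
      using that by (simp add: at glike_mult)
    show "coeff (a (b \<otimes>\<^bsub>G\<^esub> c)) [] = 1" "t (b \<otimes>\<^bsub>G\<^esub> c) \<in> carrier W"
      using that grp_Nil[OF at(2)] at(3) by simp_all
  qed
  let ?\<Phi> = "lin_ext a t"
  have elem: "?\<Phi> (group_elem b) = \<rho> b" if "b \<in> carrier G" for b
    using that by (simp add: lin_ext_group_elem at)
  have one: "\<one>\<^bsub>group_algebra G\<^esub> = (group_elem \<one>\<^bsub>G\<^esub> :: 'b \<Rightarrow> 'k)"
    by (simp add: group_algebra_def group_elem_def)
  have "\<rho> \<one>\<^bsub>G\<^esub> = \<one>\<^bsub>Bcal m\<^esub>"
    using hom_one[OF \<rho> G glike_group] by (simp add: glike_def)
  moreover have "?\<Phi> f \<in> carrier (Bcal m)" for f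
    by (simp add: lin_ext_def Theta_closed)
  moreover have "?\<Phi> (f \<oplus>\<^bsub>group_algebra G\<^esub> f') = ?\<Phi> f \<oplus>\<^bsub>Bcal m\<^esub> ?\<Phi> f'"
    if "f \<in> carrier (group_algebra G)" "f' \<in> carrier (group_algebra G)" for f f'
    using lin_ext_add[of f f' a t] that by (simp add: group_algebra_def)
  moreover have "?\<Phi> (c \<odot>\<^bsub>group_algebra G\<^esub> f) = c \<odot>\<^bsub>Bcal m\<^esub> ?\<Phi> f"
    if "f \<in> carrier (group_algebra G)" for c f
    using lin_ext_smult[of f a t c] that by (simp add: group_algebra_def)
  moreover have "?\<Phi> (f \<otimes>\<^bsub>group_algebra G\<^esub> f') = ?\<Phi> f \<otimes>\<^bsub>Bcal m\<^esub> ?\<Phi> f'"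
    if "f \<in> carrier (group_algebra G)" "f' \<in> carrier (group_algebra G)" for f f'
    by (rule lin_ext_mult[OF G at(3) _ _ that]) (use mult in auto)
  ultimately have "?\<Phi> \<in> alg_hom (group_algebra G) (Bcal m)"
    unfolding alg_hom_def ring_hom_def using elem[OF G.one_closed] one by simp
  then show ?thesis using elem by blast
qed

end

section \<open>The braid relation and the resulting morphism\<close>

section \<open>The braid relation\<close>

context group
begin

lemma word_eval_alternating_even:
  assumes "range \<phi> \<subseteq> carrier G"
  shows "word_eval \<phi> (alternating (2 * p) (x, True) (y, True)) = (\<phi> x \<otimes> \<phi> y) [^] p"
proof (induction p)
  case (Suc p)
  have "\<phi> x \<in> carrier G" "\<phi> y \<in> carrier G" using assms by auto
  then show ?case
    using Suc nat_pow_Suc2[of "\<phi> x \<otimes> \<phi> y" p] by (simp add: m_assoc)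
qed simp

lemma word_eval_alternating_odd:
  assumes "range \<phi> \<subseteq> carrier G"
  shows "word_eval \<phi> (alternating (Suc (2 * p)) (x, True) (y, True)) = (\<phi> x \<otimes> \<phi> y) [^] p \<otimes> \<phi> x"
proof (induction p)
  case 0
  have "\<phi> x \<in> carrier G" using assms by auto
  then show ?case by simp
next
  case (Suc p)
  have "\<phi> x \<in> carrier G" "\<phi> y \<in> carrier G" using assms by auto
  then show ?case
    using Suc nat_pow_Suc2[of "\<phi> x \<otimes> \<phi> y" p] by (simp add: m_assoc)
qed

lemma pow_conjugate:
  assumes "x \<in> carrier G" "y \<in> carrier G"
  shows "x \<otimes> (y \<otimes> x) [^] (p::nat) = (x \<otimes> y) [^] p \<otimes> x"
proof (induction p)
  case (Suc p)
  have "x \<otimes> (y \<otimes> x) [^] Suc p = (x \<otimes> (y \<otimes> x) [^] p) \<otimes> (y \<otimes> x)"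
    using assms by (simp add: m_assoc)
  also have "\<dots> = (x \<otimes> y) [^] p \<otimes> (x \<otimes> y) \<otimes> x"
    unfolding Suc using assms by (simp add: m_assoc)
  finally show ?case using assms by simp
qed (use assms in simp)

lemma braid_even:
  assumes "x \<in> carrier G" "y \<in> carrier G" "(x \<otimes> y) [^] (p::nat) \<otimes> x = x \<otimes> (x \<otimes> y) [^] p"
  shows "(x \<otimes> y) [^] p = (y \<otimes> x) [^] p"
  using pow_conjugate[OF assms(1,2), of p] assms by simp

text \<open>Here Y stands for x y, so \<open>inv x \<otimes> Y\<close> is y and the conclusion is
  the braid relation of length m. It results from the hypothesis on squares by cancelling Y^p on the
  left.\<close>

lemma braid_odd:
  assumes x: "x \<in> carrier G" and Y: "Y \<in> carrier G" and p: "m = Suc (2 * p)"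
    and D: "(Y [^] p \<otimes> x) \<otimes> (Y [^] p \<otimes> x) = Y [^] m"
  shows "inv x \<otimes> Y \<otimes> Y [^] p = Y [^] p \<otimes> x"
proof -
  have "Y [^] p \<otimes> (x \<otimes> (Y [^] p \<otimes> x)) = Y [^] (p + Suc p)"
    using D x Y by (simp add: p m_assoc mult_2)
  also have "\<dots> = Y [^] p \<otimes> (Y \<otimes> Y [^] p)"
    unfolding nat_pow_mult[OF Y, symmetric] nat_pow_Suc2[OF Y] ..
  finally have "Y [^] p \<otimes> (x \<otimes> (Y [^] p \<otimes> x)) = Y [^] p \<otimes> (Y \<otimes> Y [^] p)" .
  then have "x \<otimes> (Y [^] p \<otimes> x) = Y \<otimes> Y [^] p"
    using x Y by simp
  then show ?thesis
    using x Y by (metis inv_solve_left m_assoc m_closed nat_pow_closed inv_closed)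
qed

end

context dihedral_setting
begin

text \<open>Centrality is meant in the completed enveloping algebra, so the products of series are
  compared after evaluation.\<close>

definition central :: "(int, 'k::field_char_0) ncs \<Rightarrow> bool" where
  "central f \<longleftrightarrow> (\<forall>h. PsiA m (f * h) = PsiA m (h * f))"

lemma centralD: "central f \<Longrightarrow> PsiA m (f * h) = PsiA m (h * f)"
  by (simp add: central_def)

lemma central_power: "central f \<Longrightarrow> central (f ^ k)"
proof (induction k)
  case (Suc k)
  show ?case
    unfolding central_def
  proof
    fix h
    have "PsiA m (f * (f ^ k * h)) = PsiA m (f * (h * f ^ k))"
      by (rule PsiA_cong_mult[OF HOL.refl centralD[OF Suc.IH[OF Suc.prems]]])
    also have "\<dots> = PsiA m ((h * f ^ k) * f)"
      by (rule centralD[OF Suc.prems])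
    finally show "PsiA m (f ^ Suc k * h) = PsiA m (h * f ^ Suc k)"
      by (simp add: mult.assoc power_commutes)
  qed
qed (simp add: central_def)

lemma central_scl: "central f \<Longrightarrow> central (scl c f)"
  unfolding central_def mult_scl_left mult_scl_right by (blast intro: PsiA_cong_scl)

lemma central_sum: "(\<And>i. i \<in> I \<Longrightarrow> central (F i)) \<Longrightarrow> central (sum F I)"
  unfolding central_def sum_distrib_left sum_distrib_right by (blast intro: PsiA_cong_sum)

lemma central_tsum: "central (tsum m)"
  by (simp add: central_def PsiA_tsum_comm)

lemma central_ncexp:
  assumes "central f" "f \<in> order_ge (Suc 0)"
  shows "central (ncexp f)"
  unfolding central_def
proof (intro allI ext)
  fix h n
  let ?S = "\<Sum>k\<le>n. scl (1 / fact k) (f ^ k)"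
  have e: "ncexp f - ?S \<in> order_ge (Suc n)"
    using ncexp_approx[OF assms(2), of n] by simp
  have S: "PsiA m (?S * h) = PsiA m (h * ?S)"
    by (intro centralD central_sum central_scl central_power assms(1))
  have "ncexp f * h - ?S * h \<in> order_ge (Suc n)" "h * ncexp f - h * ?S \<in> order_ge (Suc n)"
    using order_ge_mult_right[OF e] order_ge_mult_left[OF e] by (simp_all add: left_diff_distrib right_diff_distrib)
  then have "Psi m n (ncexp f * h) = Psi m n (?S * h)" "Psi m n (h * ncexp f) = Psi m n (h * ?S)"
    by (auto intro!: Psi_cong simp: order_ge_def)
  then show "PsiA m (ncexp f * h) n = PsiA m (h * ncexp f) n"
    using fun_cong[OF S, of n] by (simp add: PsiA_def)
qed

lemma tsum_order: "scl c (tsum m) \<in> order_ge (Suc 0)"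
  by (simp add: order_ge_Suc_0_iff tsum_def)

definition cexp :: "'k \<Rightarrow> (int, 'k::field_char_0) ncs" where
  "cexp c = ncexp (scl c (tsum m))"

lemma central_cexp: "central (cexp c ^ k)"
  unfolding cexp_def by (intro central_power central_ncexp central_scl central_tsum tsum_order)

lemma grp_cexp: "cexp c \<in> grp X"
  unfolding cexp_def by (intro grp_ncexp[of _ "Suc 0"] lie.scl lie_tsum)

lemma sact_cexp: "w \<in> carrier W \<Longrightarrow> sact m w (cexp c ^ k) = cexp c ^ k"
  unfolding cexp_def sact_def by (simp only: ren_power ren_ncexp ren_simps(6) ren_tsum[OF sact_sym])

text \<open>The series exp(c T) is W-invariant, so its powers and those of u are collected
  separately.\<close>

lemma bel_cexp_power:
  assumes "u \<in> carrier W"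
  shows "bel m (cexp c ^ j) u [^]\<^bsub>glike\<^esub> (k::nat) = bel m (cexp c ^ (j * k)) (u [^]\<^bsub>W\<^esub> k)"
proof (induction k)
  case 0
  interpret H: group "glike :: 'a Bhol monoid" by (rule glike_group)
  show ?case by (simp add: glike_one)
next
  case (Suc k)
  interpret H: group "glike :: 'a Bhol monoid" by (rule glike_group)
  show ?case
    using assms by (simp add: Suc glike_mult sact_cexp power_add[symmetric] add.commute)
qed

text \<open>This is \<open>g (w exp(t\<^sub>r)) g\<inverse>\<close> with its coefficient moved to the left of \<open>w\<close>.\<close>

definition ref_elem :: "(int, 'k::field_char_0) ncs \<Rightarrow> dihedral_gen gword set \<Rightarrow> int \<Rightarrow> 'k Bhol" where
  "ref_elem g w r = bel m (g * sact m w (ncexp (var r) * ginv g)) w"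

lemma ref_elem_glike:
  assumes "g \<in> grp X" "w \<in> carrier W" "0 \<le> r" "r < int m"
  shows "ref_elem g w r \<in> carrier glike"
  unfolding ref_elem_def using assms
  by (intro glike_carrier grp_mult sact_grp grp_ginv grp_ncexp[of _ "Suc 0"] lie.var) auto

lemma ref_elem_conjugate:
  fixes g :: "(int, 'k::field_char_0) ncs"
  assumes "g \<in> grp X" "w \<in> carrier W" "0 \<le> r" "r < int m"
  shows "ref_elem g w r = Bcal_A m (PsiA m g)
    \<otimes>\<^bsub>Bcal m\<^esub> (Bcal_W m w \<otimes>\<^bsub>Bcal m\<^esub> Bcal_A m (Acal_exp m (1 \<odot>\<^bsub>Acal m\<^esub> Acal_t m r)))
    \<otimes>\<^bsub>Bcal m\<^esub> inv\<^bsub>Bcal m\<^esub> (Bcal_A m (PsiA m g))"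
proof -
  have "Acal_exp m (1 \<odot>\<^bsub>Acal m\<^esub> Acal_t m r) = (PsiA m (ncexp (var r)) :: 'k Ahol)"
    using assms by (simp add: PsiA_var PsiA_scl scl_simps PsiA_exp order_ge_Suc_0_iff)
  then show ?thesis
    using assms
    by (simp add: Bcal_A_bel Bcal_W_bel Bcal_A_inverse grp_Nil bel_mult ref_elem_def sact_simps mult.assoc)
qed

abbreviation "s \<equiv> dih_s m"
abbreviation "\<omega> \<equiv> dih_omega m"

text \<open>This reduces the theorem to the braid relation between two elements of
  \<open>glike\<close>: the presentation of the Artin group then gives a group morphism, and linear
  extension the algebra morphism.\<close>

lemma hopf_morphism_exists:
  assumes g: "g \<in> grp X" and h: "h \<in> grp X" and m3: "m \<ge> 3"
    and braid: "\<And>\<phi> :: artin_gen \<Rightarrow> 'k::field_char_0 Bhol.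
      \<phi> Gen_sigma = ref_elem g s 0 \<Longrightarrow> \<phi> Gen_tau = ref_elem h (\<omega> \<otimes>\<^bsub>W\<^esub> s) 1 \<Longrightarrow>
      range \<phi> \<subseteq> carrier glike \<Longrightarrow>
      group.word_eval glike \<phi> (alternating m (Gen_sigma, True) (Gen_tau, True))
        = group.word_eval glike \<phi> (alternating m (Gen_tau, True) (Gen_sigma, True))"
  shows "\<exists>\<Phi> :: (artin_gen gword set \<Rightarrow> 'k) \<Rightarrow> 'k Bhol. \<Phi> \<in> hopf_morphisms m \<and> fundamental_condition m \<Phi>"
proof -
  interpret H: group "glike :: 'k Bhol monoid" by (rule glike_group)
  have r: "(0::int) < int m" "(1::int) < int m" using m3 by auto
  define \<phi> where "\<phi> x = (case x of Gen_sigma \<Rightarrow> ref_elem g s 0 | Gen_tau \<Rightarrow> ref_elem h (\<omega> \<otimes>\<^bsub>W\<^esub> s) 1)" for x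
  have \<phi>: "range \<phi> \<subseteq> carrier glike"
  proof (rule image_subsetI)
    fix x
    show "\<phi> x \<in> carrier glike"
      using g h r by (cases x) (simp_all add: \<phi>_def ref_elem_glike)
  qed
  have rel: "H.word_eval \<phi> l = H.word_eval \<phi> q" if "(l, q) \<in> artin_rels m" for l q
    using that braid[of \<phi>] \<phi> by (simp add: artin_rels_def) (simp add: \<phi>_def)
  obtain \<rho> where \<rho>: "\<rho> \<in> hom (artin m) glike" "\<And>u. \<rho> (gword_class (artin_rels m) u) = H.word_eval \<phi> u"
    using H.presented_group_hom[OF \<phi> rel] unfolding artin_def by blast
  have art: "group (artin m)" unfolding artin_def by (rule presented_group_group)
  obtain \<Phi> where \<Phi>: "\<Phi> \<in> alg_hom (group_algebra (artin m)) (Bcal m)"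
    "\<And>b. b \<in> carrier (artin m) \<Longrightarrow> \<Phi> (group_elem b) = \<rho> b"
    using group_hom_extends[OF art \<rho>(1)] by blast
  have "\<Phi> \<in> hopf_morphisms m"
    unfolding hopf_morphisms_def using \<Phi> hom_in_carrier[OF \<rho>(1)] by (auto intro: glike_grouplike)
  moreover have "\<Phi> (group_elem (art_sigma m)) = ref_elem g s 0" "\<Phi> (group_elem (art_tau m)) = ref_elem h (\<omega> \<otimes>\<^bsub>W\<^esub> s) 1"
  proof -
    have c: "art_sigma m \<in> carrier (artin m)" "art_tau m \<in> carrier (artin m)"
      by (simp_all add: art_sigma_def art_tau_def artin_def gword_class_carrier)
    have "\<phi> Gen_sigma \<in> carrier glike" "\<phi> Gen_tau \<in> carrier glike" using \<phi> by auto
    then show "\<Phi> (group_elem (art_sigma m)) = ref_elem g s 0" "\<Phi> (group_elem (art_tau m)) = ref_elem h (\<omega> \<otimes>\<^bsub>W\<^esub> s) 1"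
      unfolding \<Phi>(2)[OF c(1)] \<Phi>(2)[OF c(2)] unfolding art_sigma_def art_tau_def \<rho>(2)
      by (simp_all add: \<phi>_def)
  qed
  \<comment> \<open>Both constants of the fundamental condition are 1.\<close>
  ultimately show ?thesis
    unfolding fundamental_condition_def
    using ref_elem_conjugate[OF g _ _ r(1), of s] ref_elem_conjugate[OF h _ _ r(2), of "\<omega> \<otimes>\<^bsub>W\<^esub> s"]
      PsiA_grouplike[OF g] PsiA_grouplike[OF h]
    by (intro exI[of _ \<Phi>] conjI exI[of _ "1::'k"] bexI[of _ "PsiA m g"] bexI[of _ "PsiA m h"]) simp_all
qed

lemma s_s_cancel: "x \<in> carrier W \<Longrightarrow> s \<otimes>\<^bsub>W\<^esub> (s \<otimes>\<^bsub>W\<^esub> x) = x"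
  by (simp add: D.m_assoc[symmetric] dih_s_square)

lemma s_omega_power: "s \<otimes>\<^bsub>W\<^esub> \<omega> [^]\<^bsub>W\<^esub> (k::nat) = inv\<^bsub>W\<^esub> \<omega> [^]\<^bsub>W\<^esub> k \<otimes>\<^bsub>W\<^esub> s"
proof (induction k)
  case (Suc k)
  have "s \<otimes>\<^bsub>W\<^esub> \<omega> [^]\<^bsub>W\<^esub> Suc k = (s \<otimes>\<^bsub>W\<^esub> \<omega> [^]\<^bsub>W\<^esub> k) \<otimes>\<^bsub>W\<^esub> \<omega>"
    by (simp add: D.m_assoc)
  also have "\<dots> = inv\<^bsub>W\<^esub> \<omega> [^]\<^bsub>W\<^esub> k \<otimes>\<^bsub>W\<^esub> (inv\<^bsub>W\<^esub> \<omega> \<otimes>\<^bsub>W\<^esub> s)"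
    by (simp add: Suc D.m_assoc dih_s_omega)
  finally show ?case by (simp add: D.m_assoc)
qed simp

lemma omega_inv_power: "inv\<^bsub>W\<^esub> \<omega> [^]\<^bsub>W\<^esub> (k::nat) = inv\<^bsub>W\<^esub> (\<omega> [^]\<^bsub>W\<^esub> k)"
  by (simp add: D.nat_pow_inv)

lemma s_inv_omega_power: "s \<otimes>\<^bsub>W\<^esub> inv\<^bsub>W\<^esub> \<omega> [^]\<^bsub>W\<^esub> (k::nat) = \<omega> [^]\<^bsub>W\<^esub> k \<otimes>\<^bsub>W\<^esub> s"
proof -
  have "s \<otimes>\<^bsub>W\<^esub> (s \<otimes>\<^bsub>W\<^esub> \<omega> [^]\<^bsub>W\<^esub> k) \<otimes>\<^bsub>W\<^esub> s = s \<otimes>\<^bsub>W\<^esub> (inv\<^bsub>W\<^esub> \<omega> [^]\<^bsub>W\<^esub> k \<otimes>\<^bsub>W\<^esub> s) \<otimes>\<^bsub>W\<^esub> s"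
    by (simp only: s_omega_power)
  then show ?thesis
    by (simp add: s_s_cancel D.m_assoc dih_s_square)
qed

lemma cperm_s: "cperm m s = dperm m (- 1) 0"
  using cperm_class[of m "[(Gen_s, True)]"] by (simp add: dih_s_def)

lemma cperm_omega_power: "cperm m (\<omega> [^]\<^bsub>W\<^esub> (k::nat)) = dperm m 1 (2 * int k)"
  unfolding dih_omega_power cperm_class by (rule wperm_omega)

lemma cperm_omega: "cperm m \<omega> = dperm m 1 2"
  using cperm_omega_power[of 1] by simp

lemma sact_s: "sact m s = ren (dperm m (- 1) 0)"
  by (simp add: sact_def dih_inv_s cperm_s)

lemma refl_square: "(\<omega> \<otimes>\<^bsub>W\<^esub> s) \<otimes>\<^bsub>W\<^esub> (\<omega> \<otimes>\<^bsub>W\<^esub> s) = \<one>\<^bsub>W\<^esub>"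
proof -
  have "(\<omega> \<otimes>\<^bsub>W\<^esub> s) \<otimes>\<^bsub>W\<^esub> (\<omega> \<otimes>\<^bsub>W\<^esub> s) = \<omega> \<otimes>\<^bsub>W\<^esub> ((s \<otimes>\<^bsub>W\<^esub> \<omega>) \<otimes>\<^bsub>W\<^esub> s)"
    by (simp add: D.m_assoc)
  also have "\<dots> = \<one>\<^bsub>W\<^esub>"
    by (simp add: dih_s_omega D.m_assoc dih_s_square)
  finally show ?thesis .
qed

lemma sact_refl: "sact m (\<omega> \<otimes>\<^bsub>W\<^esub> s) = ren (dperm m (- 1) 2)"
proof -
  have "inv\<^bsub>W\<^esub> (\<omega> \<otimes>\<^bsub>W\<^esub> s) = \<omega> \<otimes>\<^bsub>W\<^esub> s"
    by (rule D.inv_equality[OF refl_square]) simp_all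
  then have "cperm m (inv\<^bsub>W\<^esub> (\<omega> \<otimes>\<^bsub>W\<^esub> s)) = dperm m (- 1) 2"
    by (simp add: cperm_mult cperm_s cperm_omega dperm_comp)
  then show ?thesis by (simp add: sact_def)
qed

lemma refl_fixes_t1:
  assumes "m \<ge> 3"
  shows "sact m (\<omega> \<otimes>\<^bsub>W\<^esub> s) (ncexp (var 1)) = (ncexp (var 1) :: (int, 'k::field_char_0) ncs)"
proof -
  have "ren (dperm m (- 1) 2) (var 1) = (var 1 :: (int, 'k) ncs)"
    using ren_dperm_var[of "- 1" m 2 1] assms by (simp add: dperm_def)
  then show ?thesis by (simp add: sact_refl ren_ncexp)
qed

lemma sact_cancel_square: "w \<in> carrier W \<Longrightarrow> w \<otimes>\<^bsub>W\<^esub> w = \<one>\<^bsub>W\<^esub> \<Longrightarrow> sact m w (sact m w f) = f"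
  by (simp add: sact_mult_group[symmetric])

theorem even_case:
  assumes m3: "m \<ge> 3" and p: "m = 2 * p"
  shows "\<exists>\<Phi> :: (artin_gen gword set \<Rightarrow> 'k::field_char_0) \<Rightarrow> 'k Bhol. \<Phi> \<in> hopf_morphisms m \<and> fundamental_condition m \<Phi>"
proof -
  interpret H: group "glike :: 'k Bhol monoid" by (rule glike_group)
  define E :: "(int, 'k) ncs" where "E = cexp (1 / of_nat p)"
  let ?s' = "\<omega> \<otimes>\<^bsub>W\<^esub> s"
  have "sact m s (E ^ 1) = E ^ 1"
    unfolding E_def by (rule sact_cexp) simp
  then have E_fix: "sact m s E = E" by simp
  obtain g h\<^sub>0 where g: "g \<in> grp X" and h\<^sub>0: "h\<^sub>0 \<in> grp X" and
    eq: "sact m s g * ncexp (var 0) * ginv g * sact m ?s' h\<^sub>0 * ncexp (var 1) * ginv h\<^sub>0 = E"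
    using even_dihedral_equation[OF m3 p, where ?'k = 'k] unfolding sact_s sact_refl E_def cexp_def by blast
  \<comment> \<open>The coefficient of \<open>ref_elem h ?s' 1\<close> is h s'(exp(t_1) h^-1). Since
    s' is an involution fixing t_1, this choice of h turns it into the second half of the solved
    equation.\<close>
  define h where "h = sact m ?s' h\<^sub>0"
  have h: "h \<in> grp X" unfolding h_def by (rule sact_grp[OF _ h\<^sub>0]) simp
  let ?x = "ref_elem g s 0" and ?y = "ref_elem h ?s' 1"
  have xy: "?x \<in> carrier glike" "?y \<in> carrier glike"
    using g h m3 by (simp_all add: ref_elem_glike)
  have "sact m ?s' (ginv h) = ginv h\<^sub>0"
    unfolding h_def sact_ginv[OF grp_Nil[OF h\<^sub>0], symmetric]
    by (rule sact_cancel_square) (simp_all add: refl_square)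
  then have y: "?y = bel m (sact m ?s' h\<^sub>0 * ncexp (var 1) * ginv h\<^sub>0) ?s'"
    by (simp add: ref_elem_def sact_simps refl_fixes_t1[OF m3] mult.assoc) (simp add: h_def)
  have "s \<otimes>\<^bsub>W\<^esub> ?s' = inv\<^bsub>W\<^esub> \<omega>"
    by (simp add: D.m_assoc[symmetric] dih_s_omega) (simp add: D.m_assoc dih_s_square)
  \<comment> \<open>The coefficient of the product is s applied to the left side of the solved
    equation, hence s(E) = E.\<close>
  moreover have "g * sact m s (ncexp (var 0) * ginv g) * sact m s (sact m ?s' h\<^sub>0 * ncexp (var 1) * ginv h\<^sub>0) = E"
  proof -
    have "sact m s (sact m s g * ncexp (var 0) * ginv g * sact m ?s' h\<^sub>0 * ncexp (var 1) * ginv h\<^sub>0) = E"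
      unfolding eq by (rule E_fix)
    then show ?thesis
      by (simp add: sact_simps sact_cancel_square dih_s_square mult.assoc)
  qed
  ultimately have prod: "?x \<otimes>\<^bsub>glike\<^esub> ?y = bel m (E ^ 1) (inv\<^bsub>W\<^esub> \<omega>)"
    unfolding y by (simp add: ref_elem_def glike_mult)
  let ?v = "inv\<^bsub>W\<^esub> \<omega> [^]\<^bsub>W\<^esub> p"
  have power: "(?x \<otimes>\<^bsub>glike\<^esub> ?y) [^]\<^bsub>glike\<^esub> p = bel m (E ^ p) ?v"
    unfolding prod E_def by (subst bel_cexp_power) simp_all
  \<comment> \<open>As \<omega>^(2 p) = 1, the power \<omega>^-p equals \<omega>^p and commutes with
    s; it shifts indices by 2 p = m, so it acts trivially.\<close>
  have "\<omega> [^]\<^bsub>W\<^esub> p \<otimes>\<^bsub>W\<^esub> \<omega> [^]\<^bsub>W\<^esub> p = \<one>\<^bsub>W\<^esub>"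
    using dih_omega_order[of m] D.nat_pow_mult[OF dih_omega_carrier, of p p]
    by (simp only: p[symmetric] mult_2[symmetric])
  then have v: "?v = \<omega> [^]\<^bsub>W\<^esub> p"
    unfolding omega_inv_power by (intro D.inv_equality) simp_all
  have sv: "s \<otimes>\<^bsub>W\<^esub> ?v = ?v \<otimes>\<^bsub>W\<^esub> s"
    using s_omega_power[of p] by (simp only: v)
  have act: "sact m ?v f = f" for f :: "(int, 'k) ncs"
  proof -
    have "dperm m 1 (2 * int p) = id"
      using dperm_cong[of "2 * int p" m 0 1] by (simp add: p dperm_id)
    then show ?thesis
      unfolding omega_inv_power sact_def by (simp add: cperm_omega_power ren_simps(10))
  qed
  have comm: "bel m (E ^ p) ?v \<otimes>\<^bsub>glike\<^esub> ?x = ?x \<otimes>\<^bsub>glike\<^esub> bel m (E ^ p) ?v"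
    using bel_cong[OF centralD[OF central_cexp[of "1 / of_nat p" p]]]
    by (simp add: ref_elem_def glike_mult act sv sact_cexp E_def)
  show ?thesis
  proof (rule hopf_morphism_exists[OF g h m3])
    fix \<phi> :: "artin_gen \<Rightarrow> 'k Bhol"
    assume \<phi>: "\<phi> Gen_sigma = ?x" "\<phi> Gen_tau = ?y" "range \<phi> \<subseteq> carrier glike"
    have "(?x \<otimes>\<^bsub>glike\<^esub> ?y) [^]\<^bsub>glike\<^esub> p = (?y \<otimes>\<^bsub>glike\<^esub> ?x) [^]\<^bsub>glike\<^esub> p"
      by (rule H.braid_even[OF xy]) (simp only: power comm)
    then show "H.word_eval \<phi> (alternating m (Gen_sigma, True) (Gen_tau, True))
        = H.word_eval \<phi> (alternating m (Gen_tau, True) (Gen_sigma, True))"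
      using H.word_eval_alternating_even[OF \<phi>(3), of p] by (simp only: p[symmetric] \<phi>(1,2))
  qed
qed

theorem odd_case:
  assumes m3: "m \<ge> 3" and p: "m = Suc (2 * p)"
  shows "\<exists>\<Phi> :: (artin_gen gword set \<Rightarrow> 'k::field_char_0) \<Rightarrow> 'k Bhol. \<Phi> \<in> hopf_morphisms m \<and> fundamental_condition m \<Phi>"
proof -
  interpret H: group "glike :: 'k Bhol monoid" by (rule glike_group)
  define E :: "(int, 'k) ncs" where "E = cexp (1 / of_nat m)"
  let ?s' = "\<omega> \<otimes>\<^bsub>W\<^esub> s" and ?v = "inv\<^bsub>W\<^esub> \<omega> [^]\<^bsub>W\<^esub> p"
  \<comment> \<open>The element (\<sigma>\<tau>)^p \<sigma> lies over this reflection.\<close>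
  define w where "w = ?v \<otimes>\<^bsub>W\<^esub> s"
  have wW [simp]: "w \<in> carrier W" by (simp add: w_def)
  have sv: "s \<otimes>\<^bsub>W\<^esub> ?v = \<omega> [^]\<^bsub>W\<^esub> p \<otimes>\<^bsub>W\<^esub> s" by (rule s_inv_omega_power)
  have ww: "w \<otimes>\<^bsub>W\<^esub> w = \<one>\<^bsub>W\<^esub>"
  proof -
    have "w \<otimes>\<^bsub>W\<^esub> w = ?v \<otimes>\<^bsub>W\<^esub> ((s \<otimes>\<^bsub>W\<^esub> ?v) \<otimes>\<^bsub>W\<^esub> s)" by (simp add: w_def D.m_assoc)
    also have "\<dots> = ?v \<otimes>\<^bsub>W\<^esub> \<omega> [^]\<^bsub>W\<^esub> p" unfolding sv by (simp add: D.m_assoc dih_s_square)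
    finally show ?thesis by (simp add: omega_inv_power)
  qed
  have ws: "w \<otimes>\<^bsub>W\<^esub> s = ?v" by (simp add: w_def D.m_assoc dih_s_square)
  have v_omega: "?v = \<omega> [^]\<^bsub>W\<^esub> Suc p"
  proof -
    have "\<omega> [^]\<^bsub>W\<^esub> Suc p \<otimes>\<^bsub>W\<^esub> \<omega> [^]\<^bsub>W\<^esub> p = \<one>\<^bsub>W\<^esub>"
      using dih_omega_order[of m] by (simp only: D.nat_pow_mult[OF dih_omega_carrier]) (simp add: p mult_2)
    then show ?thesis unfolding omega_inv_power by (intro D.inv_equality) simp_all
  qed
  have s'w: "?s' \<otimes>\<^bsub>W\<^esub> w = w \<otimes>\<^bsub>W\<^esub> s"
  proof -
    have "?s' \<otimes>\<^bsub>W\<^esub> w = \<omega> \<otimes>\<^bsub>W\<^esub> ((s \<otimes>\<^bsub>W\<^esub> ?v) \<otimes>\<^bsub>W\<^esub> s)" by (simp add: w_def D.m_assoc)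
    also have "\<dots> = \<omega> \<otimes>\<^bsub>W\<^esub> \<omega> [^]\<^bsub>W\<^esub> p" unfolding sv by (simp add: D.m_assoc dih_s_square)
    also have "\<dots> = \<omega> [^]\<^bsub>W\<^esub> Suc p" by (rule D.nat_pow_Suc2[symmetric]) simp
    finally show ?thesis by (simp only: ws v_omega)
  qed
  \<comment> \<open>As \<omega>^-p = \<omega>^(p + 1) shifts indices by 2 p + 2 = m + 1, it is the
    rotation by one step, and w acts by r -> 1 - r.\<close>
  have cperm_v: "cperm m ?v = dperm m 1 1"
    unfolding v_omega cperm_omega_power by (rule dperm_cong) (simp add: p mod_eq_dvd_iff)
  have sact_w: "sact m w = ren (dperm m (- 1) 1)"
  proof -
    have "inv\<^bsub>W\<^esub> w = w" by (rule D.inv_equality[OF ww]) simp_all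
    moreover have "cperm m w = dperm m (- 1) 1"
      by (simp add: w_def cperm_mult cperm_v cperm_s dperm_comp)
    ultimately show ?thesis by (simp add: sact_def)
  qed
  obtain g h\<^sub>0 where g: "g \<in> grp X" and h\<^sub>0: "h\<^sub>0 \<in> grp X" and
    eq: "sact m s g * ncexp (var 0) * ginv g * sact m w h\<^sub>0 * ginv h\<^sub>0 = E"
    using odd_dihedral_equation[OF m3, where ?'k = 'k] unfolding sact_s sact_w E_def cexp_def by blast
  have E_fix: "sact m u (E ^ k) = E ^ k" if "u \<in> carrier W" for u k
    unfolding E_def by (rule sact_cexp[OF that])
  have E_central: "central (E ^ k)" for k
    unfolding E_def by (rule central_cexp)
  \<comment> \<open>With this coefficient d w is the conjugate of w exp(T) by w(h_0): E^m is exp(T),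
    and h_0^-1 w = w w(h_0)^-1.\<close>
  define d where "d = E ^ m * sact m w h\<^sub>0 * ginv h\<^sub>0"
  have d: "d \<in> grp X"
    unfolding d_def E_def by (intro grp_mult grp_power grp_cexp sact_grp grp_ginv h\<^sub>0 wW)
  let ?x = "ref_elem g s 0"
  \<comment> \<open>The value prescribed for \<sigma>\<tau>, namely \<omega>^-1 exp(2 T /
    m).\<close>
  let ?Y = "bel m (E ^ 2) (inv\<^bsub>W\<^esub> \<omega>)"
  define D' where "D' = bel m d w"
  have x: "?x \<in> carrier glike"
    using g m3 by (simp add: ref_elem_glike)
  have Y: "?Y \<in> carrier glike"
    unfolding E_def by (intro glike_carrier grp_power grp_cexp) simp
  have D': "D' \<in> carrier glike" unfolding D'_def by (rule glike_carrier[OF d wW])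
  have Y_power: "?Y [^]\<^bsub>glike\<^esub> k = bel m (E ^ (2 * k)) (inv\<^bsub>W\<^esub> \<omega> [^]\<^bsub>W\<^esub> k)" for k :: nat
    unfolding E_def by (rule bel_cexp_power) simp
  note h\<^sub>0_inv = ginv_left[OF grp_Nil[OF h\<^sub>0]] ginv_right[OF grp_Nil[OF h\<^sub>0]]
  have hw: "sact m w h\<^sub>0 * sact m w (ginv h\<^sub>0) = 1"
    by (simp only: sact_simps(7)[symmetric] h\<^sub>0_inv sact_simps(4))
  have solved: "sact m s g * ncexp (var 0) * ginv g = E * h\<^sub>0 * sact m w (ginv h\<^sub>0)"
  proof -
    have "E * h\<^sub>0 * sact m w (ginv h\<^sub>0) = sact m s g * ncexp (var 0) * ginv g
        * (sact m w h\<^sub>0 * ((ginv h\<^sub>0 * h\<^sub>0) * sact m w (ginv h\<^sub>0)))"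
      unfolding eq[symmetric] by (simp only: mult.assoc)
    then show ?thesis by (simp add: h\<^sub>0_inv hw)
  qed
  have vs: "sact m ?v (sact m s f) = sact m w f" for f :: "(int, 'k) ncs"
    unfolding w_def by (rule sact_mult_group[symmetric]) simp_all
  \<comment> \<open>Since \<open>?v\<close> times s is w, this is w applied to the solved series.
    The single factor E, joined to E^(2 p) from the power of \<open>?Y\<close>, gives the exponent m
    in d.\<close>
  have coeff: "sact m ?v (g * sact m s (ncexp (var 0) * ginv g)) = E * sact m w h\<^sub>0 * ginv h\<^sub>0"
  proof -
    have "sact m s (sact m s g * ncexp (var 0) * ginv g) = g * sact m s (ncexp (var 0) * ginv g)"
      by (simp add: sact_simps sact_cancel_square dih_s_square mult.assoc)
    then have "sact m ?v (g * sact m s (ncexp (var 0) * ginv g)) = sact m w (E * h\<^sub>0 * sact m w (ginv h\<^sub>0))"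
      unfolding solved by (metis vs)
    then show ?thesis
      using E_fix[of w 1] by (simp add: sact_simps sact_cancel_square ww)
  qed
  have D'_eq: "?Y [^]\<^bsub>glike\<^esub> p \<otimes>\<^bsub>glike\<^esub> ?x = D'"
    unfolding Y_power ref_elem_def
    by (simp add: glike_mult coeff) (simp add: D'_def d_def w_def p mult.assoc power_Suc2 del: power_Suc)
  have D'_square: "D' \<otimes>\<^bsub>glike\<^esub> D' = ?Y [^]\<^bsub>glike\<^esub> m"
  proof -
    have "sact m w d = E ^ m * h\<^sub>0 * sact m w (ginv h\<^sub>0)"
      unfolding d_def by (simp add: sact_simps E_fix sact_cancel_square ww)
    then have 1: "D' \<otimes>\<^bsub>glike\<^esub> D' = bel m (d * (E ^ m * h\<^sub>0 * sact m w (ginv h\<^sub>0))) \<one>\<^bsub>W\<^esub>"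
      by (simp add: D'_def glike_mult ww)
    \<comment> \<open>The two are inverse to each other, and E^m can be moved past \<open>?A\<close>
      after evaluation.\<close>
    let ?A = "sact m w h\<^sub>0 * ginv h\<^sub>0" and ?B = "h\<^sub>0 * sact m w (ginv h\<^sub>0)"
    have "PsiA m (d * (E ^ m * h\<^sub>0 * sact m w (ginv h\<^sub>0))) = PsiA m (E ^ m * ((?A * E ^ m) * ?B))"
      by (simp only: d_def mult.assoc)
    also have "\<dots> = PsiA m (E ^ m * ((E ^ m * ?A) * ?B))"
      by (rule PsiA_cong_mult[OF HOL.refl PsiA_cong_mult[OF centralD[OF E_central, symmetric] HOL.refl]])
    also have "E ^ m * ((E ^ m * ?A) * ?B) = E ^ (2 * m) * (sact m w h\<^sub>0 * ((ginv h\<^sub>0 * h\<^sub>0) * sact m w (ginv h\<^sub>0)))"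
      by (simp only: mult.assoc power_add mult_2)
    also have "\<dots> = E ^ (2 * m)"
      by (simp add: h\<^sub>0_inv hw)
    finally have "D' \<otimes>\<^bsub>glike\<^esub> D' = bel m (E ^ (2 * m)) \<one>\<^bsub>W\<^esub>"
      unfolding 1 by (rule bel_cong)
    moreover have "inv\<^bsub>W\<^esub> \<omega> [^]\<^bsub>W\<^esub> m = \<one>\<^bsub>W\<^esub>"
      by (simp add: omega_inv_power dih_omega_order)
    ultimately show ?thesis by (simp add: Y_power)
  qed
  \<comment> \<open>The image of \<tau> is defined so that \<sigma>\<tau> has its prescribed value;
    that it is a conjugate of the required form is shown below.\<close>
  let ?y = "inv\<^bsub>glike\<^esub> ?x \<otimes>\<^bsub>glike\<^esub> ?Y"
  have y: "?y \<in> carrier glike" using x Y by simp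
  have xy: "?x \<otimes>\<^bsub>glike\<^esub> ?y = ?Y" using x Y by (simp add: H.m_assoc[symmetric])
  have yY: "?y \<otimes>\<^bsub>glike\<^esub> ?Y [^]\<^bsub>glike\<^esub> p = D'"
    using H.braid_odd[OF x Y p] D'_square unfolding D'_eq by simp
  have conj: "?y \<otimes>\<^bsub>glike\<^esub> D' = D' \<otimes>\<^bsub>glike\<^esub> ?x"
    using x y Y by (subst (1) D'_eq[symmetric]) (simp add: H.m_assoc[symmetric] yY)
  \<comment> \<open>The image of \<tau> is the conjugate of \<open>?x\<close> by D' = d w. Moving w
    to the right past g, with w s w = s' and w(t_0) = t_1, leaves d w(g) as the conjugating
    series.\<close>
  define h where "h = d * sact m w g"
  have h: "h \<in> grp X" unfolding h_def by (intro grp_mult d sact_grp g wW)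
  have ref: "ref_elem h ?s' 1 \<otimes>\<^bsub>glike\<^esub> D' = D' \<otimes>\<^bsub>glike\<^esub> ?x"
  proof -
    have t01: "sact m w (sact m s (ncexp (var 0))) = (ncexp (var 1) :: (int, 'k) ncs)"
    proof -
      have "ren (dperm m 1 (- 1)) (var 0) = (var 1 :: (int, 'k) ncs)"
        using ren_dperm_var[of 1 m "- 1" 0] m3 by (simp add: dperm_def)
      moreover have "ren (dperm m (- 1) 1) (ren (dperm m (- 1) 0) f) = ren (dperm m 1 (- 1)) f" for f :: "(int, 'k) ncs"
        by (simp add: ren_simps(9) dperm_comp)
      ultimately show ?thesis by (simp add: sact_s sact_w ren_ncexp)
    qed
    have d1: "coeff d [] = 1" and g1: "coeff g [] = 1" using d g by (auto intro: grp_Nil)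
    have gh: "ginv h = sact m w (ginv g) * ginv d"
      unfolding h_def using d1 g1 by (simp add: ginv_mult sact_ginv)
    have dd: "sact m ?s' (ginv d) * sact m ?s' d = 1"
      by (simp only: sact_simps(7)[symmetric] ginv_left[OF d1] sact_simps(4))
    have sw: "sact m ?s' (sact m w f) = sact m w (sact m s f)" for f :: "(int, 'k) ncs"
      by (simp add: sact_mult_group[symmetric] s'w)
    have "h * sact m ?s' (ncexp (var 1) * ginv h) * sact m ?s' d
        = d * sact m w g * ncexp (var 1) * sact m w (sact m s (ginv g)) * (sact m ?s' (ginv d) * sact m ?s' d)"
      by (simp add: gh sact_simps refl_fixes_t1[OF m3] sw mult.assoc) (simp add: h_def mult.assoc)
    also have "\<dots> = d * sact m w (g * sact m s (ncexp (var 0) * ginv g))"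
      by (simp add: dd sact_simps t01 mult.assoc)
    finally show ?thesis
      by (simp add: ref_elem_def D'_def glike_mult s'w)
  qed
  have y_eq: "ref_elem h ?s' 1 = ?y"
  proof -
    have "ref_elem h ?s' 1 \<in> carrier glike" using h m3 by (simp add: ref_elem_glike)
    then show ?thesis using ref conj y D' by (metis H.right_cancel)
  qed
  show ?thesis
  proof (rule hopf_morphism_exists[OF g h m3])
    fix \<phi> :: "artin_gen \<Rightarrow> 'k Bhol"
    assume \<phi>: "\<phi> Gen_sigma = ?x" "\<phi> Gen_tau = ref_elem h ?s' 1" "range \<phi> \<subseteq> carrier glike"
    have "(?y \<otimes>\<^bsub>glike\<^esub> ?x) [^]\<^bsub>glike\<^esub> p \<otimes>\<^bsub>glike\<^esub> ?y = ?y \<otimes>\<^bsub>glike\<^esub> (?x \<otimes>\<^bsub>glike\<^esub> ?y) [^]\<^bsub>glike\<^esub> p"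
      by (rule H.pow_conjugate[OF y x, symmetric])
    also have "\<dots> = (?x \<otimes>\<^bsub>glike\<^esub> ?y) [^]\<^bsub>glike\<^esub> p \<otimes>\<^bsub>glike\<^esub> ?x"
      by (simp only: xy yY D'_eq)
    finally show "H.word_eval \<phi> (alternating m (Gen_sigma, True) (Gen_tau, True))
        = H.word_eval \<phi> (alternating m (Gen_tau, True) (Gen_sigma, True))"
      using H.word_eval_alternating_odd[OF \<phi>(3), of p] by (simp only: p[symmetric] \<phi>(1,2) y_eq)
  qed
qed

end

theorem mainTheorem1:
  fixes m :: nat
  assumes "m \<ge> 3"
  shows "\<exists>\<Phi> :: (artin_gen gword set \<Rightarrow> 'k::field_char_0) \<Rightarrow> 'k Bhol.
           \<Phi> \<in> hopf_morphisms m \<and> fundamental_condition m \<Phi>"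
proof -
  interpret dihedral_setting m by unfold_locales (use assms in simp)
  show ?thesis
  proof (cases "even m")
    case True
    then show ?thesis using even_case[OF assms] by (auto elim: evenE)
  next
    case False
    then show ?thesis using odd_case[OF assms] by (auto elim: oddE)
  qed
qed

end
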